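(* Let $K$ be a field of positive characteristic $p$ and let $G$ be a group such that the group algebra $KG$ is Lie nilpotent. Then $KG$ has upper almost maximal Lie nilpotency index, i.e. $t^{L}(KG)=|G'|-p+2$, if and only if one of the following conditions holds: (i) $p=2$, $cl(G)=2$ and $\gamma_2(G)$ is noncyclic of order $4$; (ii) $p=2$, $cl(G)=4$, $\gamma_2(G)\cong C_4\times C_2$ and $\gamma_3(G)\cong C_2\times C_2$; (iii) $p=2$, $cl(G)=4$ and $\gamma_2(G)$ is elementary abelian of order $8$; (iv) $p=3$, $cl(G)=3$ and $\gamma_2(G)$ is elementary abelian of order $9$.
   Context: For an associative algebra $R$ with identity put $[x,y]=xy-yx$ and $[x_1,\ldots,x_n]=[[x_1,\ldots,x_{n-1}],x_n]$. The lower Lie powers of $R$ are $R^{[1]}=R$ and, for $n\ge 2$, $R^{[n]}$ is the two-sided associative ideal generated by all Lie commutators $[x_1,\ldots,x_n]$ with $x_i\in R$. The algebra $R$ is Lie nilpotent if $R^{[m]}=0$ for some $m$. The upper Lie powers of $R$ are defined inductively by $R^{(1)}=R$ and, for $n\ge 2$, $R^{(n)}$ is the two-sided associative ideal generated by all $[x,y]$ with $x\in R^{(n-1)}$, $y\in R$. The upper Lie nilpotency index $t^{L}(R)$ is the minimal integer $n$ with $R^{(n)}=0$. (Known fact: for $K$ a field of characteristic $p>0$, $KG$ is Lie nilpotent if and only if $G$ is nilpotent and its commutator subgroup $G'$ is a finite $p$-group; in that case $t^{L}(KG)$ is finite and $t^{L}(KG)\le |G'|+1$.) A Lie nilpotent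 group algebra $KG$ over a field of characteristic $p>0$ is said to have upper almost maximal Lie nilpotency index if $t^{L}(KG)=|G'|-p+2$. Here $\gamma_1(G)=G$, $\gamma_{i+1}(G)=(\gamma_i(G),G)$ is the lower central series (so $\gamma_2(G)=G'$), $cl(G)$ is the nilpotency class of $G$, and $C_n$ is the cyclic group of order $n$. *)

theory Defs
  imports "HOL-Algebra.Algebra"
begin

definition ring_char :: "('k, 'm) ring_scheme \<Rightarrow> nat" where
  "ring_char R =
     (if \<exists>n::nat>0. [n] \<cdot>\<^bsub>R\<^esub> \<one>\<^bsub>R\<^esub> = \<zero>\<^bsub>R\<^esub>
      then LEAST n. n > 0 \<and> [n] \<cdot>\<^bsub>R\<^esub> \<one>\<^bsub>R\<^esub> = \<zero>\<^bsub>R\<^esub> else 0)"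

definition supp :: "('k, 'm) ring_scheme \<Rightarrow> ('g \<Rightarrow> 'k) \<Rightarrow> 'g set" where
  "supp K f = {g. f g \<noteq> \<zero>\<^bsub>K\<^esub>}"

text \<open>
  An element of the group algebra is the family of its coefficients, extended by zero outside the
  carrier of the group.
\<close>

definition group_algebra ::
    "('k, 'm) ring_scheme \<Rightarrow> ('g, 'n) monoid_scheme \<Rightarrow> ('g \<Rightarrow> 'k) ring" where
  "group_algebra K G =
     \<lparr>carrier = {f \<in> UNIV \<rightarrow> carrier K. finite (supp K f) \<and> supp K f \<subseteq> carrier G},
      monoid.mult = (\<lambda>f h g. if g \<in> carrier G
                      then (\<Oplus>\<^bsub>K\<^esub>x\<in>supp K f. f x \<otimes>\<^bsub>K\<^esub> h (inv\<^bsub>G\<^esub> x \<otimes>\<^bsub>G\<^esub> g)) else \<zero>\<^bsub>K\<^esub>),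
      one = (\<lambda>g. if g = \<one>\<^bsub>G\<^esub> then \<one>\<^bsub>K\<^esub> else \<zero>\<^bsub>K\<^esub>),
      ring.zero = (\<lambda>g. \<zero>\<^bsub>K\<^esub>),
      ring.add = (\<lambda>f h g. f g \<oplus>\<^bsub>K\<^esub> h g)\<rparr>"

lemma (in abelian_monoid) finsum_swap:
  assumes "finite A" "finite B" "\<And>x y. x \<in> A \<Longrightarrow> y \<in> B \<Longrightarrow> f x y \<in> carrier G"
  shows "(\<Oplus>x\<in>A. \<Oplus>y\<in>B. f x y) = (\<Oplus>y\<in>B. \<Oplus>x\<in>A. f x y)"
  using assms(1,3)
proof (induction A rule: finite_induct)
  case empty
  then show ?case by simp
next
  case (insert a A)
  then have "(\<Oplus>y\<in>B. \<Oplus>x\<in>insert a A. f x y) = (\<Oplus>y\<in>B. f a y \<oplus> (\<Oplus>x\<in>A. f x y))"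
    by (intro finsum_cong') (auto simp: Pi_def)
  also have "\<dots> = (\<Oplus>y\<in>B. f a y) \<oplus> (\<Oplus>y\<in>B. \<Oplus>x\<in>A. f x y)"
    using insert by (intro finsum_addf) (auto simp: Pi_def)
  finally show ?case
    using insert by (simp add: Pi_def)
qed

locale group_algebra_over = K: cring K + G: group G
  for K :: "('k, 'm) ring_scheme" and G :: "('g, 'n) monoid_scheme"
begin

abbreviation (input) KG where "KG \<equiv> group_algebra K G"

lemma carrierD:
  assumes "f \<in> carrier KG"
  shows "f g \<in> carrier K" "finite (supp K f)" "supp K f \<subseteq> carrier G"
  using assms by (auto simp: group_algebra_def)

lemma carrierI:
  assumes "\<And>g. f g \<in> carrier K" "finite A" "A \<subseteq> carrier G"
    "\<And>g. g \<notin> A \<Longrightarrow> f g = \<zero>\<^bsub>K\<^esub>"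
  shows "f \<in> carrier KG"
proof -
  have "supp K f \<subseteq> A" using assms(4) by (auto simp: supp_def)
  then show ?thesis using assms finite_subset by (fastforce simp: group_algebra_def)
qed

lemma add_apply: "(f \<oplus>\<^bsub>KG\<^esub> h) g = f g \<oplus>\<^bsub>K\<^esub> h g"
  by (simp add: group_algebra_def)

lemma zero_apply: "\<zero>\<^bsub>KG\<^esub> g = \<zero>\<^bsub>K\<^esub>"
  by (simp add: group_algebra_def)

lemma one_apply: "\<one>\<^bsub>KG\<^esub> g = (if g = \<one>\<^bsub>G\<^esub> then \<one>\<^bsub>K\<^esub> else \<zero>\<^bsub>K\<^esub>)"
  by (simp add: group_algebra_def)

lemma mult_outside: "g \<notin> carrier G \<Longrightarrow> (f \<otimes>\<^bsub>KG\<^esub> h) g = \<zero>\<^bsub>K\<^esub>"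
  by (simp add: group_algebra_def)

lemma mult_apply:
  assumes "f \<in> carrier KG" "h \<in> carrier KG" "finite A" "supp K f \<subseteq> A" "g \<in> carrier G"
  shows "(f \<otimes>\<^bsub>KG\<^esub> h) g = (\<Oplus>\<^bsub>K\<^esub>x\<in>A. f x \<otimes>\<^bsub>K\<^esub> h (inv\<^bsub>G\<^esub> x \<otimes>\<^bsub>G\<^esub> g))"
proof -
  have "(f \<otimes>\<^bsub>KG\<^esub> h) g = (\<Oplus>\<^bsub>K\<^esub>x\<in>supp K f. f x \<otimes>\<^bsub>K\<^esub> h (inv\<^bsub>G\<^esub> x \<otimes>\<^bsub>G\<^esub> g))"
    using assms by (simp add: group_algebra_def)
  also have "\<dots> = (\<Oplus>\<^bsub>K\<^esub>x\<in>A. f x \<otimes>\<^bsub>K\<^esub> h (inv\<^bsub>G\<^esub> x \<otimes>\<^bsub>G\<^esub> g))"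
    using assms(3,4) carrierD(1)[OF assms(1)] carrierD(1)[OF assms(2)]
    by (intro K.add.finprod_mono_neutral_cong_left) (auto simp: supp_def)
  finally show ?thesis .
qed

lemma add_closed:
  assumes "f \<in> carrier KG" "h \<in> carrier KG"
  shows "f \<oplus>\<^bsub>KG\<^esub> h \<in> carrier KG"
  using carrierD[OF assms(1)] carrierD[OF assms(2)]
  by (intro carrierI[where A = "supp K f \<union> supp K h"]) (auto simp: add_apply supp_def)

lemma zero_closed: "\<zero>\<^bsub>KG\<^esub> \<in> carrier KG"
  by (intro carrierI[where A = "{}"]) (auto simp: zero_apply)

lemma one_closed: "\<one>\<^bsub>KG\<^esub> \<in> carrier KG"
  by (intro carrierI[where A = "{\<one>\<^bsub>G\<^esub>}"]) (auto simp: one_apply)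

lemma mult_closed_coeff:
  assumes "f \<in> carrier KG" "h \<in> carrier KG"
  shows "(f \<otimes>\<^bsub>KG\<^esub> h) g \<in> carrier K"
  using carrierD[OF assms(1)] carrierD[OF assms(2)]
  by (cases "g \<in> carrier G") (auto simp: mult_outside mult_apply[OF assms] intro!: K.finsum_closed)

lemma supp_mult:
  assumes "f \<in> carrier KG" "h \<in> carrier KG"
  shows "supp K (f \<otimes>\<^bsub>KG\<^esub> h) \<subseteq> (\<lambda>(x, y). x \<otimes>\<^bsub>G\<^esub> y) ` (supp K f \<times> supp K h)"
proof
  fix g assume g: "g \<in> supp K (f \<otimes>\<^bsub>KG\<^esub> h)"
  note f = carrierD[OF assms(1)] and h = carrierD[OF assms(2)]
  from g have gG: "g \<in> carrier G" using mult_outside by (auto simp: supp_def)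
  have "\<exists>x\<in>supp K f. inv\<^bsub>G\<^esub> x \<otimes>\<^bsub>G\<^esub> g \<in> supp K h"
  proof (rule ccontr)
    assume "\<not> ?thesis"
    then have "(\<Oplus>\<^bsub>K\<^esub>x\<in>supp K f. f x \<otimes>\<^bsub>K\<^esub> h (inv\<^bsub>G\<^esub> x \<otimes>\<^bsub>G\<^esub> g)) = \<zero>\<^bsub>K\<^esub>"
      using f(1) by (intro K.add.finprod_one_eqI) (auto simp: supp_def)
    with g show False using mult_apply[OF assms f(2) order.refl gG] by (simp add: supp_def)
  qed
  then obtain x where x: "x \<in> supp K f" "inv\<^bsub>G\<^esub> x \<otimes>\<^bsub>G\<^esub> g \<in> supp K h" by blast
  then have "g = x \<otimes>\<^bsub>G\<^esub> (inv\<^bsub>G\<^esub> x \<otimes>\<^bsub>G\<^esub> g)"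
    using f(3) gG by (metis G.inv_closed G.inv_solve_left' G.m_closed subsetD)
  with x show "g \<in> (\<lambda>(x, y). x \<otimes>\<^bsub>G\<^esub> y) ` (supp K f \<times> supp K h)" by force
qed

lemma mult_closed:
  assumes "f \<in> carrier KG" "h \<in> carrier KG"
  shows "f \<otimes>\<^bsub>KG\<^esub> h \<in> carrier KG"
proof (rule carrierI[where A = "(\<lambda>(x, y). x \<otimes>\<^bsub>G\<^esub> y) ` (supp K f \<times> supp K h)"])
  show "(f \<otimes>\<^bsub>KG\<^esub> h) g = \<zero>\<^bsub>K\<^esub>" if "g \<notin> (\<lambda>(x, y). x \<otimes>\<^bsub>G\<^esub> y) ` (supp K f \<times> supp K h)" for g
    using that supp_mult[OF assms] by (auto simp: supp_def)
qed (use carrierD[OF assms(1)] carrierD[OF assms(2)] mult_closed_coeff[OF assms] in auto)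

lemma mult_assoc:
  assumes f: "f \<in> carrier KG" and h: "h \<in> carrier KG" and k: "k \<in> carrier KG"
  shows "(f \<otimes>\<^bsub>KG\<^esub> h) \<otimes>\<^bsub>KG\<^esub> k = f \<otimes>\<^bsub>KG\<^esub> (h \<otimes>\<^bsub>KG\<^esub> k)"
proof
  fix g
  note fD = carrierD[OF f] and hD = carrierD[OF h] and kD = carrierD[OF k]
  define A where "A = supp K f"
  define B where "B = supp K h"
  define U where "U = (\<lambda>(x, y). x \<otimes>\<^bsub>G\<^esub> y) ` (A \<times> B)"
  have A: "finite A" "A \<subseteq> carrier G" and B: "finite B" "B \<subseteq> carrier G"
    using fD hD by (auto simp: A_def B_def)
  have U: "finite U" "U \<subseteq> carrier G" using A B by (auto simp: U_def)
  show "((f \<otimes>\<^bsub>KG\<^esub> h) \<otimes>\<^bsub>KG\<^esub> k) g = (f \<otimes>\<^bsub>KG\<^esub> (h \<otimes>\<^bsub>KG\<^esub> k)) g"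
  proof (cases "g \<in> carrier G")
    case False
    then show ?thesis by (simp add: mult_outside)
  next
    case g: True
    have inner: "(\<Oplus>\<^bsub>K\<^esub>u\<in>U. h (inv\<^bsub>G\<^esub> x \<otimes>\<^bsub>G\<^esub> u) \<otimes>\<^bsub>K\<^esub> k (inv\<^bsub>G\<^esub> u \<otimes>\<^bsub>G\<^esub> g)) =
        (h \<otimes>\<^bsub>KG\<^esub> k) (inv\<^bsub>G\<^esub> x \<otimes>\<^bsub>G\<^esub> g)" if x: "x \<in> A" for x
    proof -
      have xG: "x \<in> carrier G" using x A by auto
      have inj: "inj_on (\<lambda>y. x \<otimes>\<^bsub>G\<^esub> y) B"
        using B xG by (intro inj_onI) (meson G.l_cancel subsetD)
      have "(\<Oplus>\<^bsub>K\<^esub>u\<in>U. h (inv\<^bsub>G\<^esub> x \<otimes>\<^bsub>G\<^esub> u) \<otimes>\<^bsub>K\<^esub> k (inv\<^bsub>G\<^esub> u \<otimes>\<^bsub>G\<^esub> g)) =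
          (\<Oplus>\<^bsub>K\<^esub>u\<in>(\<lambda>y. x \<otimes>\<^bsub>G\<^esub> y) ` B. h (inv\<^bsub>G\<^esub> x \<otimes>\<^bsub>G\<^esub> u) \<otimes>\<^bsub>K\<^esub> k (inv\<^bsub>G\<^esub> u \<otimes>\<^bsub>G\<^esub> g))"
      proof (intro K.add.finprod_mono_neutral_cong_right)
        fix u assume u: "u \<in> U - (\<lambda>y. x \<otimes>\<^bsub>G\<^esub> y) ` B"
        then have uG: "u \<in> carrier G" using U by auto
        have "inv\<^bsub>G\<^esub> x \<otimes>\<^bsub>G\<^esub> u \<notin> B"
        proof
          assume "inv\<^bsub>G\<^esub> x \<otimes>\<^bsub>G\<^esub> u \<in> B"
          moreover have "x \<otimes>\<^bsub>G\<^esub> (inv\<^bsub>G\<^esub> x \<otimes>\<^bsub>G\<^esub> u) = u"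
            using xG uG by (simp add: G.m_assoc[symmetric])
          ultimately show False using u by force
        qed
        then show "h (inv\<^bsub>G\<^esub> x \<otimes>\<^bsub>G\<^esub> u) \<otimes>\<^bsub>K\<^esub> k (inv\<^bsub>G\<^esub> u \<otimes>\<^bsub>G\<^esub> g) = \<zero>\<^bsub>K\<^esub>"
          using kD by (simp add: B_def supp_def)
      qed (use x U fD hD kD in \<open>auto simp: U_def\<close>)
      also have "\<dots> = (\<Oplus>\<^bsub>K\<^esub>y\<in>B. h (inv\<^bsub>G\<^esub> x \<otimes>\<^bsub>G\<^esub> (x \<otimes>\<^bsub>G\<^esub> y)) \<otimes>\<^bsub>K\<^esub> k (inv\<^bsub>G\<^esub> (x \<otimes>\<^bsub>G\<^esub> y) \<otimes>\<^bsub>G\<^esub> g))"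
        using inj hD kD by (intro K.finsum_reindex) auto
      also have "\<dots> = (\<Oplus>\<^bsub>K\<^esub>y\<in>B. h y \<otimes>\<^bsub>K\<^esub> k (inv\<^bsub>G\<^esub> y \<otimes>\<^bsub>G\<^esub> (inv\<^bsub>G\<^esub> x \<otimes>\<^bsub>G\<^esub> g)))"
      proof (intro K.finsum_cong')
        fix y assume "y \<in> B"
        then have yG: "y \<in> carrier G" using B by auto
        show "h (inv\<^bsub>G\<^esub> x \<otimes>\<^bsub>G\<^esub> (x \<otimes>\<^bsub>G\<^esub> y)) \<otimes>\<^bsub>K\<^esub> k (inv\<^bsub>G\<^esub> (x \<otimes>\<^bsub>G\<^esub> y) \<otimes>\<^bsub>G\<^esub> g) =
            h y \<otimes>\<^bsub>K\<^esub> k (inv\<^bsub>G\<^esub> y \<otimes>\<^bsub>G\<^esub> (inv\<^bsub>G\<^esub> x \<otimes>\<^bsub>G\<^esub> g))"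
          using xG yG g by (simp add: G.m_assoc[symmetric] G.inv_mult_group)
      qed (use hD kD in auto)
      also have "\<dots> = (h \<otimes>\<^bsub>KG\<^esub> k) (inv\<^bsub>G\<^esub> x \<otimes>\<^bsub>G\<^esub> g)"
        using mult_apply[OF h k B(1), of "inv\<^bsub>G\<^esub> x \<otimes>\<^bsub>G\<^esub> g"] xG g by (simp add: B_def)
      finally show ?thesis .
    qed
    have "((f \<otimes>\<^bsub>KG\<^esub> h) \<otimes>\<^bsub>KG\<^esub> k) g = (\<Oplus>\<^bsub>K\<^esub>u\<in>U. (f \<otimes>\<^bsub>KG\<^esub> h) u \<otimes>\<^bsub>K\<^esub> k (inv\<^bsub>G\<^esub> u \<otimes>\<^bsub>G\<^esub> g))"
      using mult_apply[OF mult_closed[OF f h] k U(1) _ g] supp_mult[OF f h]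
      by (simp add: U_def A_def B_def)
    also have "\<dots> = (\<Oplus>\<^bsub>K\<^esub>u\<in>U. \<Oplus>\<^bsub>K\<^esub>x\<in>A. f x \<otimes>\<^bsub>K\<^esub> (h (inv\<^bsub>G\<^esub> x \<otimes>\<^bsub>G\<^esub> u) \<otimes>\<^bsub>K\<^esub> k (inv\<^bsub>G\<^esub> u \<otimes>\<^bsub>G\<^esub> g)))"
    proof (intro K.finsum_cong')
      fix u assume "u \<in> U"
      then have uG: "u \<in> carrier G" using U by auto
      have "(f \<otimes>\<^bsub>KG\<^esub> h) u = (\<Oplus>\<^bsub>K\<^esub>x\<in>A. f x \<otimes>\<^bsub>K\<^esub> h (inv\<^bsub>G\<^esub> x \<otimes>\<^bsub>G\<^esub> u))"
        using mult_apply[OF f h A(1) _ uG] by (simp add: A_def)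
      then show "(f \<otimes>\<^bsub>KG\<^esub> h) u \<otimes>\<^bsub>K\<^esub> k (inv\<^bsub>G\<^esub> u \<otimes>\<^bsub>G\<^esub> g) =
          (\<Oplus>\<^bsub>K\<^esub>x\<in>A. f x \<otimes>\<^bsub>K\<^esub> (h (inv\<^bsub>G\<^esub> x \<otimes>\<^bsub>G\<^esub> u) \<otimes>\<^bsub>K\<^esub> k (inv\<^bsub>G\<^esub> u \<otimes>\<^bsub>G\<^esub> g)))"
        using A fD hD kD by (simp add: K.finsum_ldistr Pi_def K.m_assoc)
    qed (use fD hD kD in \<open>auto intro!: K.finsum_closed\<close>)
    also have "\<dots> = (\<Oplus>\<^bsub>K\<^esub>x\<in>A. \<Oplus>\<^bsub>K\<^esub>u\<in>U. f x \<otimes>\<^bsub>K\<^esub> (h (inv\<^bsub>G\<^esub> x \<otimes>\<^bsub>G\<^esub> u) \<otimes>\<^bsub>K\<^esub> k (inv\<^bsub>G\<^esub> u \<otimes>\<^bsub>G\<^esub> g)))"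
      using U A fD hD kD by (intro K.finsum_swap) auto
    also have "\<dots> = (\<Oplus>\<^bsub>K\<^esub>x\<in>A. f x \<otimes>\<^bsub>K\<^esub> (h \<otimes>\<^bsub>KG\<^esub> k) (inv\<^bsub>G\<^esub> x \<otimes>\<^bsub>G\<^esub> g))"
    proof (intro K.finsum_cong')
      fix x assume "x \<in> A"
      then show "(\<Oplus>\<^bsub>K\<^esub>u\<in>U. f x \<otimes>\<^bsub>K\<^esub> (h (inv\<^bsub>G\<^esub> x \<otimes>\<^bsub>G\<^esub> u) \<otimes>\<^bsub>K\<^esub> k (inv\<^bsub>G\<^esub> u \<otimes>\<^bsub>G\<^esub> g))) =
          f x \<otimes>\<^bsub>K\<^esub> (h \<otimes>\<^bsub>KG\<^esub> k) (inv\<^bsub>G\<^esub> x \<otimes>\<^bsub>G\<^esub> g)"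
        using U fD hD kD inner by (simp add: K.finsum_rdistr[symmetric] Pi_def)
    qed (use fD mult_closed_coeff[OF h k] in auto)
    also have "\<dots> = (f \<otimes>\<^bsub>KG\<^esub> (h \<otimes>\<^bsub>KG\<^esub> k)) g"
      using mult_apply[OF f mult_closed[OF h k] A(1) _ g] by (simp add: A_def)
    finally show ?thesis .
  qed
qed

lemma one_mult:
  assumes f: "f \<in> carrier KG"
  shows "\<one>\<^bsub>KG\<^esub> \<otimes>\<^bsub>KG\<^esub> f = f"
proof
  fix g
  note fD = carrierD[OF f]
  show "(\<one>\<^bsub>KG\<^esub> \<otimes>\<^bsub>KG\<^esub> f) g = f g"
  proof (cases "g \<in> carrier G")
    case False
    then have "f g = \<zero>\<^bsub>K\<^esub>" using fD(3) by (auto simp: supp_def)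
    with False show ?thesis by (simp add: mult_outside)
  next
    case True
    then have "(\<one>\<^bsub>KG\<^esub> \<otimes>\<^bsub>KG\<^esub> f) g =
        (\<Oplus>\<^bsub>K\<^esub>x\<in>{\<one>\<^bsub>G\<^esub>}. \<one>\<^bsub>KG\<^esub> x \<otimes>\<^bsub>K\<^esub> f (inv\<^bsub>G\<^esub> x \<otimes>\<^bsub>G\<^esub> g))"
      by (intro mult_apply one_closed f) (auto simp: supp_def one_apply split: if_splits)
    then show ?thesis using True fD by (simp add: one_apply)
  qed
qed

lemma mult_one:
  assumes f: "f \<in> carrier KG"
  shows "f \<otimes>\<^bsub>KG\<^esub> \<one>\<^bsub>KG\<^esub> = f"
proof
  fix g
  note fD = carrierD[OF f]
  show "(f \<otimes>\<^bsub>KG\<^esub> \<one>\<^bsub>KG\<^esub>) g = f g"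
  proof (cases "g \<in> carrier G")
    case False
    then have "f g = \<zero>\<^bsub>K\<^esub>" using fD(3) by (auto simp: supp_def)
    with False show ?thesis by (simp add: mult_outside)
  next
    case True
    define A where "A = insert g (supp K f)"
    have A: "finite A" "A \<subseteq> carrier G" using True fD by (auto simp: A_def)
    have "(f \<otimes>\<^bsub>KG\<^esub> \<one>\<^bsub>KG\<^esub>) g =
        (\<Oplus>\<^bsub>K\<^esub>x\<in>A. f x \<otimes>\<^bsub>K\<^esub> \<one>\<^bsub>KG\<^esub> (inv\<^bsub>G\<^esub> x \<otimes>\<^bsub>G\<^esub> g))"
      using A True by (intro mult_apply one_closed f) (auto simp: A_def)
    also have "\<dots> = (\<Oplus>\<^bsub>K\<^esub>x\<in>A. if g = x then f x else \<zero>\<^bsub>K\<^esub>)"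
    proof (intro K.finsum_cong')
      fix x assume "x \<in> A"
      then have xG: "x \<in> carrier G" using A by auto
      then have "inv\<^bsub>G\<^esub> x \<otimes>\<^bsub>G\<^esub> g = \<one>\<^bsub>G\<^esub> \<longleftrightarrow> g = x"
        using True by (metis G.inv_closed G.inv_equality G.inv_inv G.l_inv)
      then show "f x \<otimes>\<^bsub>K\<^esub> \<one>\<^bsub>KG\<^esub> (inv\<^bsub>G\<^esub> x \<otimes>\<^bsub>G\<^esub> g) = (if g = x then f x else \<zero>\<^bsub>K\<^esub>)"
        using fD by (simp add: one_apply)
    qed (use fD in auto)
    also have "\<dots> = f g"
      using A fD by (intro K.finsum_singleton) (auto simp: A_def)
    finally show ?thesis .
  qed
qed

lemma mult_distrib_left:
  assumes f: "f \<in> carrier KG" and h: "h \<in> carrier KG" and k: "k \<in> carrier KG"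
  shows "k \<otimes>\<^bsub>KG\<^esub> (f \<oplus>\<^bsub>KG\<^esub> h) = k \<otimes>\<^bsub>KG\<^esub> f \<oplus>\<^bsub>KG\<^esub> k \<otimes>\<^bsub>KG\<^esub> h"
proof
  fix g
  note fD = carrierD[OF f] and hD = carrierD[OF h] and kD = carrierD[OF k]
  show "(k \<otimes>\<^bsub>KG\<^esub> (f \<oplus>\<^bsub>KG\<^esub> h)) g = (k \<otimes>\<^bsub>KG\<^esub> f \<oplus>\<^bsub>KG\<^esub> k \<otimes>\<^bsub>KG\<^esub> h) g"
  proof (cases "g \<in> carrier G")
    case False
    then show ?thesis by (simp add: mult_outside add_apply)
  next
    case True
    show ?thesis
      using fD hD kD
      by (simp add: add_apply mult_apply[OF k add_closed[OF f h] kD(2) order.refl True]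
          mult_apply[OF k f kD(2) order.refl True] mult_apply[OF k h kD(2) order.refl True]
          K.r_distr K.finsum_addf Pi_def)
  qed
qed

lemma mult_distrib_right:
  assumes f: "f \<in> carrier KG" and h: "h \<in> carrier KG" and k: "k \<in> carrier KG"
  shows "(f \<oplus>\<^bsub>KG\<^esub> h) \<otimes>\<^bsub>KG\<^esub> k = f \<otimes>\<^bsub>KG\<^esub> k \<oplus>\<^bsub>KG\<^esub> h \<otimes>\<^bsub>KG\<^esub> k"
proof
  fix g
  note fD = carrierD[OF f] and hD = carrierD[OF h] and kD = carrierD[OF k]
  define A where "A = supp K f \<union> supp K h"
  have A: "finite A" "supp K f \<subseteq> A" "supp K h \<subseteq> A" "supp K (f \<oplus>\<^bsub>KG\<^esub> h) \<subseteq> A"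
    using fD hD by (auto simp: A_def supp_def add_apply)
  show "((f \<oplus>\<^bsub>KG\<^esub> h) \<otimes>\<^bsub>KG\<^esub> k) g = (f \<otimes>\<^bsub>KG\<^esub> k \<oplus>\<^bsub>KG\<^esub> h \<otimes>\<^bsub>KG\<^esub> k) g"
  proof (cases "g \<in> carrier G")
    case False
    then show ?thesis by (simp add: mult_outside add_apply)
  next
    case True
    show ?thesis
      using fD hD kD
      by (simp add: add_apply mult_apply[OF add_closed[OF f h] k A(1,4) True]
          mult_apply[OF f k A(1,2) True] mult_apply[OF h k A(1,3) True]
          K.l_distr K.finsum_addf Pi_def)
  qed
qed

text \<open>
  The locale \<open>ideal\<close> includes \<open>ring\<close>, so generated ideals of \<open>KG\<close> would be meaningless without this.
\<close>

lemma ring_group_algebra: "ring (group_algebra K G)"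
proof (rule ringI)
  show "abelian_group KG"
  proof (rule abelian_groupI)
    fix f assume f: "f \<in> carrier KG"
    note fD = carrierD[OF f]
    show "\<exists>h\<in>carrier KG. h \<oplus>\<^bsub>KG\<^esub> f = \<zero>\<^bsub>KG\<^esub>"
    proof (intro bexI[of _ "\<lambda>g. \<ominus>\<^bsub>K\<^esub> f g"])
      show "(\<lambda>g. \<ominus>\<^bsub>K\<^esub> f g) \<in> carrier KG"
        using fD by (intro carrierI[where A = "supp K f"]) (auto simp: supp_def)
    qed (use fD in \<open>auto simp: fun_eq_iff add_apply zero_apply K.l_neg\<close>)
  qed (auto simp: fun_eq_iff add_apply zero_apply carrierD(1) add_closed[unfolded add_apply]
      zero_closed intro!: add_closed K.a_assoc K.a_comm)
  show "monoid KG"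
    by (rule monoidI) (auto intro: mult_closed one_closed mult_assoc one_mult mult_one)
qed (auto intro: mult_distrib_left mult_distrib_right)

end

definition lie_bracket :: "('a, 'm) ring_scheme \<Rightarrow> 'a \<Rightarrow> 'a \<Rightarrow> 'a" where
  "lie_bracket R x y = x \<otimes>\<^bsub>R\<^esub> y \<ominus>\<^bsub>R\<^esub> y \<otimes>\<^bsub>R\<^esub> x"

text \<open>Left-normed; the value on the empty list is irrelevant.\<close>

fun lie_commutator :: "('a, 'm) ring_scheme \<Rightarrow> 'a list \<Rightarrow> 'a" where
  "lie_commutator R [] = \<zero>\<^bsub>R\<^esub>"
| "lie_commutator R (x # xs) = foldl (lie_bracket R) x xs"

text \<open>
  Both series start at index 1; the value at index 0 is the whole ring by convention. Recall that
  \<open>Idl\<close> is the two-sided ideal generated by a set.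
\<close>

definition lower_Lie_power :: "('a, 'm) ring_scheme \<Rightarrow> nat \<Rightarrow> 'a set" where
  "lower_Lie_power R n =
     (if n \<le> 1 then carrier R
      else Idl\<^bsub>R\<^esub> {lie_commutator R xs | xs. length xs = n \<and> set xs \<subseteq> carrier R})"

fun upper_Lie_power :: "('a, 'm) ring_scheme \<Rightarrow> nat \<Rightarrow> 'a set" where
  "upper_Lie_power R 0 = carrier R"
| "upper_Lie_power R (Suc 0) = carrier R"
| "upper_Lie_power R (Suc (Suc n)) =
     Idl\<^bsub>R\<^esub> {lie_bracket R x y | x y. x \<in> upper_Lie_power R (Suc n) \<and> y \<in> carrier R}"

definition Lie_nilpotent :: "('a, 'm) ring_scheme \<Rightarrow> bool" where
  "Lie_nilpotent R \<longleftrightarrow> (\<exists>m\<ge>1. lower_Lie_power R m = {\<zero>\<^bsub>R\<^esub>})"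

text \<open>Meaningful only if some upper Lie power of the ring vanishes.\<close>

definition upper_Lie_nilpotency_index :: "('a, 'm) ring_scheme \<Rightarrow> nat" where
  "upper_Lie_nilpotency_index R = (LEAST n. n \<ge> 1 \<and> upper_Lie_power R n = {\<zero>\<^bsub>R\<^esub>})"

text \<open>
  The equation is stated over the integers because \<open>card G' - p + 2\<close> would be truncated on the
  naturals when \<open>G'\<close> is trivial.
\<close>

definition upper_almost_maximal ::
    "('k, 'm) ring_scheme \<Rightarrow> ('g, 'n) monoid_scheme \<Rightarrow> bool" where
  "upper_almost_maximal K G \<longleftrightarrow>
     int (upper_Lie_nilpotency_index (group_algebra K G)) =
       int (card (derived G (carrier G))) - int (ring_char K) + 2"

text \<open>
  The commutator convention is the one used by \<open>derived\<close>; replacing it by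
  \<open>x\<inverse> y\<inverse> x y\<close> yields the same subgroups.
\<close>

definition commutator_subgroup ::
    "('g, 'n) monoid_scheme \<Rightarrow> 'g set \<Rightarrow> 'g set \<Rightarrow> 'g set" where
  "commutator_subgroup G H L =
     generate G (\<Union>x\<in>H. \<Union>y\<in>L. {x \<otimes>\<^bsub>G\<^esub> y \<otimes>\<^bsub>G\<^esub> inv\<^bsub>G\<^esub> x \<otimes>\<^bsub>G\<^esub> inv\<^bsub>G\<^esub> y})"

text \<open>Indexed from 1; the value at index 0 is the whole group by convention.\<close>

fun lower_central :: "('g, 'n) monoid_scheme \<Rightarrow> nat \<Rightarrow> 'g set" where
  "lower_central G 0 = carrier G"
| "lower_central G (Suc 0) = carrier G"
| "lower_central G (Suc (Suc n)) = commutator_subgroup G (lower_central G (Suc n)) (carrier G)"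

lemma lower_central_2: "lower_central G 2 = derived G (carrier G)"
  by (simp add: numeral_2_eq_2 commutator_subgroup_def derived_def)

text \<open>Meaningful only for nilpotent groups.\<close>

definition nilpotency_class :: "('g, 'n) monoid_scheme \<Rightarrow> nat" where
  "nilpotency_class G = (LEAST c. lower_central G (Suc c) = {\<one>\<^bsub>G\<^esub>})"

definition lower_central_group :: "('g, 'n) monoid_scheme \<Rightarrow> nat \<Rightarrow> ('g, 'n) monoid_scheme" where
  "lower_central_group G n = G\<lparr>carrier := lower_central G n\<rparr>"

definition elementary_abelian :: "nat \<Rightarrow> ('g, 'n) monoid_scheme \<Rightarrow> bool" where
  "elementary_abelian p H \<longleftrightarrow> comm_group H \<and> (\<forall>x\<in>carrier H. x [^]\<^bsub>H\<^esub> p = \<one>\<^bsub>H\<^esub>)"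

end

theory Submission
  imports Defs
begin

text \<open>
  Write \<open>R = KG\<close>. In a Lie nilpotent ring \<open>R^[3] R^[n] \<subseteq> R^[n+1]\<close>, so \<open>R^[3]\<close> is nilpotent. As few group
  elements \<open>e\<close> annihilate a given nonzero element by \<open>e - 1\<close>, each element of \<open>G\<close> has boundedly many
  commutators; hence \<open>G'\<close> is finite, the ideal generated by \<open>[R, R]\<close> is nilpotent and the upper Lie
  powers vanish.

  For every descending series \<open>H\<close> of normal subgroups of \<open>G\<close> with \<open>H 1 = G'\<close>, \<open>(H i, G) \<subseteq> H (i+1)\<close>,
  \<open>(H i, H j) \<subseteq> H (i+j)\<close>, \<open>(H i)^p \<subseteq> H (p i)\<close> that reaches \<open>1\<close>, the upper Lie powers lie in the filtration
  in which \<open>x - 1\<close> has weight \<open>i\<close> for \<open>x \<in> H i\<close>. Passing to subgroups of index \<open>p\<close> and rewriting monomials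
  as in the Poincare-Birkhoff-Witt theorem gives \<open>t^L(R) \<le> 2 + (p-1) \<Sum> log_p |H i|\<close>. Equality holds for the Lie
  dimension series, which is therefore minimal among such series.

  Almost maximal index fixes the sum of the heights \<open>log_p |H i|\<close> to be one less than its largest possible
  value, which determines the heights; minimality then leaves only \<open>(p, |G'|) = (2, 4), (2, 8), (3, 9)\<close>.
\<close>

text \<open>The known facts on Lie nilpotent group algebras are proved here, not assumed:
  \<open>upper_Lie_nilpotency_index\<close> is a \<open>LEAST\<close>, so it means something only
  once some upper Lie power is known to vanish, and the heights need \<open>G'\<close> to be finite.
  Nilpotency of \<open>R^[3]\<close> alone is too weak. The gap to \<open>R^[2]\<close> is closed by
  the pigeonhole principle: a long product of brackets of group elements repeats one of finitely
  many group commutators, and such a repetition puts the product into \<open>R^[3]\<close>.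

  Weight \<open>w\<close> corresponds to the upper Lie power \<open>w + 1\<close>, which explains
  the summand 2 in the bound. A subgroup step at depth \<open>i\<close> adds \<open>(p-1) i\<close>
  to the top weight, namely \<open>p-1\<close> for each of the \<open>i\<close> terms that grow by a
  factor \<open>p\<close>. With \<open>|G'| = p^n\<close> the heights of the Lie dimension series
  sum to at most \<open>1 + p + ... + p^(n-1)\<close>, which makes the index at most
  \<open>|G'| + 1\<close>; lowering the sum by one subtracts \<open>p-1\<close> and gives
  \<open>|G'| - p + 2\<close>, the next possible value.\<close>

context ring begin

section \<open>Two-sided ideals, Lie brackets and the lower Lie powers\<close>

lemma ideal_of_closed:
  assumes "A \<subseteq> carrier R" "\<zero> \<in> A" "\<And>a b. a \<in> A \<Longrightarrow> b \<in> A \<Longrightarrow> a \<oplus> b \<in> A"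
    and l: "\<And>a r. a \<in> A \<Longrightarrow> r \<in> carrier R \<Longrightarrow> r \<otimes> a \<in> A"
    and r: "\<And>a r. a \<in> A \<Longrightarrow> r \<in> carrier R \<Longrightarrow> a \<otimes> r \<in> A"
  shows "ideal A R"
proof (rule idealI)
  show "ring R" by (rule ring_axioms)
  show "subgroup A (add_monoid R)"
  proof (rule add.subgroupI)
    fix a assume a: "a \<in> A"
    then have "(\<ominus> \<one>) \<otimes> a \<in> A" by (intro l) auto
    then show "\<ominus> a \<in> A" using a assms(1) by (simp add: l_minus subset_iff)
  qed (use assms in auto)
qed (use l r in auto)

text \<open>The left factors \<open>a\<close> that satisfy the condition against \<open>V\<close>
  form an ideal, and then so do the right factors \<open>b\<close> that work against
  \<open>Idl U\<close>. Outer coefficients are absorbed by \<open>I\<close>, so only the coefficient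
  \<open>r\<close> between two generators has to be tested.\<close>

lemma genideal_mult_mem:
  assumes U: "U \<subseteq> carrier R" and V: "V \<subseteq> carrier R" and I: "ideal I R"
    and UV: "\<And>x r y. x \<in> U \<Longrightarrow> r \<in> carrier R \<Longrightarrow> y \<in> V \<Longrightarrow> x \<otimes> (r \<otimes> y) \<in> I"
    and a: "a \<in> Idl U" and b: "b \<in> Idl V"
  shows "a \<otimes> b \<in> I"
proof -
  interpret I: ideal I R by (rule I)
  have Uc: "x \<in> carrier R" if "x \<in> U" for x using that U by blast
  have Vc: "y \<in> carrier R" if "y \<in> V" for y using that V by blast
  define A where "A = {a \<in> carrier R. \<forall>r\<in>carrier R. \<forall>y\<in>V. a \<otimes> (r \<otimes> y) \<in> I}"
  have AD: "a \<in> carrier R" "r \<in> carrier R \<Longrightarrow> y \<in> V \<Longrightarrow> a \<otimes> (r \<otimes> y) \<in> I"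
    if "a \<in> A" for a r y using that by (auto simp: A_def)
  have AI: "a \<in> A" if "a \<in> carrier R" "\<And>r y. r \<in> carrier R \<Longrightarrow> y \<in> V \<Longrightarrow> a \<otimes> (r \<otimes> y) \<in> I" for a
    using that by (auto simp: A_def)
  have "ideal A R"
  proof (rule ideal_of_closed)
    show "A \<subseteq> carrier R" "\<zero> \<in> A" using Vc I.zero_closed by (auto simp: A_def)
    fix a b assume "a \<in> A" "b \<in> A"
    then show "a \<oplus> b \<in> A"
      by (intro AI) (simp_all add: AD Vc l_distr I.a_closed)
  next
    fix a s assume a: "a \<in> A" and s: "s \<in> carrier R"
    show "s \<otimes> a \<in> A"
      using a s by (intro AI) (simp_all add: AD Vc m_assoc I.I_l_closed)
    show "a \<otimes> s \<in> A"
    proof (rule AI)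
      fix r y assume r: "r \<in> carrier R" and y: "y \<in> V"
      have "a \<otimes> ((s \<otimes> r) \<otimes> y) \<in> I" using AD(2)[OF a, of "s \<otimes> r" y] s r y by simp
      then show "a \<otimes> s \<otimes> (r \<otimes> y) \<in> I" using AD(1)[OF a] s r Vc[OF y] by (simp add: m_assoc)
    qed (use AD(1)[OF a] s in simp)
  qed
  then have A: "Idl U \<subseteq> A"
    by (rule genideal_minimal) (use Uc UV in \<open>auto intro!: AI\<close>)
  interpret U: ideal "Idl U" R by (rule genideal_ideal[OF U])
  define B where "B = {b \<in> carrier R. \<forall>a\<in>Idl U. a \<otimes> b \<in> I}"
  have BD: "b \<in> carrier R" "a \<in> Idl U \<Longrightarrow> a \<otimes> b \<in> I" if "b \<in> B" for a b
    using that by (auto simp: B_def)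
  have BI: "b \<in> B" if "b \<in> carrier R" "\<And>a. a \<in> Idl U \<Longrightarrow> a \<otimes> b \<in> I" for b
    using that by (auto simp: B_def)
  have "ideal B R"
  proof (rule ideal_of_closed)
    show "B \<subseteq> carrier R" "\<zero> \<in> B" using U.Icarr I.zero_closed by (auto simp: B_def)
    fix a b assume "a \<in> B" "b \<in> B"
    then show "a \<oplus> b \<in> B"
      by (intro BI) (simp_all add: BD U.Icarr r_distr I.a_closed)
  next
    fix b s assume b: "b \<in> B" and s: "s \<in> carrier R"
    show "b \<otimes> s \<in> B"
      by (rule BI) (simp_all add: BD[OF b] s U.Icarr m_assoc[symmetric] I.I_r_closed)
    show "s \<otimes> b \<in> B"
    proof (rule BI)
      fix a assume a: "a \<in> Idl U"
      have "(a \<otimes> s) \<otimes> b \<in> I" by (rule BD(2)[OF b]) (rule U.I_r_closed[OF a s])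
      then show "a \<otimes> (s \<otimes> b) \<in> I" using U.Icarr[OF a] s BD(1)[OF b] by (simp add: m_assoc)
    qed (use BD(1)[OF b] s in simp)
  qed
  moreover have "V \<subseteq> B"
  proof
    fix y assume y: "y \<in> V"
    show "y \<in> B"
    proof (rule BI[OF Vc[OF y]])
      fix a assume "a \<in> Idl U"
      with A have "a \<in> A" by blast
      from AD(2)[OF this one_closed y] show "a \<otimes> y \<in> I" using Vc[OF y] by simp
    qed
  qed
  ultimately have "Idl V \<subseteq> B" by (rule genideal_minimal)
  with b have "b \<in> B" by blast
  from BD(2)[OF this a] show ?thesis .
qed

lemma lie_bracket_closed [simp, intro]:
  "x \<in> carrier R \<Longrightarrow> y \<in> carrier R \<Longrightarrow> lie_bracket R x y \<in> carrier R"
  by (simp add: lie_bracket_def)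

lemma lie_bracket_add_left:
  "x \<in> carrier R \<Longrightarrow> y \<in> carrier R \<Longrightarrow> z \<in> carrier R \<Longrightarrow>
    lie_bracket R (x \<oplus> y) z = lie_bracket R x z \<oplus> lie_bracket R y z"
  unfolding lie_bracket_def by algebra

lemma lie_bracket_add_right:
  "x \<in> carrier R \<Longrightarrow> y \<in> carrier R \<Longrightarrow> z \<in> carrier R \<Longrightarrow>
    lie_bracket R z (x \<oplus> y) = lie_bracket R z x \<oplus> lie_bracket R z y"
  unfolding lie_bracket_def by algebra

lemma lie_bracket_mult_left:
  "x \<in> carrier R \<Longrightarrow> y \<in> carrier R \<Longrightarrow> z \<in> carrier R \<Longrightarrow>
    lie_bracket R (x \<otimes> y) z = lie_bracket R x z \<otimes> y \<oplus> x \<otimes> lie_bracket R y z"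
  unfolding lie_bracket_def by algebra

lemma lie_bracket_mult_right:
  "x \<in> carrier R \<Longrightarrow> y \<in> carrier R \<Longrightarrow> z \<in> carrier R \<Longrightarrow>
    lie_bracket R z (x \<otimes> y) = lie_bracket R z x \<otimes> y \<oplus> x \<otimes> lie_bracket R z y"
  unfolding lie_bracket_def by algebra

lemma lie_bracket_self [simp]: "x \<in> carrier R \<Longrightarrow> lie_bracket R x x = \<zero>"
  unfolding lie_bracket_def by algebra

lemma lie_bracket_zero [simp]:
  "x \<in> carrier R \<Longrightarrow> lie_bracket R x \<zero> = \<zero>" "x \<in> carrier R \<Longrightarrow> lie_bracket R \<zero> x = \<zero>"
  by (simp_all add: lie_bracket_def)

lemma lie_bracket_swap:
  "x \<in> carrier R \<Longrightarrow> y \<in> carrier R \<Longrightarrow> x \<otimes> y = y \<otimes> x \<oplus> lie_bracket R x y"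
  unfolding lie_bracket_def by algebra

text \<open>Needed because \<open>Lcomm\<close> contains left-normed commutators only: a bracket
  nested on the right is rewritten through left-normed ones.\<close>

lemma lie_bracket_jacobi:
  assumes c: "x \<in> carrier R" "y \<in> carrier R" "z \<in> carrier R"
  shows "lie_bracket R z (lie_bracket R x y) =
      lie_bracket R (lie_bracket R z x) y \<ominus> lie_bracket R (lie_bracket R z y) x"
proof -
  \<comment> \<open>The six letters stand for the six monomials in \<open>x\<close>,
    \<open>y\<close>, \<open>z\<close>; the terms \<open>f\<close> and \<open>g\<close> cancel on
    the right-hand side.\<close>
  have *: "a \<oplus> \<ominus> b \<oplus> \<ominus> (d \<oplus> \<ominus> e) = a \<oplus> \<ominus> f \<oplus> \<ominus> (g \<oplus> \<ominus> e) \<ominus> (b \<oplus> \<ominus> g \<oplus> \<ominus> (f \<oplus> \<ominus> d))"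
    if "a \<in> carrier R" "b \<in> carrier R" "d \<in> carrier R" "e \<in> carrier R" "f \<in> carrier R" "g \<in> carrier R"
    for a b d e f g
  proof -
    have "a \<oplus> \<ominus> f \<oplus> \<ominus> (g \<oplus> \<ominus> e) \<ominus> (b \<oplus> \<ominus> g \<oplus> \<ominus> (f \<oplus> \<ominus> d)) =
        a \<oplus> \<ominus> b \<oplus> \<ominus> (d \<oplus> \<ominus> e) \<oplus> ((f \<oplus> \<ominus> f) \<oplus> (g \<oplus> \<ominus> g))"
      unfolding a_minus_def using that by (simp add: minus_add a_ac del: r_neg l_neg r_neg1 r_neg2)
    then show ?thesis using that by (simp add: r_neg)
  qed
  let ?a = "z \<otimes> (x \<otimes> y)" and ?b = "z \<otimes> (y \<otimes> x)" and ?d = "x \<otimes> (y \<otimes> z)"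
    and ?e = "y \<otimes> (x \<otimes> z)" and ?f = "x \<otimes> (z \<otimes> y)" and ?g = "y \<otimes> (z \<otimes> x)"
  note distr = lie_bracket_def a_minus_def l_distr r_distr l_minus r_minus m_assoc
  have "lie_bracket R z (lie_bracket R x y) = ?a \<oplus> \<ominus> ?b \<oplus> \<ominus> (?d \<oplus> \<ominus> ?e)"
    using c by (simp add: distr)
  moreover have "lie_bracket R (lie_bracket R z x) y = ?a \<oplus> \<ominus> ?f \<oplus> \<ominus> (?g \<oplus> \<ominus> ?e)"
    using c by (simp add: distr)
  moreover have "lie_bracket R (lie_bracket R z y) x = ?b \<oplus> \<ominus> ?g \<oplus> \<ominus> (?f \<oplus> \<ominus> ?d)"
    using c by (simp add: distr)
  ultimately show ?thesis using *[of ?a ?b ?d ?e ?f ?g] c by simp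
qed

lemma (in ideal) mem_of_add:
  assumes "s \<oplus> t \<in> I" "t \<in> I" "s \<in> carrier R"
  shows "s \<in> I"
proof -
  have "s \<oplus> t \<oplus> \<ominus> t \<in> I" 
    using assms additive_subgroup.a_closed[OF additive_subgroup_axioms]
      additive_subgroup.a_inv_closed[OF additive_subgroup_axioms] by blast
  then show ?thesis using assms(3) Icarr[OF assms(2)] by (simp add: a_assoc r_neg)
qed

lemma (in ideal) lie_bracket_mem:
  "a \<in> I \<Longrightarrow> y \<in> carrier R \<Longrightarrow> lie_bracket R a y \<in> I"
  "a \<in> I \<Longrightarrow> y \<in> carrier R \<Longrightarrow> lie_bracket R y a \<in> I"
  by (simp_all add: lie_bracket_def a_minus_def I_l_closed I_r_closed a_closed a_inv_closed)

definition Lcomm :: "nat \<Rightarrow> 'a set" where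
  "Lcomm n = {lie_commutator R xs | xs. length xs = n \<and> set xs \<subseteq> carrier R}"

lemma Lcomm_one: "Lcomm 1 = carrier R"
  unfolding Lcomm_def by (force simp: length_Suc_conv intro: exI[of _ "[x]" for x])

lemma Lcomm_bracket:
  assumes "u \<in> Lcomm n" "n \<ge> 1" "y \<in> carrier R"
  shows "lie_bracket R u y \<in> Lcomm (Suc n)"
proof -
  from assms(1) obtain xs where xs: "u = lie_commutator R xs" "length xs = n" "set xs \<subseteq> carrier R"
    by (auto simp: Lcomm_def)
  with assms(2) obtain z zs where "xs = z # zs" by (cases xs) auto
  with xs assms(3) have "lie_bracket R u y = lie_commutator R (xs @ [y])" "set (xs @ [y]) \<subseteq> carrier R"
    "length (xs @ [y]) = Suc n" by auto
  then show ?thesis unfolding Lcomm_def by blast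
qed

lemma Lcomm_Suc:
  assumes "u \<in> Lcomm (Suc (Suc n))"
  obtains v y where "v \<in> Lcomm (Suc n)" "y \<in> carrier R" "u = lie_bracket R v y"
proof -
  from assms obtain xs where xs: "u = lie_commutator R xs" "length xs = Suc (Suc n)" "set xs \<subseteq> carrier R"
    by (auto simp: Lcomm_def)
  then obtain ys y where ys: "xs = ys @ [y]" "length ys = Suc n" by (metis length_Suc_conv_rev)
  then obtain z zs where z: "ys = z # zs" by (cases ys) auto
  show thesis
    by (rule that[of "lie_commutator R ys" y])
      (use xs ys z in \<open>auto simp: Lcomm_def intro!: exI[of _ "z # zs"]\<close>)
qed

lemma Lcomm_carrier: "Lcomm (Suc n) \<subseteq> carrier R"
proof (induction n)
  case 0
  show ?case using Lcomm_one by simp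
next
  case (Suc n)
  show ?case by (auto elim!: Lcomm_Suc intro: Suc.IH[THEN subsetD])
qed

text \<open>The innermost bracket is itself an element of the ring, so it can serve as a single
  first entry.\<close>

lemma Lcomm_mono: "Lcomm (Suc (Suc n)) \<subseteq> Lcomm (Suc n)"
proof
  fix u assume "u \<in> Lcomm (Suc (Suc n))"
  then obtain x y zs where "u = lie_commutator R (x # y # zs)" "length zs = n"
      "set (x # y # zs) \<subseteq> carrier R"
    by (auto simp: Lcomm_def length_Suc_conv)
  then have "u = lie_commutator R (lie_bracket R x y # zs)" "length (lie_bracket R x y # zs) = Suc n"
     "set (lie_bracket R x y # zs) \<subseteq> carrier R" by auto
  then show "u \<in> Lcomm (Suc n)" unfolding Lcomm_def by blast
qed

lemma Lcomm_antimono: "1 \<le> m \<Longrightarrow> m \<le> n \<Longrightarrow> Lcomm n \<subseteq> Lcomm m"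
proof (induction n)
  case (Suc n)
  then show ?case
  proof (cases "m = Suc n")
    case False
    then have "1 \<le> n" "Lcomm n \<subseteq> Lcomm m" using Suc by auto
    then show ?thesis using Lcomm_mono[of "n - 1"] by (auto simp: numeral_eq_Suc)
  qed auto
qed auto

abbreviation "LP \<equiv> lower_Lie_power R"

lemma LP_eq: "n \<ge> 1 \<Longrightarrow> LP n = Idl (Lcomm n)"
proof (cases "n = 1")
  case True
  interpret ideal "Idl (carrier R)" R by (rule genideal_ideal) simp
  show ?thesis using True Lcomm_one genideal_self[of "carrier R"] a_subset
    by (auto simp: lower_Lie_power_def)
qed (auto simp: lower_Lie_power_def Lcomm_def)

lemma Lcomm_subset_carrier: "n \<ge> 1 \<Longrightarrow> Lcomm n \<subseteq> carrier R"
  using Lcomm_carrier[of "n - 1"] by simp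

lemma LP_ideal: "n \<ge> 1 \<Longrightarrow> ideal (LP n) R"
  using LP_eq genideal_ideal Lcomm_subset_carrier by metis

lemma Lcomm_LP: "n \<ge> 1 \<Longrightarrow> Lcomm n \<subseteq> LP n"
  using LP_eq genideal_self Lcomm_subset_carrier by metis

lemma LP_antimono: "1 \<le> m \<Longrightarrow> m \<le> n \<Longrightarrow> LP n \<subseteq> LP m"
  using LP_eq Lcomm_antimono[of m n] genideal_minimal[OF LP_ideal[of m], of "Lcomm n"] Lcomm_LP[of m]
  by auto

text \<open>Obtained by expanding \<open>[u, x y, z]\<close>.\<close>

lemma LP_exchange:
  assumes n: "n \<ge> 1" and u: "u \<in> Lcomm n" and c: "x \<in> carrier R" "y \<in> carrier R" "z \<in> carrier R"
  shows "lie_bracket R x z \<otimes> lie_bracket R u y \<oplus> lie_bracket R u x \<otimes> lie_bracket R y z \<in> LP (n + 2)"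
proof -
  interpret I: ideal "LP (n + 2)" R by (rule LP_ideal) simp
  have uc: "u \<in> carrier R" using u n Lcomm_subset_carrier by blast
  have mem: "lie_bracket R (lie_bracket R u a) b \<in> LP (n + 2)" if "a \<in> carrier R" "b \<in> carrier R" for a b
    using Lcomm_bracket[OF Lcomm_bracket[OF u n that(1)] _ that(2)] Lcomm_LP[of "n + 2"] by auto
  define A where "A = lie_bracket R (lie_bracket R u x) z \<otimes> y"
  define B where "B = lie_bracket R u x \<otimes> lie_bracket R y z"
  define C where "C = lie_bracket R x z \<otimes> lie_bracket R u y"
  define D where "D = x \<otimes> lie_bracket R (lie_bracket R u y) z"
  have cl: "A \<in> carrier R" "B \<in> carrier R" "C \<in> carrier R" "D \<in> carrier R"
    using uc c by (simp_all add: A_def B_def C_def D_def)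
  have E: "lie_bracket R (lie_bracket R u (x \<otimes> y)) z = A \<oplus> B \<oplus> (C \<oplus> D)"
    using uc c by (simp add: lie_bracket_mult_right lie_bracket_add_left lie_bracket_mult_left A_def B_def C_def D_def)
  have "A \<in> LP (n + 2)" "D \<in> LP (n + 2)" "A \<oplus> B \<oplus> (C \<oplus> D) \<in> LP (n + 2)"
    using mem c I.I_l_closed I.I_r_closed E[symmetric] by (simp_all add: A_def D_def)
  moreover have "A \<oplus> B \<oplus> (C \<oplus> D) = (C \<oplus> B) \<oplus> (A \<oplus> D)" using cl by (simp add: a_ac)
  ultimately have "C \<oplus> B \<in> LP (n + 2)"
    using I.mem_of_add[of "C \<oplus> B" "A \<oplus> D"] I.a_closed[of A D] cl by simp
  then show ?thesis by (simp add: B_def C_def)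
qed

text \<open>For generators \<open>t = [t', z]\<close> with \<open>t' = [x, s]\<close> and
  \<open>v = [u, y]\<close>, the exchange relation trades \<open>t v\<close> for
  \<open>[u, t'] [y, z]\<close>. Since \<open>t'\<close> is a bracket, Jacobi expresses
  \<open>[u, t']\<close> by commutators that are two longer than \<open>u\<close>, hence one longer
  than \<open>v\<close>.\<close>

lemma LP3_mult:
  assumes n: "n \<ge> 1" and a: "a \<in> LP 3" and b: "b \<in> LP n"
  shows "a \<otimes> b \<in> LP (Suc n)"
proof (cases "n = 1")
  case True
  interpret I: ideal "LP 2" R by (rule LP_ideal) simp
  have "LP 1 = carrier R" by (simp add: lower_Lie_power_def)
  then show ?thesis using a b True LP_antimono[of 2 3] I.I_r_closed by (auto simp: numeral_2_eq_2)
next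
  case False
  with n have n2: "n \<ge> 2" by simp
  define k where "k = n - 1"
  have k: "n = Suc k" "k \<ge> 1" using n2 by (auto simp: k_def)
  interpret I: ideal "LP (Suc n)" R by (rule LP_ideal) simp
  show ?thesis
  proof (rule genideal_mult_mem[OF _ _ I.ideal_axioms])
    show "a \<in> Idl (Lcomm 3)" "b \<in> Idl (Lcomm n)" using a b n by (auto simp: LP_eq)
    show "Lcomm 3 \<subseteq> carrier R" "Lcomm n \<subseteq> carrier R" using n by (simp_all add: Lcomm_subset_carrier)
    fix t r v assume t: "t \<in> Lcomm 3" and r: "r \<in> carrier R" and v: "v \<in> Lcomm n"
    from t obtain t' z where t': "t' \<in> Lcomm 2" "z \<in> carrier R" "t = lie_bracket R t' z"
      using Lcomm_Suc[of t 1] by (auto simp: numeral_eq_Suc)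
    from t'(1) obtain x s where x: "x \<in> carrier R" "s \<in> carrier R" "t' = lie_bracket R x s"
      using Lcomm_Suc[of t' 0] Lcomm_one by (auto simp: numeral_eq_Suc)
    obtain u y where u: "u \<in> Lcomm k" "y \<in> carrier R" "v = lie_bracket R u y"
      using Lcomm_Suc[of v "k - 1"] v k by auto
    have uc: "u \<in> carrier R" using u k Lcomm_subset_carrier by blast
    have vc: "v \<in> carrier R" and tc: "t \<in> carrier R" and t'c: "t' \<in> carrier R" using u t' x uc by auto
    have mem: "lie_bracket R (lie_bracket R u a) b \<in> LP (Suc n)"
      if "a \<in> carrier R" "b \<in> carrier R" for a b
      using Lcomm_bracket[OF Lcomm_bracket[OF u(1) k(2) that(1)] _ that(2)] Lcomm_LP[of "Suc n"] k by auto
    have "lie_bracket R u t' \<in> LP (Suc n)"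
      using mem[OF x(1,2)] mem[OF x(2,1)] x uc
      by (simp add: lie_bracket_jacobi a_minus_def I.a_closed I.a_inv_closed)
    then have 1: "\<ominus> (lie_bracket R u t' \<otimes> lie_bracket R y z) \<in> LP (Suc n)"
      using u t' I.I_r_closed I.a_inv_closed by simp
    have 2: "t \<otimes> v \<oplus> lie_bracket R u t' \<otimes> lie_bracket R y z \<in> LP (Suc n)"
      using LP_exchange[OF k(2) u(1) t'c u(2) t'(2)] k t' u by (simp add: numeral_eq_Suc)
    have "a = a \<oplus> b \<oplus> \<ominus> b" if "a \<in> carrier R" "b \<in> carrier R" for a b
      using that by algebra
    then have tv: "t \<otimes> v \<in> LP (Suc n)" using I.a_closed[OF 2 1] tc vc uc u(2) t'(2) t'c by simp
    \<comment> \<open>A coefficient between the generators costs only \<open>[v, r]\<close>, which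
      already lies one step deeper.\<close>
    have "t \<otimes> (r \<otimes> v) = t \<otimes> v \<otimes> r \<ominus> t \<otimes> lie_bracket R v r"
      unfolding lie_bracket_def using tc r vc by algebra
    moreover have "lie_bracket R v r \<in> LP (Suc n)"
      using Lcomm_bracket[OF v n r] Lcomm_LP[of "Suc n"] by auto
    ultimately show "t \<otimes> (r \<otimes> v) \<in> LP (Suc n)"
      using tv r tc I.I_l_closed I.I_r_closed by (simp add: a_minus_def I.a_closed I.a_inv_closed)
  qed
qed

definition prodl :: "'a list \<Rightarrow> 'a" where "prodl as = foldr (\<otimes>) as \<one>"

lemma prodl_simps [simp]: "prodl [] = \<one>" "prodl (a # as) = a \<otimes> prodl as"
  by (simp_all add: prodl_def)

lemma prodl_closed [simp, intro]: "set as \<subseteq> carrier R \<Longrightarrow> prodl as \<in> carrier R"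
  by (induction as) auto

lemma prodl_append: "set as \<subseteq> carrier R \<Longrightarrow> set bs \<subseteq> carrier R \<Longrightarrow> prodl (as @ bs) = prodl as \<otimes> prodl bs"
  by (induction as) (auto simp: m_assoc)

text \<open>With \<open>n = 1\<close> and \<open>u = x\<close> the second summand of the exchange
  relation contains \<open>[x, x] = 0\<close>. Moving \<open>r\<close> to the front costs a
  commutator of length three.\<close>

lemma bracket_mult_bracket_mem_LP3:
  assumes c: "x \<in> carrier R" "y \<in> carrier R" "t \<in> carrier R" "r \<in> carrier R"
  shows "lie_bracket R x y \<otimes> (r \<otimes> lie_bracket R x t) \<in> LP 3"
proof -
  interpret I: ideal "LP 3" R by (rule LP_ideal) simp
  have "lie_bracket R x y \<otimes> lie_bracket R x t \<oplus> lie_bracket R x x \<otimes> lie_bracket R t y \<in> LP (1 + 2)"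
    by (rule LP_exchange) (use c Lcomm_one in auto)
  then have 1: "lie_bracket R x y \<otimes> lie_bracket R x t \<in> LP 3" using c by (simp add: numeral_eq_Suc)
  have "lie_bracket R x y \<in> Lcomm 2"
    using Lcomm_bracket[of x 1 y] c Lcomm_one by (simp add: numeral_eq_Suc)
  then have 2: "lie_bracket R (lie_bracket R x y) r \<in> LP 3"
    using Lcomm_bracket[of _ 2 r] c Lcomm_LP[of 3] by (auto simp: numeral_eq_Suc)
  have "a \<otimes> (r \<otimes> b) = r \<otimes> (a \<otimes> b) \<oplus> lie_bracket R a r \<otimes> b" if "a \<in> carrier R" "b \<in> carrier R" for a b
    unfolding lie_bracket_def using c(4) that by algebra
  then show ?thesis using 1 2 c I.I_l_closed I.I_r_closed I.a_closed by auto
qed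

subsection \<open>Upper Lie powers\<close>

abbreviation "ULP \<equiv> upper_Lie_power R"

lemma ULP_Suc: "n \<ge> 1 \<Longrightarrow> ULP (Suc n) = Idl {lie_bracket R x y | x y. x \<in> ULP n \<and> y \<in> carrier R}"
  by (cases n) auto

lemma ULP_ideal: "ideal (ULP n) R"
proof (induction n rule: less_induct)
  case (less n)
  consider "n = 0" | "n = 1" | k where "n = Suc (Suc k)" by (metis One_nat_def not0_implies_Suc)
  then show ?case
  proof cases
    case 3
    then have "ULP (Suc k) \<subseteq> carrier R" using less[of "Suc k"] ideal.Icarr by fastforce
    then show ?thesis unfolding 3 upper_Lie_power.simps by (intro genideal_ideal) auto
  qed (auto simp: oneideal)
qed

lemma ULP_carrier: "ULP n \<subseteq> carrier R"
  using ideal.Icarr[OF ULP_ideal] by blast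

lemma ULP_bracket: "a \<in> ULP n \<Longrightarrow> y \<in> carrier R \<Longrightarrow> lie_bracket R a y \<in> ULP (Suc n)"
proof (cases "n \<ge> 1")
  case True
  assume "a \<in> ULP n" "y \<in> carrier R"
  moreover have "{lie_bracket R x y | x y. x \<in> ULP n \<and> y \<in> carrier R} \<subseteq> carrier R"
    using ULP_carrier by blast
  ultimately show ?thesis using genideal_self[of "{lie_bracket R x y | x y. x \<in> ULP n \<and> y \<in> carrier R}"] True
    by (auto simp: ULP_Suc)
qed (cases n, auto)

lemma ULP_minimal:
  assumes "n \<ge> 1" "ideal I R" "\<And>a y. a \<in> ULP n \<Longrightarrow> y \<in> carrier R \<Longrightarrow> lie_bracket R a y \<in> I"
  shows "ULP (Suc n) \<subseteq> I"
  unfolding ULP_Suc[OF assms(1)] using assms by (intro genideal_minimal) auto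

lemma ULP_mono_Suc: "ULP (Suc n) \<subseteq> ULP n"
proof (cases "n \<ge> 1")
  case True
  show ?thesis by (rule ULP_minimal[OF True ULP_ideal]) (rule ideal.lie_bracket_mem[OF ULP_ideal])
qed (use ULP_carrier in \<open>cases n, auto\<close>)

lemma ULP_antimono: "m \<le> n \<Longrightarrow> ULP n \<subseteq> ULP m"
  by (induction rule: dec_induct) (use ULP_mono_Suc in auto)

text \<open>Counting \<open>ULP (Suc m)\<close> as weight \<open>m\<close>, weights add because
  \<open>[x, y] z = [x z, y] - x [z, y]\<close>. The second term uses the induction hypothesis with
  \<open>z\<close> replaced by a bracket of larger weight, so \<open>n\<close> must be
  arbitrary.\<close>

lemma ULP_mult:
  "a \<in> ULP (Suc m) \<Longrightarrow> b \<in> ULP (Suc n) \<Longrightarrow> a \<otimes> b \<in> ULP (Suc (m + n))"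
proof (induction m arbitrary: a b n)
  case 0
  interpret ideal "ULP (Suc n)" R by (rule ULP_ideal)
  show ?case using 0 I_l_closed by simp
next
  case (Suc m)
  interpret T: ideal "ULP (Suc (Suc (m + n)))" R by (rule ULP_ideal)
  interpret B: ideal "ULP (Suc n)" R by (rule ULP_ideal)
  let ?A = "{a \<in> carrier R. \<forall>b \<in> ULP (Suc n). a \<otimes> b \<in> ULP (Suc (Suc m + n))}"
  have "ULP (Suc (Suc m)) \<subseteq> ?A"
  proof (rule ULP_minimal)
    show "ideal ?A R"
      by (rule ideal_of_closed)
        (auto simp: l_distr m_assoc T.I_l_closed B.I_l_closed T.a_closed simp del: upper_Lie_power.simps)
    fix x y assume x: "x \<in> ULP (Suc m)" and y: "y \<in> carrier R"
    have xc: "x \<in> carrier R" using x ULP_carrier by blast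
    have "lie_bracket R x y \<otimes> z \<in> ULP (Suc (Suc m + n))" if z: "z \<in> ULP (Suc n)" for z
    proof -
      have zc: "z \<in> carrier R" using z ULP_carrier by blast
      have 1: "lie_bracket R (x \<otimes> z) y \<in> ULP (Suc (Suc m + n))"
        using ULP_bracket[OF Suc.IH[OF x z] y] by simp
      have "x \<otimes> lie_bracket R z y \<in> ULP (Suc (m + Suc n))"
        by (rule Suc.IH[OF x ULP_bracket[OF z y]])
      then have 2: "\<ominus> (x \<otimes> lie_bracket R z y) \<in> ULP (Suc (Suc m + n))"
        using T.a_inv_closed by simp
      have "lie_bracket R x y \<otimes> z = lie_bracket R (x \<otimes> z) y \<oplus> \<ominus> (x \<otimes> lie_bracket R z y)"
        unfolding lie_bracket_def using xc y zc by algebra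
      then show ?thesis using T.a_closed[of "lie_bracket R (x \<otimes> z) y"] 1 2 by simp
    qed
    then show "lie_bracket R x y \<in> ?A" using xc y by auto
  qed simp
  with Suc.prems show ?case by blast
qed

lemma ULP_pow: "a \<in> ULP (Suc m) \<Longrightarrow> a [^] (k::nat) \<in> ULP (Suc (k * m))"
proof (induction k)
  case (Suc k)
  have "a [^] k \<otimes> a \<in> ULP (Suc (k * m + m))" by (rule ULP_mult) (use Suc in auto)
  then show ?case by (simp add: add.commute)
qed simp

section \<open>Products of Lie commutators, graded by weight\<close>

inductive_set Wt :: "(nat \<times> 'a) set" where
  one: "(0, \<one>) \<in> Wt"
| mult: "(n, w) \<in> Wt \<Longrightarrow> u \<in> Lcomm (Suc a) \<Longrightarrow> a \<ge> 1 \<Longrightarrow> (n + a, u \<otimes> w) \<in> Wt"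

lemma Wt_carrier: "(n, w) \<in> Wt \<Longrightarrow> w \<in> carrier R"
  by (induction rule: Wt.induct) (use Lcomm_carrier in auto)

lemma Wt_mult_right: "(n, w) \<in> Wt \<Longrightarrow> u \<in> Lcomm (Suc a) \<Longrightarrow> a \<ge> 1 \<Longrightarrow> (n + a, w \<otimes> u) \<in> Wt"
proof (induction arbitrary: u a rule: Wt.induct)
  case one
  have "u \<in> carrier R" using one Lcomm_carrier by blast
  then show ?case using Wt.mult[OF Wt.one one(1,2)] by simp
next
  case (mult n w v b)
  have "u \<in> carrier R" "v \<in> carrier R" "w \<in> carrier R" using mult Lcomm_carrier Wt_carrier by blast+
  then show ?case
    using Wt.mult[OF mult.IH[OF mult.prems] mult.hyps(2,3)]
    by (simp add: m_assoc add.commute add.left_commute)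
qed

text \<open>A commutator of length \<open>a + 1\<close> counts as weight \<open>a\<close>, so that a
  bracket with a ring element adds one. These ideals contain the upper Lie powers but are generated
  by explicit products, whose number of factors can be estimated.\<close>

definition WI :: "nat \<Rightarrow> 'a set" where "WI n = Idl {w. \<exists>k\<ge>n. (k, w) \<in> Wt}"

lemma WI_ideal: "ideal (WI n) R"
  unfolding WI_def by (rule genideal_ideal) (use Wt_carrier in auto)

lemma Wt_WI: "(k, w) \<in> Wt \<Longrightarrow> n \<le> k \<Longrightarrow> w \<in> WI n"
  unfolding WI_def by (rule subsetD[OF genideal_self]) (use Wt_carrier in auto)

text \<open>Moving a coefficient \<open>r\<close> past \<open>u\<close> replaces \<open>u\<close> by
  \<open>[u, r]\<close>, a longer commutator, so the weight never drops.\<close>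

lemma WI_mult:
  assumes u: "u \<in> Lcomm (Suc a)" "a \<ge> 1" and f: "f \<in> WI n"
  shows "u \<otimes> f \<in> WI (n + a)" "f \<otimes> u \<in> WI (n + a)"
proof -
  interpret I: ideal "WI (n + a)" R by (rule WI_ideal)
  let ?W = "{w. \<exists>k\<ge>n. (k, w) \<in> Wt}"
  have uc: "u \<in> carrier R" using u Lcomm_carrier by blast
  have W: "?W \<subseteq> carrier R" using Wt_carrier by auto
  have uI: "u \<in> Idl {u}" using uc by (intro genideal_self') 
  have br: "lie_bracket R u r \<in> Lcomm (Suc (Suc a))" if "r \<in> carrier R" for r
    using Lcomm_bracket u that by auto
  show "u \<otimes> f \<in> WI (n + a)"
  proof (rule genideal_mult_mem[OF _ W I.ideal_axioms _ uI])
    fix x r w assume x: "x \<in> {u}" and r: "r \<in> carrier R" and w: "w \<in> ?W"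
    then obtain k where k: "k \<ge> n" "(k, w) \<in> Wt" by auto
    have wc: "w \<in> carrier R" using w W by auto
    have "u \<otimes> w \<in> WI (n + a)" by (rule Wt_WI[OF Wt.mult[OF k(2) u]]) (use k in auto)
    moreover have "lie_bracket R u r \<otimes> w \<in> WI (n + a)"
      by (rule Wt_WI[OF Wt.mult[OF k(2) br[OF r]]]) (use k u in auto)
    moreover have "u \<otimes> (r \<otimes> w) = r \<otimes> (u \<otimes> w) \<oplus> lie_bracket R u r \<otimes> w"
      unfolding lie_bracket_def using uc wc r by algebra
    ultimately show "x \<otimes> (r \<otimes> w) \<in> WI (n + a)" using x r by (simp add: I.I_l_closed I.a_closed)
  qed (use uc f in \<open>auto simp: WI_def\<close>)
  show "f \<otimes> u \<in> WI (n + a)"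
  proof (rule genideal_mult_mem[OF W _ I.ideal_axioms _ _ uI])
    fix x r w assume x: "x \<in> {u}" and r: "r \<in> carrier R" and w: "w \<in> ?W"
    then obtain k where k: "k \<ge> n" "(k, w) \<in> Wt" by auto
    have wc: "w \<in> carrier R" using w W by auto
    have "w \<otimes> u \<in> WI (n + a)" by (rule Wt_WI[OF Wt_mult_right[OF k(2) u]]) (use k in auto)
    moreover have "w \<otimes> lie_bracket R u r \<in> WI (n + a)"
      by (rule Wt_WI[OF Wt_mult_right[OF k(2) br[OF r]]]) (use k u in auto)
    moreover have "w \<otimes> (r \<otimes> u) = (w \<otimes> u) \<otimes> r \<oplus> \<ominus> (w \<otimes> lie_bracket R u r)"
      unfolding lie_bracket_def using uc wc r by algebra
    ultimately show "w \<otimes> (r \<otimes> x) \<in> WI (n + a)" using x r 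
      by (simp add: I.I_r_closed I.a_closed I.a_inv_closed)
  qed (use uc f in \<open>auto simp: WI_def\<close>)
qed

lemma Wt_bracket: "(n, w) \<in> Wt \<Longrightarrow> y \<in> carrier R \<Longrightarrow> lie_bracket R w y \<in> WI (Suc n)"
proof (induction rule: Wt.induct)
  case one
  have "lie_bracket R \<one> y = \<zero>" using one by (simp add: lie_bracket_def a_minus_def r_neg)
  then show ?case using additive_subgroup.zero_closed[OF ideal.axioms(1)[OF WI_ideal]] by simp
next
  case (mult n w u a)
  interpret I: ideal "WI (Suc (n + a))" R by (rule WI_ideal)
  have c: "u \<in> carrier R" "w \<in> carrier R" using mult Lcomm_carrier Wt_carrier by blast+
  have "u \<otimes> lie_bracket R w y \<in> WI (Suc n + a)" by (rule WI_mult) (use mult in auto)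
  moreover have "lie_bracket R u y \<otimes> w \<in> WI (Suc (n + a))"
    by (rule Wt_WI[OF Wt.mult[OF mult.hyps(1) Lcomm_bracket[OF mult.hyps(2)]]]) (use mult in auto)
  ultimately show ?case using c mult.prems by (simp add: lie_bracket_mult_left I.a_closed)
qed

text \<open>Bracketing is a derivation. On a generator it lengthens one factor
  (\<open>Wt_bracket\<close>); on a multiple \<open>r a\<close> it also produces
  \<open>[r, y] a\<close>, where \<open>[r, y]\<close> is a new factor of weight one.\<close>

lemma WI_bracket: "f \<in> WI n \<Longrightarrow> y \<in> carrier R \<Longrightarrow> lie_bracket R f y \<in> WI (Suc n)"
proof -
  assume f: "f \<in> WI n" and y: "y \<in> carrier R"
  interpret I: ideal "WI n" R by (rule WI_ideal)
  interpret I': ideal "WI (Suc n)" R by (rule WI_ideal)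
  have br: "lie_bracket R r y \<in> Lcomm (Suc 1)" if "r \<in> carrier R" "y \<in> carrier R" for r y
    using Lcomm_bracket[of r 1 y] Lcomm_one that by auto
  let ?A = "{a \<in> WI n. \<forall>y\<in>carrier R. lie_bracket R a y \<in> WI (Suc n)}"
  have "ideal ?A R"
  proof (rule ideal_of_closed)
    fix a r assume "a \<in> ?A" and r: "r \<in> carrier R"
    then have a: "a \<in> WI n" "\<And>y. y \<in> carrier R \<Longrightarrow> lie_bracket R a y \<in> WI (Suc n)" by auto
    have "lie_bracket R r y \<otimes> a \<in> WI (n + 1)" "a \<otimes> lie_bracket R r y \<in> WI (n + 1)"
      if "y \<in> carrier R" for y
      using WI_mult[OF br[OF r that] _ a(1)] by simp_all
    then show "r \<otimes> a \<in> ?A" "a \<otimes> r \<in> ?A" using a r I.I_l_closed I.I_r_closed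
      by (auto simp: lie_bracket_mult_left I'.I_l_closed I'.I_r_closed intro!: I'.a_closed)
  qed (auto simp: lie_bracket_add_left I.a_closed I'.a_closed)
  moreover have "{w. \<exists>k\<ge>n. (k, w) \<in> Wt} \<subseteq> ?A"
  proof
    fix w assume "w \<in> {w. \<exists>k\<ge>n. (k, w) \<in> Wt}"
    then obtain k where k: "k \<ge> n" "(k, w) \<in> Wt" by auto
    have "WI (Suc k) \<subseteq> WI (Suc n)"
      unfolding WI_def[of "Suc k"] by (rule genideal_minimal[OF WI_ideal]) (use k Wt_WI in auto)
    then show "w \<in> ?A" using k Wt_bracket Wt_WI by blast
  qed
  ultimately have "Idl {w. \<exists>k\<ge>n. (k, w) \<in> Wt} \<subseteq> ?A" by (rule genideal_minimal)
  with f y show ?thesis by (auto simp: WI_def)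
qed

lemma ULP_WI: "ULP (Suc n) \<subseteq> WI n"
proof (induction n)
  case 0
  interpret ideal "WI 0" R by (rule WI_ideal)
  have "\<one> \<in> WI 0" using Wt_WI[OF Wt.one] by simp
  then show ?case using I_l_closed by force
next
  case (Suc n)
  show ?case by (rule ULP_minimal) (use Suc WI_bracket WI_ideal in auto)
qed

text \<open>Commutators of length above \<open>m\<close> vanish, so a factor of a nonzero product
  has weight below \<open>m\<close>. A product of weight above \<open>m N\<close> therefore has at
  least \<open>N\<close> factors, all of them in \<open>LP 2\<close>, unless it is already
  zero.\<close>

lemma ULP_eventually_zero:
  assumes LP: "LP m = {\<zero>}" "m \<ge> 1"
    and nil: "\<And>as. set as \<subseteq> LP 2 \<Longrightarrow> length as \<ge> N \<Longrightarrow> prodl as = \<zero>"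
  shows "ULP (Suc (Suc (m * N))) = {\<zero>}"
proof -
  have L: "u = \<zero>" if "u \<in> Lcomm (Suc a)" "a \<ge> m" for u a
    using that Lcomm_antimono[of m "Suc a"] Lcomm_LP[of m] LP by auto
  have *: "\<exists>as. set as \<subseteq> LP 2 \<and> w = prodl as \<and> (w \<noteq> \<zero> \<longrightarrow> n \<le> m * length as)" if "(n, w) \<in> Wt" for n w
    using that
  proof (induction rule: Wt.induct)
    case one
    then show ?case by (intro exI[of _ "[]"]) auto
  next
    case (mult n w u a)
    then obtain as where as: "set as \<subseteq> LP 2" "w = prodl as" "w \<noteq> \<zero> \<longrightarrow> n \<le> m * length as" by blast
    have "u \<in> LP 2" using mult Lcomm_antimono[of 2 "Suc a"] Lcomm_LP[of 2] by auto
    moreover have "u \<in> carrier R" "w \<in> carrier R" using mult Lcomm_carrier Wt_carrier by blast+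
    ultimately show ?case using as L[OF mult.hyps(2)] by (intro exI[of _ "u # as"]) (cases "a \<ge> m"; auto)
  qed
  have "{w. \<exists>k\<ge>Suc (m * N). (k, w) \<in> Wt} \<subseteq> {\<zero>}"
  proof
    fix w assume "w \<in> {w. \<exists>k\<ge>Suc (m * N). (k, w) \<in> Wt}"
    then obtain k where k: "k > m * N" "(k, w) \<in> Wt" by (auto simp: Suc_le_eq)
    from *[OF k(2)] obtain as where as: "set as \<subseteq> LP 2" "w = prodl as" "w \<noteq> \<zero> \<longrightarrow> k \<le> m * length as" by blast
    have "w = \<zero>"
    proof (rule ccontr)
      assume "w \<noteq> \<zero>"
      then have "k \<le> m * length as" using as(3) by blast
      with k(1) have "m * N < m * length as" by (rule less_le_trans)
      then have "N \<le> length as" by (meson less_imp_le mult_less_cancel1)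
      then show False using nil[OF as(1)] as(2) \<open>w \<noteq> \<zero>\<close> by auto
    qed
    then show "w \<in> {\<zero>}" by simp
  qed
  then have "WI (Suc (m * N)) \<subseteq> {\<zero>}" unfolding WI_def by (intro genideal_minimal zeroideal)
  then show ?thesis using ULP_WI[of "Suc (m * N)"] additive_subgroup.zero_closed[OF ideal.axioms(1)[OF ULP_ideal]]
    by blast
qed

end


subsection \<open>Groups with boundedly many commutators per element\<close>

definition gcomm :: "('g, 'n) monoid_scheme \<Rightarrow> 'g \<Rightarrow> 'g \<Rightarrow> 'g" where
  "gcomm G x y = x \<otimes>\<^bsub>G\<^esub> y \<otimes>\<^bsub>G\<^esub> inv\<^bsub>G\<^esub> x \<otimes>\<^bsub>G\<^esub> inv\<^bsub>G\<^esub> y"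

context group begin

lemma gcomm_closed [simp, intro]: "x \<in> carrier G \<Longrightarrow> y \<in> carrier G \<Longrightarrow> gcomm G x y \<in> carrier G"
  by (simp add: gcomm_def)

lemma inv_l_cancel: "x \<in> carrier G \<Longrightarrow> y \<in> carrier G \<Longrightarrow> inv x \<otimes> (x \<otimes> y) = y"
  by (simp add: m_assoc[symmetric])

lemma inv_r_cancel: "x \<in> carrier G \<Longrightarrow> y \<in> carrier G \<Longrightarrow> x \<otimes> (inv x \<otimes> y) = y"
  by (simp add: m_assoc[symmetric])

lemmas group_nf = m_assoc inv_l_cancel inv_r_cancel inv_mult_group

lemma gcomm_mult_left:
  "x \<in> carrier G \<Longrightarrow> y \<in> carrier G \<Longrightarrow> g \<in> carrier G \<Longrightarrow>
    gcomm G (x \<otimes> y) g = x \<otimes> gcomm G y g \<otimes> inv x \<otimes> gcomm G x g"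
  by (simp add: gcomm_def group_nf)

lemma gcomm_mult_swap: "x \<in> carrier G \<Longrightarrow> y \<in> carrier G \<Longrightarrow> gcomm G x y \<otimes> (y \<otimes> x) = x \<otimes> y"
  by (simp add: gcomm_def group_nf)

lemma gcomm_eq_one_iff:
  assumes "x \<in> carrier G" "y \<in> carrier G"
  shows "gcomm G x y = \<one> \<longleftrightarrow> x \<otimes> y = y \<otimes> x"
  using gcomm_mult_swap[OF assms] assms
  by (metis gcomm_closed l_cancel_one' m_closed r_cancel_one')

text \<open>
  If \<open>x\<close> has as many commutators as possible, then multiplying \<open>x\<close> by an element \<open>c\<close> that
  centralises representatives of them does not change the set of commutators, which restricts
  the commutators of \<open>c\<close>.
\<close>

lemma finite_commutators:
  assumes B: "\<And>x. x \<in> carrier G \<Longrightarrow> finite (gcomm G x ` carrier G) \<and> card (gcomm G x ` carrier G) \<le> B"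
  shows "finite {gcomm G x y | x y. x \<in> carrier G \<and> y \<in> carrier G}"
proof -
  define N where "N x = card (gcomm G x ` carrier G)" for x
  have "\<exists>x. x \<in> carrier G \<and> (\<forall>y. y \<in> carrier G \<longrightarrow> N y \<le> N x)"
    by (rule ex_has_greatest_nat[of _ \<one> _ "Suc B"]) (use B in \<open>auto simp: N_def le_imp_less_Suc\<close>)
  then obtain x where x: "x \<in> carrier G" and max: "\<And>y. y \<in> carrier G \<Longrightarrow> N y \<le> N x" by blast
  obtain T where T: "T \<subseteq> carrier G" "finite T" "gcomm G x ` carrier G = gcomm G x ` T"
    using finite_subset_image[of "gcomm G x ` carrier G" "gcomm G x" "carrier G"] B[OF x] by blast
  \<comment> \<open>From \<open>(x c, g) = x (c, g) x^-1 (x, g)\<close>: if both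
    \<open>(x c, g)\<close> and \<open>(x, g)\<close> are commutators of \<open>x\<close>, then
    \<open>(c, g)\<close> has the form listed in \<open>F\<close>.\<close>
  define F where "F = (\<lambda>(a, b). inv x \<otimes> (a \<otimes> inv b) \<otimes> x) ` (gcomm G x ` T \<times> gcomm G x ` T)"
  have F: "gcomm G c g \<in> F"
    if c: "c \<in> carrier G" "\<And>t. t \<in> T \<Longrightarrow> c \<otimes> t = t \<otimes> c" and g: "g \<in> carrier G" for c g
  proof -
    have "gcomm G (x \<otimes> c) t = gcomm G x t" if t: "t \<in> T" for t
    proof -
      have tG: "t \<in> carrier G" using t T by blast
      have "gcomm G c t = \<one>" using c t tG gcomm_eq_one_iff by auto
      then show ?thesis using x c tG by (simp add: gcomm_mult_left)
    qed
    then have "gcomm G x ` T \<subseteq> gcomm G (x \<otimes> c) ` carrier G" using T by force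
    moreover have "N (x \<otimes> c) \<le> card (gcomm G x ` T)" using max[of "x \<otimes> c"] x c T by (simp add: N_def)
    ultimately have eq: "gcomm G (x \<otimes> c) ` carrier G = gcomm G x ` T"
      using B[of "x \<otimes> c"] x c unfolding N_def by (metis card_seteq m_closed)
    have "gcomm G (x \<otimes> c) g \<in> gcomm G x ` T" "gcomm G x g \<in> gcomm G x ` T"
      using eq T g by blast+
    moreover have "gcomm G c g = inv x \<otimes> (gcomm G (x \<otimes> c) g \<otimes> inv (gcomm G x g)) \<otimes> x"
      using x c g by (simp add: gcomm_def group_nf)
    ultimately show ?thesis unfolding F_def by force
  qed
  \<comment> \<open>Records the commutators of the representatives with \<open>y\<close>. There are
    finitely many possible records, and elements with the same record differ by some
    \<open>c\<close> that centralises \<open>T\<close>.\<close>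
  define \<phi> where "\<phi> y = (\<lambda>t\<in>T. gcomm G t y)" for y
  have "finite (\<Pi>\<^sub>E t\<in>T. gcomm G t ` carrier G)" using T B by (intro finite_PiE) auto
  moreover have "\<phi> ` carrier G \<subseteq> (\<Pi>\<^sub>E t\<in>T. gcomm G t ` carrier G)" by (auto simp: \<phi>_def)
  ultimately have "finite (\<phi> ` carrier G)" by (rule rev_finite_subset)
  then obtain S where S: "S \<subseteq> carrier G" "finite S" "\<phi> ` carrier G = \<phi> ` S"
    using finite_subset_image[of "\<phi> ` carrier G" \<phi> "carrier G"] by blast
  have "{gcomm G x y | x y. x \<in> carrier G \<and> y \<in> carrier G} \<subseteq>
      (\<Union>s\<in>S. (\<lambda>(a, b). s \<otimes> a \<otimes> inv s \<otimes> b) ` (F \<times> gcomm G s ` carrier G))"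
  proof
    fix k assume "k \<in> {gcomm G x y | x y. x \<in> carrier G \<and> y \<in> carrier G}"
    then obtain y g where y: "y \<in> carrier G" and g: "g \<in> carrier G" and k: "k = gcomm G y g" by blast
    from y S(3) obtain s where s: "s \<in> S" "\<phi> y = \<phi> s" by blast
    have sG: "s \<in> carrier G" using s S by blast
    define c where "c = inv s \<otimes> y"
    have c: "c \<in> carrier G" "y = s \<otimes> c" using y sG by (auto simp: c_def inv_r_cancel)
    have "c \<otimes> t = t \<otimes> c" if t: "t \<in> T" for t
    proof -
      have tG: "t \<in> carrier G" using t T by blast
      have "gcomm G t y = gcomm G t s" using s(2) t by (metis \<phi>_def restrict_apply')
      then have "y \<otimes> inv t \<otimes> inv y = s \<otimes> inv t \<otimes> inv s"
        using tG y sG by (simp add: gcomm_def m_assoc)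
      then have "inv (y \<otimes> inv t \<otimes> inv y) = inv (s \<otimes> inv t \<otimes> inv s)" by simp
      then have "y \<otimes> t \<otimes> inv y = s \<otimes> t \<otimes> inv s" using tG y sG by (simp add: group_nf)
      then have "inv s \<otimes> (y \<otimes> t \<otimes> inv y) \<otimes> y = inv s \<otimes> (s \<otimes> t \<otimes> inv s) \<otimes> y" by simp
      then show ?thesis using tG y sG by (simp add: c_def group_nf)
    qed
    from F[OF c(1) this g] have "gcomm G c g \<in> F" .
    moreover have "k = s \<otimes> gcomm G c g \<otimes> inv s \<otimes> gcomm G s g"
      using k c sG g by (simp add: gcomm_mult_left)
    ultimately show "k \<in> (\<Union>s\<in>S. (\<lambda>(a, b). s \<otimes> a \<otimes> inv s \<otimes> b) ` (F \<times> gcomm G s ` carrier G))"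
      using s(1) g by force
  qed
  moreover have "finite (\<Union>s\<in>S. (\<lambda>(a, b). s \<otimes> a \<otimes> inv s \<otimes> b) ` (F \<times> gcomm G s ` carrier G))"
  proof (rule finite_UN_I[OF S(2)], rule finite_imageI, rule finite_cartesian_product)
    show "finite F" using T(2) by (simp add: F_def)
  qed (use B S in blast)
  ultimately show ?thesis by (rule finite_subset)
qed

end

subsection \<open>Monomials of the group algebra\<close>

context group_algebra_over begin

sublocale R: ring "group_algebra K G" by (rule ring_group_algebra)

definition mon :: "'k \<Rightarrow> 'g \<Rightarrow> 'g \<Rightarrow> 'k" where
  "mon c g = (\<lambda>x. if x = g then c else \<zero>\<^bsub>K\<^esub>)"

abbreviation \<delta> where "\<delta> \<equiv> mon \<one>\<^bsub>K\<^esub>"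

lemma mon_closed [simp, intro]: "c \<in> carrier K \<Longrightarrow> g \<in> carrier G \<Longrightarrow> mon c g \<in> carrier KG"
  by (rule carrierI[where A = "{g}"]) (auto simp: mon_def)

lemma supp_mon: "supp K (mon c g) \<subseteq> {g}"
  by (auto simp: supp_def mon_def)

lemma mon_mult_apply:
  assumes "c \<in> carrier K" "h \<in> carrier G" "f \<in> carrier KG" "g \<in> carrier G"
  shows "(mon c h \<otimes>\<^bsub>KG\<^esub> f) g = c \<otimes>\<^bsub>K\<^esub> f (inv\<^bsub>G\<^esub> h \<otimes>\<^bsub>G\<^esub> g)"
proof -
  have "(mon c h \<otimes>\<^bsub>KG\<^esub> f) g = (\<Oplus>\<^bsub>K\<^esub>x\<in>{h}. mon c h x \<otimes>\<^bsub>K\<^esub> f (inv\<^bsub>G\<^esub> x \<otimes>\<^bsub>G\<^esub> g))"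
    using assms supp_mon by (intro mult_apply) auto
  then show ?thesis using assms carrierD[OF assms(3)] by (simp add: mon_def)
qed

lemma mult_mon_apply:
  assumes "c \<in> carrier K" "h \<in> carrier G" "f \<in> carrier KG" "g \<in> carrier G"
  shows "(f \<otimes>\<^bsub>KG\<^esub> mon c h) g = f (g \<otimes>\<^bsub>G\<^esub> inv\<^bsub>G\<^esub> h) \<otimes>\<^bsub>K\<^esub> c"
proof -
  note fD = carrierD[OF assms(3)]
  define a where "a = g \<otimes>\<^bsub>G\<^esub> inv\<^bsub>G\<^esub> h"
  define A where "A = insert a (supp K f)"
  have A: "finite A" "A \<subseteq> carrier G" using fD assms by (auto simp: A_def a_def)
  have "(f \<otimes>\<^bsub>KG\<^esub> mon c h) g = (\<Oplus>\<^bsub>K\<^esub>x\<in>A. f x \<otimes>\<^bsub>K\<^esub> mon c h (inv\<^bsub>G\<^esub> x \<otimes>\<^bsub>G\<^esub> g))"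
    using A assms by (intro mult_apply) (auto simp: A_def)
  also have "\<dots> = (\<Oplus>\<^bsub>K\<^esub>x\<in>A. if a = x then f x \<otimes>\<^bsub>K\<^esub> c else \<zero>\<^bsub>K\<^esub>)"
  proof (intro K.finsum_cong')
    fix x assume "x \<in> A"
    then have x: "x \<in> carrier G" using A by blast
    then have "inv\<^bsub>G\<^esub> x \<otimes>\<^bsub>G\<^esub> g = h \<longleftrightarrow> a = x"
      unfolding a_def using assms by (metis G.inv_solve_left G.inv_solve_right)
    then show "f x \<otimes>\<^bsub>K\<^esub> mon c h (inv\<^bsub>G\<^esub> x \<otimes>\<^bsub>G\<^esub> g) = (if a = x then f x \<otimes>\<^bsub>K\<^esub> c else \<zero>\<^bsub>K\<^esub>)"
      using fD by (simp add: mon_def)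
  qed (use fD assms in auto)
  also have "\<dots> = f a \<otimes>\<^bsub>K\<^esub> c"
    using A fD assms by (intro K.finsum_singleton) (auto simp: A_def)
  finally show ?thesis by (simp add: a_def)
qed

lemma mon_mult:
  assumes "c \<in> carrier K" "d \<in> carrier K" "g \<in> carrier G" "h \<in> carrier G"
  shows "mon c g \<otimes>\<^bsub>KG\<^esub> mon d h = mon (c \<otimes>\<^bsub>K\<^esub> d) (g \<otimes>\<^bsub>G\<^esub> h)"
proof
  fix x
  show "(mon c g \<otimes>\<^bsub>KG\<^esub> mon d h) x = mon (c \<otimes>\<^bsub>K\<^esub> d) (g \<otimes>\<^bsub>G\<^esub> h) x"
  proof (cases "x \<in> carrier G")
    case True
    then have "inv\<^bsub>G\<^esub> g \<otimes>\<^bsub>G\<^esub> x = h \<longleftrightarrow> x = g \<otimes>\<^bsub>G\<^esub> h"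
      using assms by (metis G.inv_solve_left G.m_closed)
    with True assms show ?thesis by (simp add: mon_mult_apply) (simp add: mon_def)
  next
    case False
    then show ?thesis using assms by (auto simp: mult_outside mon_def)
  qed
qed

lemma one_eq_delta: "\<one>\<^bsub>KG\<^esub> = \<delta> \<one>\<^bsub>G\<^esub>"
  by (auto simp: fun_eq_iff one_apply mon_def)

lemma delta_mult: "g \<in> carrier G \<Longrightarrow> h \<in> carrier G \<Longrightarrow> \<delta> g \<otimes>\<^bsub>KG\<^esub> \<delta> h = \<delta> (g \<otimes>\<^bsub>G\<^esub> h)"
  by (simp add: mon_mult)

lemma delta_inv:
  "g \<in> carrier G \<Longrightarrow> \<delta> g \<otimes>\<^bsub>KG\<^esub> \<delta> (inv\<^bsub>G\<^esub> g) = \<one>\<^bsub>KG\<^esub>"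
  "g \<in> carrier G \<Longrightarrow> \<delta> (inv\<^bsub>G\<^esub> g) \<otimes>\<^bsub>KG\<^esub> \<delta> g = \<one>\<^bsub>KG\<^esub>"
  by (simp_all add: delta_mult one_eq_delta)

lemma delta_pow: "g \<in> carrier G \<Longrightarrow> \<delta> g [^]\<^bsub>KG\<^esub> (n::nat) = \<delta> (g [^]\<^bsub>G\<^esub> n)"
  by (induction n) (auto simp: delta_mult one_eq_delta)

lemma eq_zero_iff_supp: "f = \<zero>\<^bsub>KG\<^esub> \<longleftrightarrow> supp K f = {}"
  by (auto simp: fun_eq_iff zero_apply supp_def)

lemma minus_apply:
  assumes "f \<in> carrier KG" "h \<in> carrier KG"
  shows "(f \<ominus>\<^bsub>KG\<^esub> h) g = f g \<ominus>\<^bsub>K\<^esub> h g"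
proof -
  have "f = (f \<ominus>\<^bsub>KG\<^esub> h) \<oplus>\<^bsub>KG\<^esub> h" using assms by (simp add: a_minus_def R.a_assoc R.l_neg)
  then have "f g = (f \<ominus>\<^bsub>KG\<^esub> h) g \<oplus>\<^bsub>K\<^esub> h g" by (metis add_apply)
  moreover have "(f \<ominus>\<^bsub>KG\<^esub> h) g \<in> carrier K" using assms by (intro carrierD(1)) auto
  ultimately show ?thesis using carrierD(1)[OF assms(2)] by (simp add: a_minus_def K.a_assoc K.r_neg)
qed

lemma KG_induct [consumes 1, case_names zero add mon]:
  assumes "f \<in> carrier KG" "P \<zero>\<^bsub>KG\<^esub>"
    and add: "\<And>a b. a \<in> carrier KG \<Longrightarrow> b \<in> carrier KG \<Longrightarrow> P a \<Longrightarrow> P b \<Longrightarrow> P (a \<oplus>\<^bsub>KG\<^esub> b)"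
    and mon: "\<And>c g. c \<in> carrier K \<Longrightarrow> g \<in> carrier G \<Longrightarrow> P (mon c g)"
  shows "P f"
proof -
  have "P f" if "finite A" "supp K f \<subseteq> A" "f \<in> carrier KG" for A f
    using that
  proof (induction A arbitrary: f rule: finite_induct)
    case empty
    then have "f = \<zero>\<^bsub>KG\<^esub>" using eq_zero_iff_supp by blast
    then show ?case using assms by simp
  next
    case (insert x A)
    show ?case
    proof (cases "x \<in> supp K f")
      case True
      note fD = carrierD[OF insert.prems(2)]
      define h where "h = f(x := \<zero>\<^bsub>K\<^esub>)"
      have xG: "x \<in> carrier G" using True fD by blast
      have h: "h \<in> carrier KG"
        by (rule carrierI[where A = "supp K f"]) (use fD in \<open>auto simp: h_def supp_def\<close>)
      have "supp K h \<subseteq> A" using insert.prems by (auto simp: h_def supp_def)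
      then have "P h" using insert.IH h by blast
      then have "P (mon (f x) x \<oplus>\<^bsub>KG\<^esub> h)" using xG fD h by (intro add mon) auto
      moreover have "mon (f x) x \<oplus>\<^bsub>KG\<^esub> h = f"
        using fD by (auto simp: fun_eq_iff add_apply mon_def h_def)
      ultimately show ?thesis by simp
    next
      case False
      then show ?thesis using insert by blast
    qed
  qed
  then show ?thesis using assms(1) carrierD(2)[OF assms(1)] by blast
qed

lemma lie_bracket_mon:
  assumes "c \<in> carrier K" "d \<in> carrier K" "g \<in> carrier G" "h \<in> carrier G"
  shows "lie_bracket KG (mon c g) (mon d h) = mon (c \<otimes>\<^bsub>K\<^esub> d) \<one>\<^bsub>G\<^esub> \<otimes>\<^bsub>KG\<^esub> lie_bracket KG (\<delta> g) (\<delta> h)"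
  using assms by (simp add: lie_bracket_def a_minus_def R.r_distr R.r_minus mon_mult K.m_comm[of d c])

abbreviation \<Delta> where "\<Delta> g \<equiv> \<delta> g \<ominus>\<^bsub>KG\<^esub> \<one>\<^bsub>KG\<^esub>"

lemma Delta_one [simp]: "\<Delta> \<one>\<^bsub>G\<^esub> = \<zero>\<^bsub>KG\<^esub>"
  by (simp add: one_eq_delta[symmetric] a_minus_def R.r_neg)

lemma Delta_mult:
  "g \<in> carrier G \<Longrightarrow> h \<in> carrier G \<Longrightarrow>
    \<Delta> (g \<otimes>\<^bsub>G\<^esub> h) = \<Delta> g \<otimes>\<^bsub>KG\<^esub> \<delta> h \<oplus>\<^bsub>KG\<^esub> \<Delta> h"
  by (simp add: delta_mult[symmetric] a_minus_def R.l_distr R.l_minus R.a_assoc)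
    (simp add: R.a_assoc[symmetric] R.l_neg)

text \<open>From \<open>g h = (g, h) h g\<close>: the ring bracket and \<open>(g, h) - 1\<close>
  differ by a unit. With its converse \<open>Delta_gcomm\<close> this is the passage between Lie
  commutators and group commutators.\<close>

lemma lie_bracket_delta:
  assumes "g \<in> carrier G" "h \<in> carrier G"
  shows "lie_bracket KG (\<delta> g) (\<delta> h) = \<Delta> (gcomm G g h) \<otimes>\<^bsub>KG\<^esub> \<delta> (h \<otimes>\<^bsub>G\<^esub> g)"
proof -
  have "gcomm G g h \<otimes>\<^bsub>G\<^esub> (h \<otimes>\<^bsub>G\<^esub> g) = g \<otimes>\<^bsub>G\<^esub> h"
    using assms by (rule G.gcomm_mult_swap)
  then show ?thesis
    using assms by (simp add: lie_bracket_def a_minus_def R.l_distr R.l_minus delta_mult)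
qed

lemma Delta_gcomm:
  assumes "g \<in> carrier G" "h \<in> carrier G"
  shows "\<Delta> (gcomm G g h) = lie_bracket KG (\<delta> g) (\<delta> h) \<otimes>\<^bsub>KG\<^esub> \<delta> (inv\<^bsub>G\<^esub> (h \<otimes>\<^bsub>G\<^esub> g))"
  using assms by (simp add: lie_bracket_delta R.m_assoc delta_inv del: G.inv_mult_group)

lemma Delta_inv: "g \<in> carrier G \<Longrightarrow> \<Delta> (inv\<^bsub>G\<^esub> g) = \<ominus>\<^bsub>KG\<^esub> (\<Delta> g \<otimes>\<^bsub>KG\<^esub> \<delta> (inv\<^bsub>G\<^esub> g))"
  by (simp add: a_minus_def R.l_distr R.l_minus delta_inv R.minus_add R.a_comm)

text \<open>The dimension subgroup \<open>G \<inter> (1 + I)\<close>.\<close>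

definition dim_subgroup :: "('g \<Rightarrow> 'k) set \<Rightarrow> 'g set" where
  "dim_subgroup I = {g \<in> carrier G. \<Delta> g \<in> I}"

lemma dim_subgroup:
  assumes "ideal I KG"
  shows "subgroup (dim_subgroup I) G"
proof -
  interpret I: ideal I KG by fact
  show ?thesis
  proof
    fix x y assume "x \<in> dim_subgroup I" "y \<in> dim_subgroup I"
    then show "x \<otimes>\<^bsub>G\<^esub> y \<in> dim_subgroup I"
      by (auto simp: dim_subgroup_def Delta_mult I.I_r_closed intro!: I.a_closed)
  next
    fix x assume "x \<in> dim_subgroup I"
    then show "inv\<^bsub>G\<^esub> x \<in> dim_subgroup I"
      by (auto simp: dim_subgroup_def Delta_inv I.I_r_closed intro!: I.a_inv_closed)
  qed (auto simp: dim_subgroup_def)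
qed

lemma gcomm_mem_dim_subgroup:
  assumes "ideal I KG" "g \<in> carrier G" "h \<in> carrier G" "lie_bracket KG (\<delta> g) (\<delta> h) \<in> I"
  shows "gcomm G g h \<in> dim_subgroup I"
  using assms by (auto simp: dim_subgroup_def Delta_gcomm ideal.I_r_closed simp del: G.inv_mult_group)

subsection \<open>Lie nilpotent group algebras\<close>

lemma lie_bracket_mem_LP2: "x \<in> carrier KG \<Longrightarrow> y \<in> carrier KG \<Longrightarrow> lie_bracket KG x y \<in> R.LP 2"
  using R.Lcomm_bracket[of x 1 y] R.Lcomm_one R.Lcomm_LP[of 2] by (auto simp: numeral_2_eq_2)

lemma derived_subset_LP2: "derived G (carrier G) \<subseteq> dim_subgroup (R.LP 2)"
proof -
  have I: "ideal (R.LP 2) KG" by (rule R.LP_ideal) simp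
  have "derived_set G (carrier G) \<subseteq> dim_subgroup (R.LP 2)"
    using gcomm_mem_dim_subgroup[OF I _ _ lie_bracket_mem_LP2] by (auto simp: gcomm_def)
  then show ?thesis unfolding derived_def by (rule G.generate_subgroup_incl[OF _ dim_subgroup[OF I]])
qed

lemma Delta_mult_Delta_mem_LP3:
  assumes "x \<in> carrier G" "y \<in> carrier G" "t \<in> carrier G"
  shows "\<Delta> (gcomm G x y) \<otimes>\<^bsub>KG\<^esub> \<Delta> (gcomm G x t) \<in> R.LP 3"
proof -
  interpret I: ideal "R.LP 3" KG by (rule R.LP_ideal) simp
  let ?u = "\<delta> (inv\<^bsub>G\<^esub> (y \<otimes>\<^bsub>G\<^esub> x))" and ?v = "\<delta> (inv\<^bsub>G\<^esub> (t \<otimes>\<^bsub>G\<^esub> x))"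
  have "lie_bracket KG (\<delta> x) (\<delta> y) \<otimes>\<^bsub>KG\<^esub> (?u \<otimes>\<^bsub>KG\<^esub> lie_bracket KG (\<delta> x) (\<delta> t)) \<in> R.LP 3"
    using assms by (intro R.bracket_mult_bracket_mem_LP3) auto
  then have "lie_bracket KG (\<delta> x) (\<delta> y) \<otimes>\<^bsub>KG\<^esub> (?u \<otimes>\<^bsub>KG\<^esub> lie_bracket KG (\<delta> x) (\<delta> t)) \<otimes>\<^bsub>KG\<^esub> ?v \<in> R.LP 3"
    by (rule I.I_r_closed) (use assms in auto)
  then show ?thesis using assms by (simp add: Delta_gcomm R.m_assoc del: G.inv_mult_group)
qed

text \<open>Factors are taken in pairs: two commutators with the same first entry \<open>x\<close>
  give an element of \<open>LP 3\<close>, and by \<open>LP3_mult\<close> each such pair raises the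
  lower Lie power by one.\<close>

lemma prodl_Delta_gcomm_mem_LP:
  assumes "x \<in> carrier G"
  shows "length es = 2 * k \<Longrightarrow> set es \<subseteq> gcomm G x ` carrier G \<Longrightarrow> R.prodl (map \<Delta> es) \<in> R.LP (Suc k)"
proof (induction k arbitrary: es)
  case 0
  then show ?case by (simp add: lower_Lie_power_def)
next
  case (Suc k)
  then obtain e1 e2 r where es: "es = e1 # e2 # r" "length r = 2 * k"
    by (auto simp: length_Suc_conv)
  with Suc have "R.prodl (map \<Delta> r) \<in> R.LP (Suc k)" by auto
  moreover have "\<Delta> e1 \<otimes>\<^bsub>KG\<^esub> \<Delta> e2 \<in> R.LP 3"
    using Suc.prems es assms Delta_mult_Delta_mem_LP3 by auto
  ultimately have "\<Delta> e1 \<otimes>\<^bsub>KG\<^esub> \<Delta> e2 \<otimes>\<^bsub>KG\<^esub> R.prodl (map \<Delta> r) \<in> R.LP (Suc (Suc k))"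
    by (intro R.LP3_mult) auto
  moreover have "set (map \<Delta> r) \<subseteq> carrier KG" "e1 \<in> carrier G" "e2 \<in> carrier G"
    using Suc.prems es assms by auto
  ultimately show ?case using es by (simp add: R.m_assoc)
qed

text \<open>
  Only few group elements \<open>e\<close> satisfy \<open>(e - 1) a = 0\<close>, since \<open>e\<close> then maps the support of \<open>a\<close>
  to itself.
\<close>

lemma card_commutators_le:
  assumes m: "R.LP m = {\<zero>\<^bsub>KG\<^esub>}" "m \<ge> 1" and K1: "\<one>\<^bsub>K\<^esub> \<noteq> \<zero>\<^bsub>K\<^esub>" and x: "x \<in> carrier G"
  shows "finite (gcomm G x ` carrier G) \<and> card (gcomm G x ` carrier G) \<le> 2 ^ (2 * m)"
proof (rule ccontr)
  assume neg: "\<not> ?thesis"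
  let ?C = "gcomm G x ` carrier G"
  have C: "?C \<subseteq> carrier G" using x by auto
  \<comment> \<open>A nonzero product is built greedily. Each factor at most doubles the support,
    and \<open>2 m\<close> factors are enough to contradict \<open>LP m = 0\<close>.\<close>
  have "j \<le> 2 * m \<Longrightarrow> \<exists>es. length es = j \<and> set es \<subseteq> ?C \<and> R.prodl (map \<Delta> es) \<noteq> \<zero>\<^bsub>KG\<^esub> \<and>
      card (supp K (R.prodl (map \<Delta> es))) \<le> 2 ^ j" for j
  proof (induction j)
    case 0
    have "supp K (\<one>\<^bsub>KG\<^esub>) = {\<one>\<^bsub>G\<^esub>}" using K1 by (auto simp: supp_def one_apply)
    then show ?case by (auto simp: eq_zero_iff_supp intro!: exI[of _ "[]"])
  next
    case (Suc j)
    then obtain es where es: "length es = j" "set es \<subseteq> ?C" "R.prodl (map \<Delta> es) \<noteq> \<zero>\<^bsub>KG\<^esub>"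
      "card (supp K (R.prodl (map \<Delta> es))) \<le> 2 ^ j" by auto
    define a where "a = R.prodl (map \<Delta> es)"
    have "set es \<subseteq> carrier G" using es C by blast
    then have "set (map \<Delta> es) \<subseteq> carrier KG" by auto
    then have a: "a \<in> carrier KG" by (simp add: a_def R.prodl_closed)
    note aD = carrierD[OF a]
    obtain y where y: "y \<in> supp K a" using es(3) by (auto simp: eq_zero_iff_supp a_def)
    \<comment> \<open>If \<open>(e - 1) a\<close> vanishes at \<open>y\<close>, then
      \<open>e^-1 y\<close> lies in the support of \<open>a\<close>. So at most \<open>2 ^ j\<close>
      elements \<open>e\<close> are excluded, while \<open>neg\<close> provides more commutators
      than that.\<close>
    define Bad where "Bad = (\<lambda>z. y \<otimes>\<^bsub>G\<^esub> inv\<^bsub>G\<^esub> z) ` supp K a"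
    have Bad: "finite Bad" "card Bad \<le> 2 ^ j"
      using aD(2) es(4) card_image_le[OF aD(2), of "\<lambda>z. y \<otimes>\<^bsub>G\<^esub> inv\<^bsub>G\<^esub> z"] by (auto simp: Bad_def a_def)
    have "\<not> ?C \<subseteq> Bad"
    proof
      assume sub: "?C \<subseteq> Bad"
      have "card Bad \<le> 2 ^ (2 * m)" 
      proof (rule order.trans[OF Bad(2)])
        show "(2::nat) ^ j \<le> 2 ^ (2 * m)" by (rule power_increasing) (use Suc.prems in auto)
      qed
      moreover have "finite ?C" using sub Bad(1) by (rule finite_subset)
      moreover have "card ?C \<le> card Bad" using Bad(1) sub by (rule card_mono)
      ultimately show False using neg by linarith
    qed
    then obtain e where e: "e \<in> ?C" "e \<notin> Bad" by blast
    have eG: "e \<in> carrier G" and yG: "y \<in> carrier G" using e C y aD by auto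
    have ea: "\<Delta> e \<otimes>\<^bsub>KG\<^esub> a = \<delta> e \<otimes>\<^bsub>KG\<^esub> a \<ominus>\<^bsub>KG\<^esub> a"
      using eG a by (simp add: a_minus_def R.l_distr R.l_minus)
    have ap: "(\<Delta> e \<otimes>\<^bsub>KG\<^esub> a) g = a (inv\<^bsub>G\<^esub> e \<otimes>\<^bsub>G\<^esub> g) \<ominus>\<^bsub>K\<^esub> a g" if "g \<in> carrier G" for g
      using that eG a aD by (simp add: ea minus_apply mon_mult_apply)
    have "(\<Delta> e \<otimes>\<^bsub>KG\<^esub> a) y \<noteq> \<zero>\<^bsub>K\<^esub>"
    proof
      assume "(\<Delta> e \<otimes>\<^bsub>KG\<^esub> a) y = \<zero>\<^bsub>K\<^esub>"
      then have "a (inv\<^bsub>G\<^esub> e \<otimes>\<^bsub>G\<^esub> y) = a y" using ap[OF yG] aD by (simp add: K.r_right_minus_eq)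
      then have "inv\<^bsub>G\<^esub> e \<otimes>\<^bsub>G\<^esub> y \<in> supp K a" using y by (simp add: supp_def)
      moreover have "e = y \<otimes>\<^bsub>G\<^esub> inv\<^bsub>G\<^esub> (inv\<^bsub>G\<^esub> e \<otimes>\<^bsub>G\<^esub> y)" using eG yG by (simp add: G.group_nf)
      ultimately show False using e(2) by (auto simp: Bad_def)
    qed
    then have nz: "\<Delta> e \<otimes>\<^bsub>KG\<^esub> a \<noteq> \<zero>\<^bsub>KG\<^esub>" by (auto simp: zero_apply)
    have "supp K (\<Delta> e \<otimes>\<^bsub>KG\<^esub> a) \<subseteq> (\<lambda>g. e \<otimes>\<^bsub>G\<^esub> g) ` supp K a \<union> supp K a"
    proof
      fix g assume g: "g \<in> supp K (\<Delta> e \<otimes>\<^bsub>KG\<^esub> a)"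
      then have gG: "g \<in> carrier G" using mult_outside by (auto simp: supp_def)
      then have "a (inv\<^bsub>G\<^esub> e \<otimes>\<^bsub>G\<^esub> g) \<noteq> \<zero>\<^bsub>K\<^esub> \<or> a g \<noteq> \<zero>\<^bsub>K\<^esub>"
        using ap[OF gG] g by (auto simp: supp_def a_minus_def)
      moreover have "g = e \<otimes>\<^bsub>G\<^esub> (inv\<^bsub>G\<^esub> e \<otimes>\<^bsub>G\<^esub> g)" using eG gG by (simp add: G.inv_r_cancel)
      ultimately show "g \<in> (\<lambda>g. e \<otimes>\<^bsub>G\<^esub> g) ` supp K a \<union> supp K a" by (auto simp: supp_def)
    qed
    then have "card (supp K (\<Delta> e \<otimes>\<^bsub>KG\<^esub> a)) \<le> card ((\<lambda>g. e \<otimes>\<^bsub>G\<^esub> g) ` supp K a \<union> supp K a)"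
      using aD by (intro card_mono) auto
    also have "\<dots> \<le> card (supp K a) + card (supp K a)"
      using card_Un_le[of "(\<lambda>g. e \<otimes>\<^bsub>G\<^esub> g) ` supp K a" "supp K a"] card_image_le[OF aD(2), of "\<lambda>g. e \<otimes>\<^bsub>G\<^esub> g"]
      by linarith
    also have "\<dots> \<le> 2 ^ Suc j" using es(4) by (simp add: a_def)
    finally have "card (supp K (\<Delta> e \<otimes>\<^bsub>KG\<^esub> a)) \<le> 2 ^ Suc j" .
    with nz es e show ?case by (intro exI[of _ "e # es"]) (auto simp: a_def)
  qed
  from this[OF order.refl] obtain es where es: "length es = 2 * m" "set es \<subseteq> ?C"
    "R.prodl (map \<Delta> es) \<noteq> \<zero>\<^bsub>KG\<^esub>" by blast
  then show False using prodl_Delta_gcomm_mem_LP[OF x es(1,2)] m R.LP_antimono[of m "Suc m"] by auto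
qed

text \<open>Brackets are bilinear, so group elements suffice. This brings in the finitely many group
  commutators and makes a pigeonhole argument possible.\<close>

lemma LP2_subset:
  "R.LP 2 \<subseteq> Idl\<^bsub>KG\<^esub> {lie_bracket KG (\<delta> g) (\<delta> h) | g h. g \<in> carrier G \<and> h \<in> carrier G}"
    (is "_ \<subseteq> Idl\<^bsub>KG\<^esub> ?U")
proof -
  have U: "?U \<subseteq> carrier KG" by auto
  interpret I: ideal "Idl\<^bsub>KG\<^esub> ?U" KG by (rule R.genideal_ideal[OF U])
  have "lie_bracket KG x y \<in> Idl\<^bsub>KG\<^esub> ?U" if "x \<in> carrier KG" "y \<in> carrier KG" for x y
    using that
  proof (induction x rule: KG_induct)
    case zero
    then show ?case by (simp add: R.lie_bracket_zero)
  next
    case (add a b)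
    then show ?case by (simp add: R.lie_bracket_add_left I.a_closed)
  next
    case (mon c g)
    from mon(3) show ?case
    proof (induction y rule: KG_induct)
      case zero
      then show ?case using mon by (simp add: R.lie_bracket_zero)
    next
      case (add a b)
      then show ?case using mon by (simp add: R.lie_bracket_add_right I.a_closed)
    next
      case (mon d h)
      have "lie_bracket KG (\<delta> g) (\<delta> h) \<in> ?U"
        using mon(2) \<open>g \<in> carrier G\<close> by blast
      then have "lie_bracket KG (\<delta> g) (\<delta> h) \<in> Idl\<^bsub>KG\<^esub> ?U"
        by (rule subsetD[OF R.genideal_self[OF U]])
      then have "mon (c \<otimes>\<^bsub>K\<^esub> d) \<one>\<^bsub>G\<^esub> \<otimes>\<^bsub>KG\<^esub> lie_bracket KG (\<delta> g) (\<delta> h) \<in> Idl\<^bsub>KG\<^esub> ?U"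
        by (rule I.I_l_closed) (use mon \<open>c \<in> carrier K\<close> in auto)
      then show ?case
        using lie_bracket_mon[OF \<open>c \<in> carrier K\<close> mon(1) \<open>g \<in> carrier G\<close> mon(2)] by simp
    qed
  qed
  note br = this
  have "R.Lcomm 2 \<subseteq> Idl\<^bsub>KG\<^esub> ?U"
  proof
    fix u assume "u \<in> R.Lcomm 2"
    then have "u \<in> R.Lcomm (Suc (Suc 0))" by (simp add: numeral_2_eq_2)
    then show "u \<in> Idl\<^bsub>KG\<^esub> ?U"
      by (rule R.Lcomm_Suc) (use br R.Lcomm_one in auto)
  qed
  then have "Idl\<^bsub>KG\<^esub> (R.Lcomm 2) \<subseteq> Idl\<^bsub>KG\<^esub> ?U" by (rule R.genideal_minimal[OF I.ideal_axioms])
  then show ?thesis using R.LP_eq[of 2] by simp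
qed

text \<open>Two brackets with the same group commutator differ by a unit \<open>v\<close> only. The
  product therefore contains \<open>B r B\<close> with a single bracket \<open>B\<close>, and this
  lies in \<open>LP 3\<close>.\<close>

lemma prodl_bracket_mem_LP3:
  assumes ps: "set ps \<subseteq> carrier G \<times> carrier G" and nd: "\<not> distinct (map (\<lambda>(g, h). gcomm G g h) ps)"
  shows "R.prodl (map (\<lambda>(g, h). lie_bracket KG (\<delta> g) (\<delta> h)) ps) \<in> R.LP 3"
proof -
  interpret I: ideal "R.LP 3" KG by (rule R.LP_ideal) simp
  let ?b = "\<lambda>(g, h). lie_bracket KG (\<delta> g) (\<delta> h)"
  define f where "f = (\<lambda>(g, h). gcomm G g h)"
  obtain xs ys zs c where "map f ps = xs @ [c] @ ys @ [c] @ zs"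
    using not_distinct_decomp[OF nd] unfolding f_def by blast
  then obtain ps1 q1 ps2 q2 ps3 where dec: "ps = ps1 @ q1 # ps2 @ q2 # ps3"
    and c: "f q1 = c" "f q2 = c"
    by (auto simp: map_eq_append_conv map_eq_Cons_conv append_eq_map_conv Cons_eq_map_conv)
  obtain x y x' y' where q: "q1 = (x, y)" "q2 = (x', y')" by fastforce
  have cl: "x \<in> carrier G" "y \<in> carrier G" "x' \<in> carrier G" "y' \<in> carrier G"
    using ps q by (auto simp: dec)
  define P1 P2 P3 where "P1 = R.prodl (map ?b ps1)" and "P2 = R.prodl (map ?b ps2)" and "P3 = R.prodl (map ?b ps3)"
  have sub: "set (map ?b ps1) \<subseteq> carrier KG" "set (map ?b ps2) \<subseteq> carrier KG" "set (map ?b ps3) \<subseteq> carrier KG"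
    using ps by (auto simp: dec)
  then have P: "P1 \<in> carrier KG" "P2 \<in> carrier KG" "P3 \<in> carrier KG"
    by (auto simp: P1_def P2_def P3_def intro!: R.prodl_closed)
  define v where "v = \<delta> (inv\<^bsub>G\<^esub> (y \<otimes>\<^bsub>G\<^esub> x)) \<otimes>\<^bsub>KG\<^esub> \<delta> (y' \<otimes>\<^bsub>G\<^esub> x')"
  have v: "v \<in> carrier KG" using cl by (auto simp: v_def)
  have "lie_bracket KG (\<delta> x') (\<delta> y') = \<Delta> (gcomm G x y) \<otimes>\<^bsub>KG\<^esub> \<delta> (y' \<otimes>\<^bsub>G\<^esub> x')"
    using c q cl by (simp add: lie_bracket_delta f_def)
  also have "\<dots> = lie_bracket KG (\<delta> x) (\<delta> y) \<otimes>\<^bsub>KG\<^esub> v"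
    using cl by (simp add: Delta_gcomm v_def R.m_assoc del: G.inv_mult_group)
  finally have b2: "lie_bracket KG (\<delta> x') (\<delta> y') = lie_bracket KG (\<delta> x) (\<delta> y) \<otimes>\<^bsub>KG\<^esub> v" .
  let ?B = "lie_bracket KG (\<delta> x) (\<delta> y)"
  have "?B \<otimes>\<^bsub>KG\<^esub> (P2 \<otimes>\<^bsub>KG\<^esub> ?B) \<in> R.LP 3"
    using cl P by (intro R.bracket_mult_bracket_mem_LP3) auto
  then have "?B \<otimes>\<^bsub>KG\<^esub> (P2 \<otimes>\<^bsub>KG\<^esub> ?B) \<otimes>\<^bsub>KG\<^esub> (v \<otimes>\<^bsub>KG\<^esub> P3) \<in> R.LP 3"
    by (rule I.I_r_closed) (use P v in simp)
  then have "P1 \<otimes>\<^bsub>KG\<^esub> (?B \<otimes>\<^bsub>KG\<^esub> (P2 \<otimes>\<^bsub>KG\<^esub> ?B) \<otimes>\<^bsub>KG\<^esub> (v \<otimes>\<^bsub>KG\<^esub> P3)) \<in> R.LP 3"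
    using P(1) by (rule I.I_l_closed)
  moreover have "R.prodl (map ?b ps) = P1 \<otimes>\<^bsub>KG\<^esub> (?B \<otimes>\<^bsub>KG\<^esub> (P2 \<otimes>\<^bsub>KG\<^esub> (?B \<otimes>\<^bsub>KG\<^esub> v \<otimes>\<^bsub>KG\<^esub> P3)))"
    using sub cl by (simp add: dec q R.prodl_append b2[symmetric] P1_def P2_def P3_def)
  ultimately show ?thesis using P v cl by (simp add: R.m_assoc)
qed

text \<open>Brackets of group elements commute with all coefficients modulo commutators of length
  three. So a product of elements of \<open>LP 2\<close> lies in the ideal generated by products of
  such brackets together with \<open>Lcomm 3\<close>; when there are more brackets than group
  commutators, a commutator repeats.\<close>

lemma LP2_nilpotent:
  assumes m: "R.LP m = {\<zero>\<^bsub>KG\<^esub>}" "m \<ge> 1" and fin: "finite {gcomm G x y | x y. x \<in> carrier G \<and> y \<in> carrier G}"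
  shows "\<exists>N. \<forall>as. set as \<subseteq> R.LP 2 \<longrightarrow> length as \<ge> N \<longrightarrow> R.prodl as = \<zero>\<^bsub>KG\<^esub>"
proof -
  let ?b = "\<lambda>(g, h). lie_bracket KG (\<delta> g) (\<delta> h)"
  define U where "U = {lie_bracket KG (\<delta> g) (\<delta> h) | g h. g \<in> carrier G \<and> h \<in> carrier G}"
  define W where "W k = {R.prodl (map ?b ps) | ps. length ps = k \<and> set ps \<subseteq> carrier G \<times> carrier G}" for k :: nat
  have U: "U \<subseteq> carrier KG" by (auto simp: U_def)
  have L3: "R.Lcomm 3 \<subseteq> carrier KG" by (rule R.Lcomm_subset_carrier) simp
  have "R.prodl (map ?b ps) \<in> carrier KG" if "set ps \<subseteq> carrier G \<times> carrier G" for ps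
    by (rule R.prodl_closed) (use that in auto)
  then have W: "W k \<union> R.Lcomm 3 \<subseteq> carrier KG" for k using L3 by (auto simp: W_def)
  interpret J: ideal "Idl\<^bsub>KG\<^esub> (W k \<union> R.Lcomm 3)" KG for k by (rule R.genideal_ideal[OF W])
  have *: "R.prodl as \<in> Idl\<^bsub>KG\<^esub> (W (length as) \<union> R.Lcomm 3)" if "set as \<subseteq> R.LP 2" for as
    using that
  proof (induction as)
    case Nil
    have "\<one>\<^bsub>KG\<^esub> \<in> W 0" by (auto simp: W_def)
    then show ?case using R.genideal_self[OF W] by auto
  next
    case (Cons a as)
    let ?k = "length as"
    let ?I = "Idl\<^bsub>KG\<^esub> (W (Suc ?k) \<union> R.Lcomm 3)"
    have "a \<otimes>\<^bsub>KG\<^esub> R.prodl as \<in> ?I"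
    proof (rule R.genideal_mult_mem[OF U W J.ideal_axioms])
      show "a \<in> Idl\<^bsub>KG\<^esub> U" using Cons.prems LP2_subset by (auto simp: U_def)
      show "R.prodl as \<in> Idl\<^bsub>KG\<^esub> (W ?k \<union> R.Lcomm 3)" using Cons by simp
      fix x r y assume x: "x \<in> U" and r: "r \<in> carrier KG" and y: "y \<in> W ?k \<union> R.Lcomm 3"
      then have xc: "x \<in> carrier KG" and yc: "y \<in> carrier KG" using U W by blast+
      have L3I: "u \<in> ?I" if "u \<in> R.Lcomm 3" for u using that R.genideal_self[OF W] by auto
      show "x \<otimes>\<^bsub>KG\<^esub> (r \<otimes>\<^bsub>KG\<^esub> y) \<in> ?I"
      proof (cases "y \<in> W ?k")
        case True
        from x obtain g h where gh: "g \<in> carrier G" "h \<in> carrier G" "x = ?b (g, h)" by (auto simp: U_def)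
        from True obtain ps where ps: "length ps = ?k" "set ps \<subseteq> carrier G \<times> carrier G"
          "y = R.prodl (map ?b ps)" by (auto simp: W_def)
        have "x \<otimes>\<^bsub>KG\<^esub> y \<in> W (Suc ?k)"
          unfolding W_def using gh ps by (auto intro!: exI[of _ "(g, h) # ps"])
        then have 1: "x \<otimes>\<^bsub>KG\<^esub> y \<in> ?I" using R.genideal_self[OF W] by auto
        have "x \<in> R.Lcomm 2"
          using gh R.Lcomm_bracket[of "\<delta> g" 1 "\<delta> h"] R.Lcomm_one by (auto simp: numeral_2_eq_2)
        then have 2: "lie_bracket KG x r \<in> ?I"
          using R.Lcomm_bracket[of x 2 r] r L3I by (simp add: numeral_3_eq_3 numeral_2_eq_2)
        have "x \<otimes>\<^bsub>KG\<^esub> (r \<otimes>\<^bsub>KG\<^esub> y) = (r \<otimes>\<^bsub>KG\<^esub> x \<oplus>\<^bsub>KG\<^esub> lie_bracket KG x r) \<otimes>\<^bsub>KG\<^esub> y"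
          using xc r yc R.lie_bracket_swap[of x r] by (simp add: R.m_assoc[symmetric])
        also have "\<dots> = r \<otimes>\<^bsub>KG\<^esub> (x \<otimes>\<^bsub>KG\<^esub> y) \<oplus>\<^bsub>KG\<^esub> lie_bracket KG x r \<otimes>\<^bsub>KG\<^esub> y"
          using xc r yc by (simp add: R.l_distr R.m_assoc)
        finally show ?thesis using J.I_l_closed[OF 1 r] J.I_r_closed[OF 2 yc] J.a_closed by simp
      next
        case False
        then have "y \<in> ?I" using y L3I by blast
        then show ?thesis using xc r by (intro J.I_l_closed) auto
      qed
    qed
    then show ?case by simp
  qed
  \<comment> \<open>One more than the number of commutators: every block of \<open>M\<close> factors
    lies in \<open>LP 3\<close>, and \<open>m\<close> blocks reach \<open>LP (Suc m)\<close>, which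
    is zero.\<close>
  define M where "M = Suc (card {gcomm G x y | x y. x \<in> carrier G \<and> y \<in> carrier G})"
  have "W M \<subseteq> R.LP 3"
  proof
    fix w assume "w \<in> W M"
    then obtain ps where ps: "length ps = M" "set ps \<subseteq> carrier G \<times> carrier G"
      "w = R.prodl (map ?b ps)" by (auto simp: W_def)
    have "set (map (\<lambda>(g, h). gcomm G g h) ps) \<subseteq> {gcomm G x y | x y. x \<in> carrier G \<and> y \<in> carrier G}"
      using ps by auto
    then have "card (set (map (\<lambda>(g, h). gcomm G g h) ps)) < M"
      using card_mono[OF fin] by (auto simp: M_def le_imp_less_Suc)
    then have "\<not> distinct (map (\<lambda>(g, h). gcomm G g h) ps)" using ps(1) distinct_card by fastforce
    then show "w \<in> R.LP 3" using prodl_bracket_mem_LP3[OF ps(2)] ps(3) by simp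
  qed
  then have IL: "Idl\<^bsub>KG\<^esub> (W M \<union> R.Lcomm 3) \<subseteq> R.LP 3"
    using R.Lcomm_LP[of 3] by (intro R.genideal_minimal R.LP_ideal) auto
  have LP2c: "R.LP 2 \<subseteq> carrier KG" using ideal.Icarr[OF R.LP_ideal[of 2]] by auto
  have "R.prodl as \<in> R.LP (Suc k)" if "set as \<subseteq> R.LP 2" "length as \<ge> M * k" for as k
    using that
  proof (induction k arbitrary: as)
    case 0
    then show ?case using R.prodl_closed[of as] LP2c by (auto simp: lower_Lie_power_def)
  next
    case (Suc k)
    define bs cs where "bs = take M as" and "cs = drop M as"
    have as: "as = bs @ cs" "length bs = M" "length cs \<ge> M * k" "set bs \<subseteq> R.LP 2" "set cs \<subseteq> R.LP 2"
      using Suc.prems set_take_subset[of M as] set_drop_subset[of M as] by (auto simp: bs_def cs_def)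
    have "R.prodl bs \<in> R.LP 3" using *[OF as(4)] as(2) IL by auto
    then have "R.prodl bs \<otimes>\<^bsub>KG\<^esub> R.prodl cs \<in> R.LP (Suc (Suc k))"
      using Suc.IH[OF as(5,3)] by (intro R.LP3_mult) auto
    moreover have "set bs \<subseteq> carrier KG" "set cs \<subseteq> carrier KG" using as(4,5) LP2c by auto
    ultimately show ?case by (simp add: as(1) R.prodl_append)
  qed
  note LPk = this
  have "R.prodl as = \<zero>\<^bsub>KG\<^esub>" if "set as \<subseteq> R.LP 2" "length as \<ge> M * m" for as
    using LPk[OF that] m R.LP_antimono[of m "Suc m"] by auto
  then show ?thesis by (intro exI[of _ "M * m"] allI impI)
qed

text \<open>Each \<open>h\<close> in \<open>S\<close> fixes \<open>a\<close> under right
  multiplication, so it moves a chosen point of the finite support to another one; distinct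
  \<open>h\<close> give distinct points.\<close>

lemma finite_of_annihilator:
  assumes a: "a \<in> carrier KG" "a \<noteq> \<zero>\<^bsub>KG\<^esub>" and S: "S \<subseteq> carrier G" and h: "\<And>h. h \<in> S \<Longrightarrow> a \<otimes>\<^bsub>KG\<^esub> \<Delta> h = \<zero>\<^bsub>KG\<^esub>"
  shows "finite S"
proof -
  note aD = carrierD[OF a(1)]
  obtain y where y: "y \<in> supp K a" using a(2) by (auto simp: eq_zero_iff_supp)
  have yG: "y \<in> carrier G" using y aD by blast
  have "(\<lambda>h. y \<otimes>\<^bsub>G\<^esub> inv\<^bsub>G\<^esub> h) ` S \<subseteq> supp K a"
  proof
    fix z assume "z \<in> (\<lambda>h. y \<otimes>\<^bsub>G\<^esub> inv\<^bsub>G\<^esub> h) ` S"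
    then obtain g where g: "g \<in> S" "z = y \<otimes>\<^bsub>G\<^esub> inv\<^bsub>G\<^esub> g" by blast
    have gG: "g \<in> carrier G" using g S by blast
    have "a \<otimes>\<^bsub>KG\<^esub> \<Delta> g = a \<otimes>\<^bsub>KG\<^esub> \<delta> g \<ominus>\<^bsub>KG\<^esub> a"
      using a gG by (simp add: a_minus_def R.r_distr R.r_minus)
    then have "a \<otimes>\<^bsub>KG\<^esub> \<delta> g \<ominus>\<^bsub>KG\<^esub> a = \<zero>\<^bsub>KG\<^esub>" using h[OF g(1)] by simp
    then have "a \<otimes>\<^bsub>KG\<^esub> \<delta> g = a" using R.r_right_minus_eq[of "a \<otimes>\<^bsub>KG\<^esub> \<delta> g" a] a(1) gG by simp
    then have "(a \<otimes>\<^bsub>KG\<^esub> \<delta> g) y = a y" by simp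
    then have "a z = a y" using g gG yG a aD by (simp add: mult_mon_apply)
    then show "z \<in> supp K a" using y by (simp add: supp_def)
  qed
  then have "finite ((\<lambda>h. y \<otimes>\<^bsub>G\<^esub> inv\<^bsub>G\<^esub> h) ` S)" using aD(2) finite_subset by blast
  moreover have "inj_on (\<lambda>h. y \<otimes>\<^bsub>G\<^esub> inv\<^bsub>G\<^esub> h) S"
    using S yG by (intro inj_onI) (metis G.inv_closed G.inv_inv G.l_cancel subsetD)
  ultimately show ?thesis by (rule finite_imageD)
qed

lemma Lie_nilpotent_consequences:
  assumes nil: "Lie_nilpotent KG" and K1: "\<one>\<^bsub>K\<^esub> \<noteq> \<zero>\<^bsub>K\<^esub>"
  shows "finite (derived G (carrier G))" "\<exists>n. R.ULP (Suc n) = {\<zero>\<^bsub>KG\<^esub>}"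
proof -
  from nil obtain m where m: "R.LP m = {\<zero>\<^bsub>KG\<^esub>}" "m \<ge> 1" by (auto simp: Lie_nilpotent_def)
  have "finite {gcomm G x y | x y. x \<in> carrier G \<and> y \<in> carrier G}"
    using card_commutators_le[OF m K1] by (rule G.finite_commutators)
  from LP2_nilpotent[OF m this] obtain N
    where N: "\<And>as. set as \<subseteq> R.LP 2 \<Longrightarrow> length as \<ge> N \<Longrightarrow> R.prodl as = \<zero>\<^bsub>KG\<^esub>" by blast
  show "\<exists>n. R.ULP (Suc n) = {\<zero>\<^bsub>KG\<^esub>}" using R.ULP_eventually_zero[OF m N] by blast
  have LP2c: "R.LP 2 \<subseteq> carrier KG" using ideal.Icarr[OF R.LP_ideal[of 2]] by auto
  \<comment> \<open>A nonzero product of maximal length in \<open>LP 2\<close> is annihilated by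
    every \<open>h - 1\<close> with \<open>h\<close> in \<open>G'\<close>.\<close>
  define P where "P n \<longleftrightarrow> (\<exists>as. length as = n \<and> set as \<subseteq> R.LP 2 \<and> R.prodl as \<noteq> \<zero>\<^bsub>KG\<^esub>)" for n
  have "\<one>\<^bsub>KG\<^esub> \<noteq> \<zero>\<^bsub>KG\<^esub>" using K1 by (metis one_apply zero_apply)
  then have "P 0" by (auto simp: P_def)
  moreover have "\<forall>n. P n \<longrightarrow> n \<le> N" using N by (force simp: P_def)
  ultimately obtain n where n: "P n" "\<not> P (Suc n)"
    using ex_has_greatest_nat[of P 0 "\<lambda>x. x" "Suc N"] by (metis Suc_n_not_le_n le_imp_less_Suc)
  from n(1) obtain as where as: "length as = n" "set as \<subseteq> R.LP 2" "R.prodl as \<noteq> \<zero>\<^bsub>KG\<^esub>"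
    by (auto simp: P_def)
  have asc: "set as \<subseteq> carrier KG" using as LP2c by blast
  show "finite (derived G (carrier G))"
  proof (rule finite_of_annihilator)
    show "R.prodl as \<in> carrier KG" "R.prodl as \<noteq> \<zero>\<^bsub>KG\<^esub>" using asc as by auto
    show "derived G (carrier G) \<subseteq> carrier G" by (rule G.derived_in_carrier) simp
    fix h assume "h \<in> derived G (carrier G)"
    then have h: "\<Delta> h \<in> R.LP 2" "\<Delta> h \<in> carrier KG" using derived_subset_LP2 LP2c by (auto simp: dim_subgroup_def)
    then have "R.prodl (as @ [\<Delta> h]) = \<zero>\<^bsub>KG\<^esub>" using n(2) as by (auto simp: P_def)
    then show "R.prodl as \<otimes>\<^bsub>KG\<^esub> \<Delta> h = \<zero>\<^bsub>KG\<^esub>" using h asc by (simp add: R.prodl_append)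
  qed
qed

end


subsection \<open>Subgroups of prime index\<close>

text \<open>\<open>M0\<close> is a subgroup of index \<open>p\<close>, normal in \<open>M\<close>,
  and \<open>x\<close> generates the quotient. The normal form \<open>m x^e\<close> is stated
  directly, without quotient groups, because monomials of the group algebra will be rewritten to
  it.\<close>

locale subgroup_step = group G for G (structure) +
  fixes p :: nat and M M0 :: "'a set" and x :: 'a
  assumes prime: "Factorial_Ring.prime p" and M: "subgroup M G" and M0: "subgroup M0 G" and M0_M: "M0 \<subseteq> M"
    and x: "x \<in> M" "x \<notin> M0" and x_pow: "x [^] p \<in> M0"
    and x_conj: "\<And>m. m \<in> M0 \<Longrightarrow> x \<otimes> m \<otimes> inv x \<in> M0"
    and decomp: "\<And>g. g \<in> M \<Longrightarrow> \<exists>m\<in>M0. \<exists>e<p. g = m \<otimes> x [^] e"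
begin

lemma in_carrier: "g \<in> M \<Longrightarrow> g \<in> carrier G" "x \<in> carrier G" "m \<in> M0 \<Longrightarrow> m \<in> carrier G"
  using subgroup.mem_carrier[OF M] subgroup.mem_carrier[OF M0] x(1) by simp_all

text \<open>By Bezout, \<open>x^e\<close> and \<open>x^p\<close> in \<open>M0\<close> would give
  \<open>x\<close> in \<open>M0\<close>.\<close>

lemma pow_not_mem:
  assumes "0 < e" "e < p" shows "x [^] e \<notin> M0"
proof
  assume mem: "x [^] e \<in> M0"
  have "\<not> p dvd e" using assms nat_dvd_not_less by blast
  then have "coprime p e" using prime prime_imp_coprime_nat by blast
  then have "coprime (int e) (int p)" by (simp add: coprime_commute)
  then obtain a b where ab: "a * int e + b * int p = 1" using bezout_int[of "int e" "int p"] by auto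
  have "x = x [^] (int e * a + int p * b)" using ab in_carrier by (simp add: mult.commute)
  also have "\<dots> = (x [^] (int e)) [^] a \<otimes> (x [^] (int p)) [^] b"
    using in_carrier by (simp add: int_pow_mult int_pow_pow)
  also have "\<dots> \<in> M0"
    using mem x_pow M0 by (simp add: int_pow_int subgroup.m_closed subgroup_int_pow_closed)
  finally show False using x by simp
qed

lemma decomp_unique:
  assumes "m \<in> M0" "m' \<in> M0" "e < p" "e' < p" "m \<otimes> x [^] e = m' \<otimes> x [^] e'"
  shows "m = m' \<and> e = e'"
proof -
  have *: "e1 = e2" if "m1 \<in> M0" "m2 \<in> M0" "e1 \<le> e2" "e2 < p" "m1 \<otimes> x [^] e1 = m2 \<otimes> x [^] e2"
    for m1 m2 and e1 e2 :: nat
  proof (rule ccontr)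
    assume "e1 \<noteq> e2"
    then have d: "0 < e2 - e1" "e2 - e1 < p" using that by auto
    have c: "m1 \<in> carrier G" "m2 \<in> carrier G" "x \<in> carrier G" using that in_carrier by auto
    have "x [^] e2 = x [^] (e2 - e1) \<otimes> x [^] e1" using c that by (simp add: nat_pow_mult)
    then have "m1 \<otimes> x [^] e1 = m2 \<otimes> x [^] (e2 - e1) \<otimes> x [^] e1" using that c by (simp add: m_assoc)
    then have "m1 = m2 \<otimes> x [^] (e2 - e1)" using c by simp
    then have "x [^] (e2 - e1) = inv m2 \<otimes> m1" using c by (simp add: inv_l_cancel)
    also have "\<dots> \<in> M0" using that M0 by (simp add: subgroup.m_closed subgroup.m_inv_closed)
    finally show False using pow_not_mem[OF d] by simp
  qed
  have "e = e'"
  proof (cases "e \<le> e'")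
    case True then show ?thesis using *[OF assms(1,2)] assms by blast
  next
    case False then show ?thesis using *[OF assms(2,1), of e' e] assms by fastforce
  qed
  then show ?thesis using assms in_carrier by simp
qed

lemma card_eq: "card M = p * card M0"
proof -
  have "bij_betw (\<lambda>(m, e). m \<otimes> x [^] e) (M0 \<times> {..<p}) M"
    unfolding bij_betw_def
  proof
    show "inj_on (\<lambda>(m, e). m \<otimes> x [^] e) (M0 \<times> {..<p})"
      by (rule inj_onI) (use decomp_unique in auto)
    have "m \<otimes> x [^] (e::nat) \<in> M" if "m \<in> M0" for m e
      using that M x M0_M by (metis int_pow_int subgroup.m_closed subgroup_int_pow_closed subsetD)
    then show "(\<lambda>(m, e). m \<otimes> x [^] e) ` (M0 \<times> {..<p}) = M" using decomp by fastforce
  qed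
  from bij_betw_same_card[OF this] show ?thesis by (simp add: card_cartesian_product mult.commute)
qed

end

context group begin

lemma gcomm_conj:
  "x \<in> carrier G \<Longrightarrow> y \<in> carrier G \<Longrightarrow> x \<otimes> y \<otimes> inv x = gcomm G x y \<otimes> y"
  by (simp add: gcomm_def group_nf)

lemma gcomm_inv: "x \<in> carrier G \<Longrightarrow> y \<in> carrier G \<Longrightarrow> inv (gcomm G x y) = gcomm G y x"
  by (simp add: gcomm_def group_nf)

text \<open>\<open>M0\<close> is a largest proper subgroup of \<open>M\<close> above
  \<open>N\<close>. Since \<open>N\<close> contains all commutators of \<open>M\<close>, every
  subgroup in between is normal, so \<open>M0\<close> and one further element \<open>x\<close>
  generate all of \<open>M\<close>; as \<open>x^p\<close> lies in \<open>N\<close>, exponents can be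
  reduced modulo \<open>p\<close>.\<close>

lemma subgroup_step_exists:
  assumes p: "Factorial_Ring.prime p" and M: "subgroup M G" "finite M" and N: "subgroup N G" "N \<subseteq> M" "N \<noteq> M"
    and comm: "\<And>a b. a \<in> M \<Longrightarrow> b \<in> M \<Longrightarrow> gcomm G a b \<in> N" and pow: "\<And>a. a \<in> M \<Longrightarrow> a [^] p \<in> N"
  shows "\<exists>M0 x. subgroup_step G p M M0 x \<and> N \<subseteq> M0"
proof -
  define F where "F L \<longleftrightarrow> subgroup L G \<and> N \<subseteq> L \<and> L \<subseteq> M \<and> L \<noteq> M" for L
  have "F N" using N by (simp add: F_def)
  moreover have "\<forall>L. F L \<longrightarrow> card L < Suc (card M)"
    using card_mono[OF M(2)] by (simp add: F_def le_imp_less_Suc)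
  ultimately have "\<exists>L. F L \<and> (\<forall>L'. F L' \<longrightarrow> card L' \<le> card L)"
    by (rule ex_has_greatest_nat)
  then obtain M0 where M0: "F M0" and max: "\<And>L. F L \<Longrightarrow> card L \<le> card M0" by blast
  have M0': "subgroup M0 G" "N \<subseteq> M0" "M0 \<subseteq> M" "M0 \<noteq> M" using M0 by (auto simp: F_def)
  obtain x where x: "x \<in> M" "x \<notin> M0" using M0' by blast
  have Mc: "a \<in> carrier G" if "a \<in> M" for a using subgroup.mem_carrier[OF M(1) that] .
  have xG: "x \<in> carrier G" using x Mc by blast
  have M0c: "a \<in> carrier G" if "a \<in> M0" for a using subgroup.mem_carrier[OF M0'(1) that] .
  have conj: "u \<otimes> m \<otimes> inv u \<in> M0" if "u \<in> M" "m \<in> M0" for u m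
  proof -
    have "m \<in> M" using that M0'(3) by blast
    then have "gcomm G u m \<otimes> m \<in> M0"
      using comm[OF that(1)] M0'(2) that(2) by (intro subgroup.m_closed[OF M0'(1)]) auto
    then show ?thesis using gcomm_conj Mc that(1) \<open>m \<in> M\<close> by simp
  qed
  have xpow: "x [^] (e::int) \<in> M" for e using subgroup_int_pow_closed[OF M(1) x(1)] .
  \<comment> \<open>The subgroup generated by \<open>M0\<close> and \<open>x\<close>; maximality of
    \<open>M0\<close> forces \<open>L = M\<close>.\<close>
  define L where "L = {m \<otimes> x [^] (e::int) | m e. m \<in> M0}"
  have LI: "m \<otimes> x [^] (e::int) \<in> L" if "m \<in> M0" for m e using that by (auto simp: L_def)
  have "subgroup L G"
  proof (rule subgroupI)
    show "L \<subseteq> carrier G" using M0c xG by (auto simp: L_def)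
    show "L \<noteq> {}" using LI subgroup.one_closed[OF M0'(1)] by blast
    fix a assume "a \<in> L"
    then obtain m e where a: "a = m \<otimes> x [^] (e::int)" "m \<in> M0" by (auto simp: L_def)
    have "inv a = (x [^] (-e) \<otimes> inv m \<otimes> inv (x [^] (-e))) \<otimes> x [^] (-e)"
      using a M0c xG by (simp add: int_pow_neg group_nf)
    also have "\<dots> \<in> L" using a(2) by (intro LI conj xpow subgroup.m_inv_closed[OF M0'(1)])
    finally show "inv a \<in> L" .
    fix b assume "b \<in> L"
    then obtain m' e' where b: "b = m' \<otimes> x [^] (e'::int)" "m' \<in> M0" by (auto simp: L_def)
    have "a \<otimes> b = (m \<otimes> (x [^] e \<otimes> m' \<otimes> inv (x [^] e))) \<otimes> x [^] (e + e')"
      using a b M0c xG by (simp add: int_pow_mult group_nf)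
    also have "\<dots> \<in> L" using a(2) b(2) by (intro LI subgroup.m_closed[OF M0'(1)] conj xpow)
    finally show "a \<otimes> b \<in> L" .
  qed
  moreover have "M0 \<subseteq> L"
  proof
    fix m assume "m \<in> M0"
    then show "m \<in> L" using LI[of m 0] M0c by simp
  qed
  moreover have "x \<in> L" using LI[OF subgroup.one_closed[OF M0'(1)], of 1] xG by simp
  moreover have "L \<subseteq> M" using xpow M0'(3) subgroup.m_closed[OF M(1)] by (auto simp: L_def)
  moreover have "L = M"
  proof (rule ccontr)
    assume "L \<noteq> M"
    then have "F L" using calculation M0' by (auto simp: F_def)
    then have "card L \<le> card M0" by (rule max)
    moreover have "M0 \<subset> L" using \<open>M0 \<subseteq> L\<close> \<open>x \<in> L\<close> x by blast
    moreover have "finite L" using \<open>L \<subseteq> M\<close> M(2) by (rule finite_subset)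
    ultimately show False using psubset_card_mono[of L M0] by simp
  qed
  ultimately have M_eq: "M = L" by simp
  have xp: "x [^] p \<in> M0" using pow[OF x(1)] M0' by blast
  have "subgroup_step G p M M0 x"
  proof (intro subgroup_step.intro subgroup_step_axioms.intro)
    fix g assume "g \<in> M"
    then obtain m e where g: "g = m \<otimes> x [^] (e::int)" "m \<in> M0" by (auto simp: M_eq L_def)
    define q r where "q = e div int p" and "r = nat (e mod int p)"
    have p0: "p > 0" using prime_gt_0_nat[OF p] .
    have e: "e = int p * q + int r" using p0 by (simp add: q_def r_def)
    have "x [^] e = (x [^] p) [^] q \<otimes> x [^] r"
      unfolding e using xG by (simp add: int_pow_mult int_pow_pow[symmetric] int_pow_int)
    then have "g = (m \<otimes> (x [^] p) [^] q) \<otimes> x [^] r" using g M0c xG by (simp add: m_assoc)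
    moreover have "m \<otimes> (x [^] p) [^] q \<in> M0"
      using g(2) xp by (intro subgroup.m_closed[OF M0'(1)] subgroup_int_pow_closed[OF M0'(1)])
    moreover have "r < p" using p0 by (simp add: r_def nat_less_iff)
    ultimately show "\<exists>m\<in>M0. \<exists>e<p. g = m \<otimes> x [^] e" by blast
  qed (use p M(1) M0' x xp conj in \<open>simp_all add: group_axioms\<close>)
  then show ?thesis using M0'(2) by (intro exI conjI)
qed

end

subsection \<open>The Frobenius identity\<close>

context ring begin

lemma add_one_pow:
  fixes n :: nat
  assumes y: "y \<in> carrier R"
  defines "f \<equiv> (\<lambda>(n::nat) k. add_pow R (n choose k) (y [^] k))"
  shows "(y \<oplus> \<one>) [^] n = (\<Oplus>k\<in>{..n}. f n k)"
proof (induction n)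
  case 0
  have "f 0 0 = \<one>" by (simp add: f_def add.nat_pow_eone)
  then show ?case by simp
next
  case (Suc n)
  have c: "f n k \<in> carrier R" for n k using y by (simp add: f_def)
  have rec: "f (Suc n) (Suc k) = f n k \<otimes> y \<oplus> f n (Suc k)" for k
    using y by (simp add: f_def add_pow_ldistr add.nat_pow_mult)
  have f0: "f n 0 = \<one>" for n by (simp add: f_def add.nat_pow_eone)
  have fn: "f n (Suc n) = \<zero>" by (simp add: f_def binomial_eq_0 del: nat_pow_Suc)
  let ?A = "\<Oplus>k\<in>{..n}. f n k \<otimes> y" and ?B = "\<Oplus>k\<in>{..n}. f n (Suc k)" and ?C = "\<Oplus>k\<in>{..n}. f n k"
  have cl: "?A \<in> carrier R" "?B \<in> carrier R" "?C \<in> carrier R"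
    using c y by (simp_all add: Pi_def)
  have BC: "?B \<oplus> \<one> = ?C"
  proof -
    have "?B \<oplus> f n 0 = (\<Oplus>k\<in>{..Suc n}. f n k)" by (rule finsum_Suc2[symmetric]) (use c in auto)
    also have "\<dots> = f n (Suc n) \<oplus> ?C" by (rule finsum_Suc) (use c in auto)
    finally show ?thesis using f0 fn cl by simp
  qed
  have "(\<Oplus>k\<in>{..Suc n}. f (Suc n) k) = (\<Oplus>k\<in>{..n}. f (Suc n) (Suc k)) \<oplus> f (Suc n) 0"
    by (rule finsum_Suc2) (use c in auto)
  also have "(\<Oplus>k\<in>{..n}. f (Suc n) (Suc k)) = (\<Oplus>k\<in>{..n}. f n k \<otimes> y \<oplus> f n (Suc k))"
    by (simp only: rec)
  also have "\<dots> = ?A \<oplus> ?B"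
    by (rule finsum_addf) (use y c in auto)
  also have "?A = ?C \<otimes> y"
    by (rule finsum_ldistr[symmetric]) (use y c in auto)
  finally have "(\<Oplus>k\<in>{..Suc n}. f (Suc n) k) = ?C \<otimes> y \<oplus> (?B \<oplus> \<one>)"
    using cl y f0 by (simp only: a_assoc m_closed one_closed)
  then have "(\<Oplus>k\<in>{..Suc n}. f (Suc n) k) = ?C \<otimes> (y \<oplus> \<one>)"
    unfolding BC using cl y by (simp only: r_distr r_one one_closed)
  then show ?case using Suc by simp
qed

lemma add_one_pow_prime:
  fixes p :: nat
  assumes y: "y \<in> carrier R" and p: "Factorial_Ring.prime p" and char: "\<And>a. a \<in> carrier R \<Longrightarrow> add_pow R p a = \<zero>"
  shows "(y \<oplus> \<one>) [^] p = y [^] p \<oplus> \<one>"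
proof -
  define r q where "r = p - 2" and "q = p - 1"
  have q: "p = Suc q" and r: "q = Suc r" using prime_ge_2_nat[OF p] by (auto simp: r_def q_def)
  have "add_pow R (p choose Suc k) (y [^] Suc k) = \<zero>" if "k \<le> r" for k
  proof -
    have "p dvd (p choose Suc k)" by (rule dvd_choose_prime) (use that p q r in simp_all)
    then obtain m where "p choose Suc k = p * m" by (rule dvdE)
    then have "add_pow R (p choose Suc k) (y [^] Suc k) = add_pow R m (add_pow R p (y [^] Suc k))"
      using y by (simp add: add.nat_pow_pow del: nat_pow_Suc)
    then show ?thesis using y char by (simp del: nat_pow_Suc)
  qed
  then have *: "(\<Oplus>k\<in>{..r}. add_pow R (p choose Suc k) (y [^] Suc k)) = \<zero>"
    by (intro add.finprod_one_eqI) auto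
  define f where "f k = add_pow R (p choose k) (y [^] k)" for k
  have c: "f k \<in> carrier R" for k using y by (simp add: f_def)
  have fp: "f p = y [^] p" "f 0 = \<one>" using y by (simp_all add: f_def add.nat_pow_eone)
  have "(y \<oplus> \<one>) [^] p = (\<Oplus>k\<in>{..Suc q}. f k)"
    using add_one_pow[OF y, of p] q by (simp only: f_def)
  also have "\<dots> = (\<Oplus>k\<in>{..q}. f (Suc k)) \<oplus> f 0" by (rule finsum_Suc2) (use c in auto)
  also have "(\<Oplus>k\<in>{..q}. f (Suc k)) = f (Suc q) \<oplus> (\<Oplus>k\<in>{..r}. f (Suc k))"
    unfolding r by (rule finsum_Suc) (use c in auto)
  also have "(\<Oplus>k\<in>{..r}. f (Suc k)) = \<zero>" using * by (simp only: f_def)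
  finally show ?thesis using c[of p] fp by (simp add: q[symmetric])
qed

end


subsection \<open>Filtrations of the commutator subgroup\<close>

locale modular_group_algebra = group_algebra_over K G
  for K :: "('k, 'm) ring_scheme" and G :: "('g, 'n) monoid_scheme" +
  fixes p :: nat
  assumes prime_p: "Factorial_Ring.prime p"
    and char_p: "add_pow K p \<one>\<^bsub>K\<^esub> = \<zero>\<^bsub>K\<^esub>"
    and one_not_zero: "\<one>\<^bsub>K\<^esub> \<noteq> \<zero>\<^bsub>K\<^esub>"
begin

lemma p_gt_0: "p > 0" using prime_gt_0_nat[OF prime_p] .

lemma add_pow_apply: "f \<in> carrier KG \<Longrightarrow> (add_pow KG (n::nat) f) g = add_pow K n (f g)"
proof (induction n)
  case 0
  then show ?case by (simp add: zero_apply)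
next
  case (Suc n)
  then show ?case by (simp add: R.add.nat_pow_Suc K.add.nat_pow_Suc add_apply)
qed

lemma char_KG: "f \<in> carrier KG \<Longrightarrow> add_pow KG p f = \<zero>\<^bsub>KG\<^esub>"
proof
  fix g assume f: "f \<in> carrier KG"
  have "f g \<in> carrier K" by (rule carrierD(1)[OF f])
  then have "add_pow K p (f g) = add_pow K p \<one>\<^bsub>K\<^esub> \<otimes>\<^bsub>K\<^esub> f g"
    by (simp add: K.add_pow_ldistr)
  then show "(add_pow KG p f) g = \<zero>\<^bsub>KG\<^esub> g"
    using \<open>f g \<in> carrier K\<close> f by (simp add: add_pow_apply char_p zero_apply)
qed

lemma Delta_closed [simp, intro]: "g \<in> carrier G \<Longrightarrow> \<Delta> g \<in> carrier KG"
  by simp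

lemma Delta_add_one: "g \<in> carrier G \<Longrightarrow> \<Delta> g \<oplus>\<^bsub>KG\<^esub> \<one>\<^bsub>KG\<^esub> = \<delta> g"
  by (simp add: a_minus_def R.a_assoc R.l_neg)

lemma Delta_pow_p: "g \<in> carrier G \<Longrightarrow> \<Delta> g [^]\<^bsub>KG\<^esub> p = \<Delta> (g [^]\<^bsub>G\<^esub> p)"
proof -
  assume g: "g \<in> carrier G"
  have "\<delta> (g [^]\<^bsub>G\<^esub> p) = (\<Delta> g \<oplus>\<^bsub>KG\<^esub> \<one>\<^bsub>KG\<^esub>) [^]\<^bsub>KG\<^esub> p"
    using g by (simp only: Delta_add_one delta_pow)
  also have "\<dots> = \<Delta> g [^]\<^bsub>KG\<^esub> p \<oplus>\<^bsub>KG\<^esub> \<one>\<^bsub>KG\<^esub>"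
    by (rule R.add_one_pow_prime[OF Delta_closed[OF g] prime_p char_KG])
  finally show ?thesis using g by (simp add: a_minus_def R.a_assoc R.r_neg)
qed

lemma Delta_apply:
  assumes "x \<in> carrier G" "f \<in> carrier KG" "g \<in> carrier G"
  shows "(\<Delta> x \<otimes>\<^bsub>KG\<^esub> f) g = f (inv\<^bsub>G\<^esub> x \<otimes>\<^bsub>G\<^esub> g) \<ominus>\<^bsub>K\<^esub> f g"
proof -
  have "\<Delta> x \<otimes>\<^bsub>KG\<^esub> f = \<delta> x \<otimes>\<^bsub>KG\<^esub> f \<ominus>\<^bsub>KG\<^esub> f"
    using assms by (simp add: a_minus_def R.l_distr R.l_minus)
  then show ?thesis using assms carrierD(1)[OF assms(2)] by (simp add: minus_apply mon_mult_apply)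
qed

lemma scalar_central:
  assumes "c \<in> carrier K" "f \<in> carrier KG"
  shows "f \<otimes>\<^bsub>KG\<^esub> mon c \<one>\<^bsub>G\<^esub> = mon c \<one>\<^bsub>G\<^esub> \<otimes>\<^bsub>KG\<^esub> f"
proof
  fix g
  show "(f \<otimes>\<^bsub>KG\<^esub> mon c \<one>\<^bsub>G\<^esub>) g = (mon c \<one>\<^bsub>G\<^esub> \<otimes>\<^bsub>KG\<^esub> f) g"
    using assms carrierD(1)[OF assms(2)]
    by (cases "g \<in> carrier G") (simp_all add: mult_outside mult_mon_apply mon_mult_apply K.m_comm)
qed

lemma mon_eq: "c \<in> carrier K \<Longrightarrow> g \<in> carrier G \<Longrightarrow> mon c g = mon c \<one>\<^bsub>G\<^esub> \<otimes>\<^bsub>KG\<^esub> \<delta> g"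
  by (simp add: mon_mult)

lemma Delta_mult': "g \<in> carrier G \<Longrightarrow> h \<in> carrier G \<Longrightarrow>
    \<Delta> (g \<otimes>\<^bsub>G\<^esub> h) = \<Delta> g \<otimes>\<^bsub>KG\<^esub> \<Delta> h \<oplus>\<^bsub>KG\<^esub> \<Delta> g \<oplus>\<^bsub>KG\<^esub> \<Delta> h"
proof -
  assume g: "g \<in> carrier G" and h: "h \<in> carrier G"
  have "\<Delta> (g \<otimes>\<^bsub>G\<^esub> h) = \<Delta> g \<otimes>\<^bsub>KG\<^esub> (\<Delta> h \<oplus>\<^bsub>KG\<^esub> \<one>\<^bsub>KG\<^esub>) \<oplus>\<^bsub>KG\<^esub> \<Delta> h"
    using g h by (simp only: Delta_mult Delta_add_one)
  then show ?thesis using g h by (simp only: R.r_distr Delta_closed R.one_closed R.r_one)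
qed

text \<open>The rewriting rule that moves \<open>x - 1\<close> to the right of \<open>g - 1\<close>:
  it expresses \<open>x g = g' x\<close> with \<open>g' = x g x^-1 = (x, g) g\<close> through
  differences. Every error term contains the commutator, whose weight makes up for the lost factor
  \<open>x - 1\<close>.\<close>

lemma gcomm_swap:
  assumes "x \<in> carrier G" "g \<in> carrier G"
  shows "\<Delta> x \<otimes>\<^bsub>KG\<^esub> \<Delta> g = \<Delta> (x \<otimes>\<^bsub>G\<^esub> g \<otimes>\<^bsub>G\<^esub> inv\<^bsub>G\<^esub> x) \<otimes>\<^bsub>KG\<^esub> \<Delta> x
    \<oplus>\<^bsub>KG\<^esub> (\<Delta> (gcomm G x g) \<otimes>\<^bsub>KG\<^esub> \<Delta> g \<oplus>\<^bsub>KG\<^esub> \<Delta> (gcomm G x g))"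
proof -
  define c g' where "c = gcomm G x g" and "g' = x \<otimes>\<^bsub>G\<^esub> g \<otimes>\<^bsub>G\<^esub> inv\<^bsub>G\<^esub> x"
  have cl: "c \<in> carrier G" "g' \<in> carrier G" using assms by (auto simp: c_def g'_def)
  have 1: "g' = c \<otimes>\<^bsub>G\<^esub> g" using assms by (simp add: c_def g'_def G.gcomm_conj)
  have 2: "g' \<otimes>\<^bsub>G\<^esub> x = x \<otimes>\<^bsub>G\<^esub> g" using assms by (simp add: g'_def G.m_assoc)
  let ?a = "\<Delta> x \<otimes>\<^bsub>KG\<^esub> \<Delta> g" and ?b = "\<Delta> g' \<otimes>\<^bsub>KG\<^esub> \<Delta> x" and ?d = "\<Delta> c \<otimes>\<^bsub>KG\<^esub> \<Delta> g"
  have e1: "?a \<oplus>\<^bsub>KG\<^esub> \<Delta> x \<oplus>\<^bsub>KG\<^esub> \<Delta> g = ?b \<oplus>\<^bsub>KG\<^esub> \<Delta> g' \<oplus>\<^bsub>KG\<^esub> \<Delta> x"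
    using Delta_mult'[OF assms] Delta_mult'[OF cl(2) assms(1)] 2 by simp
  have dg: "\<Delta> g' = ?d \<oplus>\<^bsub>KG\<^esub> \<Delta> c \<oplus>\<^bsub>KG\<^esub> \<Delta> g" unfolding 1 by (rule Delta_mult'[OF cl(1) assms(2)])
  have eq: "?a \<oplus>\<^bsub>KG\<^esub> \<Delta> x \<oplus>\<^bsub>KG\<^esub> \<Delta> g = ?b \<oplus>\<^bsub>KG\<^esub> (?d \<oplus>\<^bsub>KG\<^esub> \<Delta> c \<oplus>\<^bsub>KG\<^esub> \<Delta> g) \<oplus>\<^bsub>KG\<^esub> \<Delta> x"
    unfolding dg[symmetric] by (rule e1)
  have C: "?a \<in> carrier KG" "?b \<in> carrier KG" "?d \<in> carrier KG" "\<Delta> x \<in> carrier KG" "\<Delta> g \<in> carrier KG" "\<Delta> c \<in> carrier KG"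
    using assms cl by simp_all
  have *: "a = b \<oplus>\<^bsub>KG\<^esub> (d \<oplus>\<^bsub>KG\<^esub> e)"
    if "a \<oplus>\<^bsub>KG\<^esub> y \<oplus>\<^bsub>KG\<^esub> h = b \<oplus>\<^bsub>KG\<^esub> (d \<oplus>\<^bsub>KG\<^esub> e \<oplus>\<^bsub>KG\<^esub> h) \<oplus>\<^bsub>KG\<^esub> y"
      "a \<in> carrier KG" "b \<in> carrier KG" "d \<in> carrier KG" "e \<in> carrier KG" "h \<in> carrier KG" "y \<in> carrier KG"
    for a b d e h y
  proof -
    note cl = that(2-7)
    have "a \<oplus>\<^bsub>KG\<^esub> (y \<oplus>\<^bsub>KG\<^esub> h) = a \<oplus>\<^bsub>KG\<^esub> y \<oplus>\<^bsub>KG\<^esub> h"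
      using cl by (simp add: R.a_assoc)
    also note that(1)
    also have "b \<oplus>\<^bsub>KG\<^esub> (d \<oplus>\<^bsub>KG\<^esub> e \<oplus>\<^bsub>KG\<^esub> h) \<oplus>\<^bsub>KG\<^esub> y =
        b \<oplus>\<^bsub>KG\<^esub> (d \<oplus>\<^bsub>KG\<^esub> e) \<oplus>\<^bsub>KG\<^esub> (y \<oplus>\<^bsub>KG\<^esub> h)"
      using cl by (simp add: R.a_ac)
    finally show ?thesis using cl by (simp add: R.add.r_cancel)
  qed
  show ?thesis using *[OF eq C(1,2,3) C(6,5,4)] by (simp only: c_def g'_def)
qed

end

text \<open>A restricted \<open>N\<close>-series on \<open>G'\<close> in which commutators with
  arbitrary elements of \<open>G\<close> also go one step deeper. The index is the weight of
  \<open>x - 1\<close>; it starts with 1 at \<open>G'\<close> because brackets of ring elements lie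
  in the second upper Lie power. The value at 0 repeats \<open>G'\<close>.\<close>

locale central_series = modular_group_algebra K G p
  for K :: "('k, 'm) ring_scheme" and G :: "('g, 'n) monoid_scheme" and p +
  fixes H :: "nat \<Rightarrow> 'g set"
  assumes H_subgroup: "\<And>i. subgroup (H i) G"
    and H_0: "H 0 = derived G (carrier G)" and H_1: "H 1 = derived G (carrier G)"
    and H_Suc: "\<And>i. H (Suc i) \<subseteq> H i"
    and H_central: "\<And>i x g. x \<in> H i \<Longrightarrow> g \<in> carrier G \<Longrightarrow> gcomm G x g \<in> H (Suc i)"
    and H_comm: "\<And>i j x y. x \<in> H i \<Longrightarrow> y \<in> H j \<Longrightarrow> gcomm G x y \<in> H (i + j)"
    and H_pow: "\<And>i x. x \<in> H i \<Longrightarrow> x [^]\<^bsub>G\<^esub> p \<in> H (p * i)"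
    and H_end: "\<exists>c. H c = {\<one>\<^bsub>G\<^esub>}"
    and finite_derived: "finite (derived G (carrier G))"
begin

abbreviation D where "D \<equiv> derived G (carrier G)"

lemma H_carrier: "x \<in> H i \<Longrightarrow> x \<in> carrier G"
  using subgroup.mem_carrier[OF H_subgroup] .

lemma H_antimono: "i \<le> j \<Longrightarrow> H j \<subseteq> H i"
  by (induction rule: dec_induct) (use H_Suc in auto)

lemma H_mono: "x \<in> H j \<Longrightarrow> i \<le> j \<Longrightarrow> x \<in> H i"
  using H_antimono by (rule subsetD)

lemma H_D: "H i \<subseteq> D"
  using H_antimono[of 0 i] H_0 by simp

lemma H_finite: "finite (H i)"
  using H_D finite_derived by (rule finite_subset)

lemma H_gcomm': "x \<in> H i \<Longrightarrow> g \<in> carrier G \<Longrightarrow> gcomm G g x \<in> H (Suc i)"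
  using subgroup.m_inv_closed[OF H_subgroup H_central, of x i g] H_carrier[of x i]
  by (simp add: G.gcomm_inv)

lemma H_conj:
  assumes x: "x \<in> H i" and g: "g \<in> carrier G" shows "g \<otimes>\<^bsub>G\<^esub> x \<otimes>\<^bsub>G\<^esub> inv\<^bsub>G\<^esub> g \<in> H i"
proof -
  have "gcomm G g x \<otimes>\<^bsub>G\<^esub> x \<in> H i"
    using H_gcomm'[OF x g] H_Suc x by (intro subgroup.m_closed[OF H_subgroup]) auto
  then show ?thesis using H_carrier[OF x] g by (simp add: G.gcomm_conj)
qed

lemma gcomm_D: "x \<in> carrier G \<Longrightarrow> y \<in> carrier G \<Longrightarrow> gcomm G x y \<in> H 1"
  unfolding H_1 derived_def by (rule generate.incl) (auto simp: gcomm_def)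

text \<open>Sums of products \<open>r (g_1 - 1) ... (g_k - 1)\<close> with all \<open>g_j\<close> in
  \<open>M\<close>, where the depths of the \<open>g_j\<close> add up to at least \<open>w\<close>.
  Coefficients stand on the left only, which suits the later splitting off of factors on the
  right.\<close>

inductive_set S :: "'g set \<Rightarrow> (nat \<times> ('g \<Rightarrow> 'k)) set" for M where
  base: "r \<in> carrier KG \<Longrightarrow> (0, r) \<in> S M"
| zero: "(w, \<zero>\<^bsub>KG\<^esub>) \<in> S M"
| add: "(w, a) \<in> S M \<Longrightarrow> (w, b) \<in> S M \<Longrightarrow> (w, a \<oplus>\<^bsub>KG\<^esub> b) \<in> S M"
| mult: "(w, a) \<in> S M \<Longrightarrow> g \<in> M \<Longrightarrow> g \<in> H v \<Longrightarrow> (w + v, a \<otimes>\<^bsub>KG\<^esub> \<Delta> g) \<in> S M"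
| mono: "(w, a) \<in> S M \<Longrightarrow> u \<le> w \<Longrightarrow> (u, a) \<in> S M"

lemma S_carrier: "(w, a) \<in> S M \<Longrightarrow> a \<in> carrier KG"
  by (induction rule: S.induct) (auto dest: H_carrier)

lemma S_left: "(w, a) \<in> S M \<Longrightarrow> r \<in> carrier KG \<Longrightarrow> (w, r \<otimes>\<^bsub>KG\<^esub> a) \<in> S M"
proof (induction rule: S.induct)
  case (base s)
  then show ?case by (intro S.base) auto
next
  case (zero w)
  then show ?case by (simp add: S.zero)
next
  case (add w a b)
  then show ?case using S.add[of w "r \<otimes>\<^bsub>KG\<^esub> a" M "r \<otimes>\<^bsub>KG\<^esub> b"] S_carrier by (simp add: R.r_distr)
next
  case (mult w a g v)
  have "(w + v, r \<otimes>\<^bsub>KG\<^esub> a \<otimes>\<^bsub>KG\<^esub> \<Delta> g) \<in> S M" using mult by (intro S.mult) auto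
  then show ?case using mult S_carrier[OF mult.hyps(1)] H_carrier[OF mult.hyps(3)] by (simp add: R.m_assoc)
next
  case (mono w a u)
  then show ?case using S.mono by simp
qed

text \<open>Passing a group element to the left conjugates the factors \<open>g\<close>, and the
  terms \<open>H v\<close> are normal.\<close>

lemma S_delta: "(w, a) \<in> S D \<Longrightarrow> h \<in> carrier G \<Longrightarrow> (w, a \<otimes>\<^bsub>KG\<^esub> \<delta> h) \<in> S D"
proof (induction rule: S.induct)
  case (base s)
  then show ?case by (intro S.base) auto
next
  case (zero w)
  then show ?case by (simp add: S.zero)
next
  case (add w a b)
  then show ?case using S.add[of w "a \<otimes>\<^bsub>KG\<^esub> \<delta> h" D "b \<otimes>\<^bsub>KG\<^esub> \<delta> h"] S_carrier by (simp add: R.l_distr)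
next
  case (mult w a g v)
  define g' where "g' = inv\<^bsub>G\<^esub> h \<otimes>\<^bsub>G\<^esub> g \<otimes>\<^bsub>G\<^esub> inv\<^bsub>G\<^esub> (inv\<^bsub>G\<^esub> h)"
  have gG: "g \<in> carrier G" using mult H_carrier by blast
  have g': "g' \<in> H v" unfolding g'_def using mult by (intro H_conj) auto
  have "h \<otimes>\<^bsub>G\<^esub> g' = g \<otimes>\<^bsub>G\<^esub> h" using gG mult by (simp add: g'_def G.group_nf)
  then have "\<Delta> g \<otimes>\<^bsub>KG\<^esub> \<delta> h = \<delta> h \<otimes>\<^bsub>KG\<^esub> \<Delta> g'"
    using gG mult H_carrier[OF g'] by (simp add: a_minus_def R.l_distr R.r_distr R.l_minus R.r_minus delta_mult)
  then have "a \<otimes>\<^bsub>KG\<^esub> \<Delta> g \<otimes>\<^bsub>KG\<^esub> \<delta> h = a \<otimes>\<^bsub>KG\<^esub> \<delta> h \<otimes>\<^bsub>KG\<^esub> \<Delta> g'"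
    using gG mult H_carrier[OF g'] S_carrier[OF mult.hyps(1)] by (simp add: R.m_assoc)
  moreover have "(w + v, a \<otimes>\<^bsub>KG\<^esub> \<delta> h \<otimes>\<^bsub>KG\<^esub> \<Delta> g') \<in> S D"
    using mult g' H_D by (intro S.mult) auto
  ultimately show ?case by simp
next
  case (mono w a u)
  then show ?case using S.mono by simp
qed

lemma S_right: "y \<in> carrier KG \<Longrightarrow> (w, a) \<in> S D \<Longrightarrow> (w, a \<otimes>\<^bsub>KG\<^esub> y) \<in> S D"
proof (induction y rule: KG_induct)
  case zero
  then show ?case using S_carrier by (simp add: S.zero)
next
  case (add y z)
  then show ?case using S_carrier[OF add.prems] S.add[of w "a \<otimes>\<^bsub>KG\<^esub> y" D "a \<otimes>\<^bsub>KG\<^esub> z"] by (simp add: R.r_distr)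
next
  case (mon c h)
  note ac = S_carrier[OF mon.prems]
  have "a \<otimes>\<^bsub>KG\<^esub> mon c h = mon c \<one>\<^bsub>G\<^esub> \<otimes>\<^bsub>KG\<^esub> (a \<otimes>\<^bsub>KG\<^esub> \<delta> h)"
    using mon ac by (simp add: mon_eq[of c h] R.m_assoc[symmetric] scalar_central)
  then show ?case using S_left[OF S_delta[OF mon.prems mon(2)], of "mon c \<one>\<^bsub>G\<^esub>"] mon by simp
qed

text \<open>Here the commutator goes to the right, \<open>g h = h g (g^-1, h^-1)\<close>, because
  \<open>S\<close> appends its factors on the right; this is where the inverses come from.\<close>

lemma S_lie_bracket_delta:
  assumes g: "g \<in> H v" "g \<in> carrier G" and h: "h \<in> carrier G" and a: "(w, a) \<in> S D"
    and c: "gcomm G (inv\<^bsub>G\<^esub> g) (inv\<^bsub>G\<^esub> h) \<in> H (Suc v)"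
  shows "(w + Suc v, a \<otimes>\<^bsub>KG\<^esub> lie_bracket KG (\<delta> g) (\<delta> h)) \<in> S D"
proof -
  let ?c = "gcomm G (inv\<^bsub>G\<^esub> g) (inv\<^bsub>G\<^esub> h)"
  have "h \<otimes>\<^bsub>G\<^esub> g \<otimes>\<^bsub>G\<^esub> ?c = g \<otimes>\<^bsub>G\<^esub> h" using g h by (simp add: gcomm_def G.group_nf)
  then have "lie_bracket KG (\<delta> g) (\<delta> h) = \<delta> (h \<otimes>\<^bsub>G\<^esub> g) \<otimes>\<^bsub>KG\<^esub> \<Delta> ?c"
    using g h by (simp add: lie_bracket_def a_minus_def R.r_distr R.r_minus delta_mult)
  moreover have "(w + Suc v, a \<otimes>\<^bsub>KG\<^esub> \<delta> (h \<otimes>\<^bsub>G\<^esub> g) \<otimes>\<^bsub>KG\<^esub> \<Delta> ?c) \<in> S D"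
    using c H_D g h by (intro S.mult S_delta[OF a]) auto
  ultimately show ?thesis using g h S_carrier[OF a] by (simp add: R.m_assoc)
qed

lemma Delta_lie_bracket:
  assumes "g \<in> carrier G" "y \<in> carrier KG"
  shows "lie_bracket KG (\<Delta> g) y = lie_bracket KG (\<delta> g) y"
proof -
  have "lie_bracket KG (\<Delta> g) y \<oplus>\<^bsub>KG\<^esub> lie_bracket KG \<one>\<^bsub>KG\<^esub> y = lie_bracket KG (\<delta> g) y"
    using assms by (simp add: R.lie_bracket_add_left[symmetric] Delta_add_one)
  moreover have "lie_bracket KG \<one>\<^bsub>KG\<^esub> y = \<zero>\<^bsub>KG\<^esub>"
    using assms by (simp add: lie_bracket_def a_minus_def R.r_neg)
  ultimately show ?thesis using assms by simp
qed

text \<open>The bracket acts as a derivation: on the coefficient it creates a commutator in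
  \<open>H 1\<close>, and on a factor \<open>g - 1\<close> it replaces \<open>g\<close> by a
  commutator one step deeper.\<close>

lemma S_bracket_delta: "(w, a) \<in> S D \<Longrightarrow> h \<in> carrier G \<Longrightarrow> (Suc w, lie_bracket KG a (\<delta> h)) \<in> S D"
proof (induction rule: S.induct)
  case (base r)
  from base(1) show ?case
  proof (induction r rule: KG_induct)
    case zero
    then show ?case using base by (simp add: S.zero R.lie_bracket_zero)
  next
    case (add a b)
    then show ?case using base S.add by (simp add: R.lie_bracket_add_left)
  next
    case (mon d g)
    have "(0 + Suc 0, mon d \<one>\<^bsub>G\<^esub> \<otimes>\<^bsub>KG\<^esub> lie_bracket KG (\<delta> g) (\<delta> h)) \<in> S D"
    proof -
      let ?c = "gcomm G (inv\<^bsub>G\<^esub> g) (inv\<^bsub>G\<^esub> h)"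
      have "h \<otimes>\<^bsub>G\<^esub> g \<otimes>\<^bsub>G\<^esub> ?c = g \<otimes>\<^bsub>G\<^esub> h" using mon base by (simp add: gcomm_def G.group_nf)
      then have "lie_bracket KG (\<delta> g) (\<delta> h) = \<delta> (h \<otimes>\<^bsub>G\<^esub> g) \<otimes>\<^bsub>KG\<^esub> \<Delta> ?c"
        using mon base by (simp add: lie_bracket_def a_minus_def R.r_distr R.r_minus delta_mult)
      moreover have "?c \<in> H 1" using mon base by (intro gcomm_D) auto
      then have "(0 + 1, mon d \<one>\<^bsub>G\<^esub> \<otimes>\<^bsub>KG\<^esub> \<delta> (h \<otimes>\<^bsub>G\<^esub> g) \<otimes>\<^bsub>KG\<^esub> \<Delta> ?c) \<in> S D"
        using mon base H_1 by (intro S.mult S.base) auto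
      ultimately show ?thesis using mon base by (simp add: R.m_assoc)
    qed
    moreover have "lie_bracket KG (mon d g) (\<delta> h) = mon d \<one>\<^bsub>G\<^esub> \<otimes>\<^bsub>KG\<^esub> lie_bracket KG (\<delta> g) (\<delta> h)"
      using lie_bracket_mon[of d "\<one>\<^bsub>K\<^esub>" g h] mon base by simp
    ultimately show ?case by simp
  qed
next
  case (zero w)
  then show ?case by (simp add: S.zero R.lie_bracket_zero)
next
  case (add w a b)
  then show ?case using S.add S_carrier by (simp add: R.lie_bracket_add_left)
next
  case (mult w a g v)
  have gG: "g \<in> carrier G" using mult H_carrier by blast
  have ac: "a \<in> carrier KG" by (rule S_carrier[OF mult.hyps(1)])
  have 1: "(Suc w + v, lie_bracket KG a (\<delta> h) \<otimes>\<^bsub>KG\<^esub> \<Delta> g) \<in> S D"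
    using mult by (intro S.mult) auto
  have 2: "(w + Suc v, a \<otimes>\<^bsub>KG\<^esub> lie_bracket KG (\<delta> g) (\<delta> h)) \<in> S D"
  proof (rule S_lie_bracket_delta[OF mult.hyps(3) gG mult.prems mult.hyps(1)])
    show "gcomm G (inv\<^bsub>G\<^esub> g) (inv\<^bsub>G\<^esub> h) \<in> H (Suc v)"
      using mult gG subgroup.m_inv_closed[OF H_subgroup] by (intro H_central) auto
  qed
  have "lie_bracket KG (a \<otimes>\<^bsub>KG\<^esub> \<Delta> g) (\<delta> h) =
      lie_bracket KG a (\<delta> h) \<otimes>\<^bsub>KG\<^esub> \<Delta> g \<oplus>\<^bsub>KG\<^esub> a \<otimes>\<^bsub>KG\<^esub> lie_bracket KG (\<delta> g) (\<delta> h)"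
    using R.lie_bracket_mult_left[of a "\<Delta> g" "\<delta> h"] Delta_lie_bracket[of g "\<delta> h"] ac gG mult.prems by simp
  then show ?case using S.add[of "Suc (w + v)"] 1 2 by simp
next
  case (mono w a u)
  then show ?case using S.mono[of "Suc w" _ D "Suc u"] by simp
qed

lemma S_bracket: "y \<in> carrier KG \<Longrightarrow> (w, a) \<in> S D \<Longrightarrow> (Suc w, lie_bracket KG a y) \<in> S D"
proof (induction y rule: KG_induct)
  case zero
  then show ?case using S_carrier by (simp add: S.zero R.lie_bracket_zero)
next
  case (add y z)
  then show ?case using S_carrier[OF add.prems] S.add by (simp add: R.lie_bracket_add_right)
next
  case (mon c h)
  note ac = S_carrier[OF mon.prems]
  have mc: "mon c \<one>\<^bsub>G\<^esub> \<in> carrier KG" using mon by simp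
  have "a \<otimes>\<^bsub>KG\<^esub> mon c h = mon c \<one>\<^bsub>G\<^esub> \<otimes>\<^bsub>KG\<^esub> (a \<otimes>\<^bsub>KG\<^esub> \<delta> h)"
    using mon ac by (simp add: mon_eq[of c h] R.m_assoc[symmetric] scalar_central)
  moreover have "mon c h \<otimes>\<^bsub>KG\<^esub> a = mon c \<one>\<^bsub>G\<^esub> \<otimes>\<^bsub>KG\<^esub> (\<delta> h \<otimes>\<^bsub>KG\<^esub> a)"
    using mon ac by (simp add: mon_eq[of c h] R.m_assoc)
  ultimately have "lie_bracket KG a (mon c h) = mon c \<one>\<^bsub>G\<^esub> \<otimes>\<^bsub>KG\<^esub> lie_bracket KG a (\<delta> h)"
    using mon ac mc by (simp add: lie_bracket_def a_minus_def R.r_distr R.r_minus)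
  then show ?case using S_left[OF S_bracket_delta[OF mon.prems mon(2)] mc] by simp
qed

lemma ULP_subset_S: "R.ULP (Suc w) \<subseteq> {a. (w, a) \<in> S D}"
proof (induction w)
  case 0
  show ?case using S.base by auto
next
  case (Suc w)
  show ?case
  proof (rule R.ULP_minimal)
    show "ideal {a. (Suc w, a) \<in> S D} KG"
      by (rule R.ideal_of_closed) (use S_carrier S.zero S.add S_left S_right in auto)
    fix a y assume "a \<in> R.ULP (Suc w)" "y \<in> carrier KG"
    then show "lie_bracket KG a y \<in> {a. (Suc w, a) \<in> S D}" using Suc S_bracket by blast
  qed simp
qed

lemma S_trivial: "(w, a) \<in> S {\<one>\<^bsub>G\<^esub>} \<Longrightarrow> w = 0 \<or> a = \<zero>\<^bsub>KG\<^esub>"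
proof (induction rule: S.induct)
  case (mult w a g v)
  then show ?case using S_carrier[OF mult.hyps(1)] by simp
qed auto

text \<open>\<open>i\<close> is the exact depth of \<open>M\<close>. The deeper elements of
  \<open>M\<close> contain its commutators and, since \<open>p i \<ge> i + 1\<close>, its
  \<open>p\<close>-th powers, so they can be kept inside \<open>M0\<close>. Thus every element of
  \<open>M\<close> outside \<open>M0\<close> has depth at most \<open>i\<close>.\<close>

lemma step_exists:
  assumes M: "subgroup M G" "M \<subseteq> D" "M \<noteq> {\<one>\<^bsub>G\<^esub>}"
  shows "\<exists>i M0 x. i \<ge> 1 \<and> M \<subseteq> H i \<and> M \<inter> H (Suc i) \<subseteq> M0 \<and> subgroup_step G p M M0 x"
proof -
  obtain c where c: "H c = {\<one>\<^bsub>G\<^esub>}" using H_end by blast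
  have one: "\<one>\<^bsub>G\<^esub> \<in> M" by (rule subgroup.one_closed[OF M(1)])
  have "\<not> M \<subseteq> H c" using M(3) one c by blast
  moreover have "M \<subseteq> H 1" using M(2) H_1 by simp
  ultimately have "\<exists>i\<ge>1. M \<subseteq> H i \<and> \<not> M \<subseteq> H (Suc i)"
  proof -
    assume c: "\<not> M \<subseteq> H c" and 1: "M \<subseteq> H 1"
    have "\<exists>i\<ge>1. M \<subseteq> H i \<and> \<not> M \<subseteq> H (Suc i)" if "\<not> M \<subseteq> H (Suc n)" for n
      using that
    proof (induction n)
      case (Suc n)
      then show ?case by (cases "M \<subseteq> H (Suc n)") (auto intro!: exI[of _ "Suc n"])
    qed (use 1 in auto)
    moreover have "\<not> M \<subseteq> H (Suc c)" using c H_Suc[of c] by blast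
    ultimately show ?thesis by blast
  qed
  then obtain i where i: "i \<ge> 1" "M \<subseteq> H i" "\<not> M \<subseteq> H (Suc i)" by blast
  have "\<exists>M0 x. subgroup_step G p M M0 x \<and> M \<inter> H (Suc i) \<subseteq> M0"
  proof (rule G.subgroup_step_exists[OF prime_p M(1)])
    show "finite M" using M(2) finite_derived by (rule finite_subset)
    show "subgroup (M \<inter> H (Suc i)) G" by (rule G.subgroups_Inter_pair[OF M(1) H_subgroup])
    show "M \<inter> H (Suc i) \<noteq> M" using i by blast
    fix a assume a: "a \<in> M"
    have aG: "a \<in> carrier G" by (rule subgroup.mem_carrier[OF M(1) a])
    have "a [^]\<^bsub>G\<^esub> int p \<in> M" by (rule G.subgroup_int_pow_closed[OF M(1) a])
    moreover have "a [^]\<^bsub>G\<^esub> p \<in> H (Suc i)"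
    proof (rule H_mono[OF H_pow])
      show "a \<in> H i" using a i by blast
      have "2 * i \<le> p * i" by (rule mult_le_mono1[OF prime_ge_2_nat[OF prime_p]])
      then show "Suc i \<le> p * i" using i(1) by linarith
    qed
    ultimately show "a [^]\<^bsub>G\<^esub> p \<in> M \<inter> H (Suc i)" by (simp add: int_pow_int)
    fix b assume b: "b \<in> M"
    have bG: "b \<in> carrier G" by (rule subgroup.mem_carrier[OF M(1) b])
    have "gcomm G a b \<in> M"
      unfolding gcomm_def using a b by (intro subgroup.m_closed[OF M(1)] subgroup.m_inv_closed[OF M(1)])
    moreover have "gcomm G a b \<in> H (Suc i)" using a i bG by (intro H_central) auto
    ultimately show "gcomm G a b \<in> M \<inter> H (Suc i)" by simp
  qed simp
  then show ?thesis using i by blast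
qed

end

section \<open>Normal forms over a subgroup of index \<open>p\<close>\<close>

locale central_series_step = central_series K G p H + subgroup_step G p M M0 x
  for K :: "('k, 'm) ring_scheme" and G :: "('g, 'n) monoid_scheme" and p H M M0 x +
  fixes i :: nat
  assumes M_H: "M \<subseteq> H i" and M_H_Suc: "M \<inter> H (Suc i) \<subseteq> M0"
begin

lemma x_G: "x \<in> carrier G" and x_H: "x \<in> H i"
  using in_carrier(2) subsetD[OF M_H x(1)] by simp_all

text \<open>Sums of terms \<open>b (x - 1)^e\<close> with \<open>e \<le> k\<close> whose weight,
  counting \<open>i\<close> for each \<open>x - 1\<close>, is at least \<open>w\<close>. The bound
  \<open>k\<close> is recorded because the rewriting is an induction on the exponent.\<close>

inductive_set T :: "nat \<Rightarrow> (nat \<times> ('g \<Rightarrow> 'k)) set" for k where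
  gen: "(u, b) \<in> S M0 \<Longrightarrow> e \<le> k \<Longrightarrow> w \<le> u + e * i \<Longrightarrow> (w, b \<otimes>\<^bsub>KG\<^esub> \<Delta> x [^]\<^bsub>KG\<^esub> e) \<in> T k"
| add: "(w, a) \<in> T k \<Longrightarrow> (w, b) \<in> T k \<Longrightarrow> (w, a \<oplus>\<^bsub>KG\<^esub> b) \<in> T k"

lemma T_carrier: "(w, a) \<in> T k \<Longrightarrow> a \<in> carrier KG"
proof (induction rule: T.induct)
  case (gen u b e w)
  then show ?case using S_carrier[OF gen(1)] x_G by simp
qed simp

lemma T_mono: "(w, a) \<in> T k \<Longrightarrow> w' \<le> w \<Longrightarrow> k \<le> k' \<Longrightarrow> (w', a) \<in> T k'"
proof (induction rule: T.induct)
  case (gen u b e w)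
  then show ?case by (intro T.gen[of u b]) auto
next
  case (add w a b)
  then show ?case by (intro T.add) auto
qed

lemma T_zero: "(w, \<zero>\<^bsub>KG\<^esub>) \<in> T k"
  using T.gen[OF S.zero[of w M0], of 0 k w] by simp

lemma T_mult_x: "(w, a) \<in> T k \<Longrightarrow> (w + i, a \<otimes>\<^bsub>KG\<^esub> \<Delta> x) \<in> T (Suc k)"
proof (induction rule: T.induct)
  case (gen u b e w)
  have "(w + i, b \<otimes>\<^bsub>KG\<^esub> \<Delta> x [^]\<^bsub>KG\<^esub> Suc e) \<in> T (Suc k)" using gen by (intro T.gen[of u b]) auto
  then show ?case using S_carrier[OF gen(1)] x_G by (simp add: R.m_assoc)
next
  case (add w a b)
  then show ?case using T.add T_carrier x_G by (simp add: R.l_distr)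
qed

text \<open>By \<open>gcomm_swap\<close> the last \<open>x - 1\<close> moves past
  \<open>g - 1\<close>, and in all three resulting terms the factor from \<open>M0\<close> faces a
  smaller power of \<open>x - 1\<close>. No weight is lost: \<open>(x, g)\<close> has depth
  \<open>i + v\<close> by \<open>H_comm\<close>.\<close>

lemma T_mult_M0:
  "(w, a) \<in> T k \<Longrightarrow> g \<in> M0 \<Longrightarrow> g \<in> H v \<Longrightarrow> (w + v, a \<otimes>\<^bsub>KG\<^esub> \<Delta> g) \<in> T k"
proof (induction k arbitrary: w a g v rule: less_induct)
  case (less k)
  note IH = less.IH
  note g = less.prems(2,3)
  have gG: "g \<in> carrier G" by (rule H_carrier[OF g(2)])
  from less.prems(1) show ?case
  proof (induction rule: T.induct)
    case (gen u b e w)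
    have bc: "b \<in> carrier KG" by (rule S_carrier[OF gen(1)])
    show ?case
    proof (cases e)
      case 0
      have "(w + v, b \<otimes>\<^bsub>KG\<^esub> \<Delta> g \<otimes>\<^bsub>KG\<^esub> \<Delta> x [^]\<^bsub>KG\<^esub> (0::nat)) \<in> T k"
        using gen 0 g by (intro T.gen[of "u + v"] S.mult) auto
      then show ?thesis using 0 bc gG by simp
    next
      case (Suc e')
      define c g' where "c = gcomm G x g" and "g' = x \<otimes>\<^bsub>G\<^esub> g \<otimes>\<^bsub>G\<^esub> inv\<^bsub>G\<^esub> x"
      have g': "g' \<in> M0" "g' \<in> H v" using g x_G by (auto simp: g'_def intro: x_conj H_conj)
      have c_H: "c \<in> H (i + v)" unfolding c_def by (rule H_comm[OF x_H g(2)])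
      have "c = g' \<otimes>\<^bsub>G\<^esub> inv\<^bsub>G\<^esub> g" by (simp add: c_def g'_def gcomm_def)
      then have c_M0: "c \<in> M0"
        using g'(1) g(1) by (simp add: subgroup.m_closed[OF M0] subgroup.m_inv_closed[OF M0])
      have cG: "c \<in> carrier G" "g' \<in> carrier G" using H_carrier c_H g' by auto
      define y where "y = b \<otimes>\<^bsub>KG\<^esub> \<Delta> x [^]\<^bsub>KG\<^esub> e'"
      have yc: "y \<in> carrier KG" using bc x_G by (simp add: y_def)
      have y: "(u + e' * i, y) \<in> T e'" unfolding y_def by (rule T.gen[OF gen(1)]) auto
      have lt: "e' < k" using gen(2) Suc by simp
      have 1: "(u + e' * i + v + i, y \<otimes>\<^bsub>KG\<^esub> \<Delta> g' \<otimes>\<^bsub>KG\<^esub> \<Delta> x) \<in> T (Suc e')"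
        by (rule T_mult_x[OF IH[OF lt y g']])
      have 2: "(u + e' * i + (i + v), y \<otimes>\<^bsub>KG\<^esub> \<Delta> c) \<in> T e'"
        by (rule IH[OF lt y c_M0 c_H])
      have 3: "(u + e' * i + (i + v) + v, y \<otimes>\<^bsub>KG\<^esub> \<Delta> c \<otimes>\<^bsub>KG\<^esub> \<Delta> g) \<in> T e'"
        by (rule IH[OF lt 2 g])
      have "(w + v, y \<otimes>\<^bsub>KG\<^esub> \<Delta> g' \<otimes>\<^bsub>KG\<^esub> \<Delta> x) \<in> T k"
        by (rule T_mono[OF 1]) (use gen(3) Suc lt in auto)
      moreover have "(w + v, y \<otimes>\<^bsub>KG\<^esub> \<Delta> c) \<in> T k"
        by (rule T_mono[OF 2]) (use gen(3) Suc lt in auto)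
      moreover have "(w + v, y \<otimes>\<^bsub>KG\<^esub> \<Delta> c \<otimes>\<^bsub>KG\<^esub> \<Delta> g) \<in> T k"
        by (rule T_mono[OF 3]) (use gen(3) Suc lt in auto)
      ultimately have "(w + v, y \<otimes>\<^bsub>KG\<^esub> \<Delta> g' \<otimes>\<^bsub>KG\<^esub> \<Delta> x \<oplus>\<^bsub>KG\<^esub>
          (y \<otimes>\<^bsub>KG\<^esub> \<Delta> c \<otimes>\<^bsub>KG\<^esub> \<Delta> g \<oplus>\<^bsub>KG\<^esub> y \<otimes>\<^bsub>KG\<^esub> \<Delta> c)) \<in> T k"
        by (intro T.add)
      moreover have "b \<otimes>\<^bsub>KG\<^esub> \<Delta> x [^]\<^bsub>KG\<^esub> e \<otimes>\<^bsub>KG\<^esub> \<Delta> g = y \<otimes>\<^bsub>KG\<^esub> (\<Delta> x \<otimes>\<^bsub>KG\<^esub> \<Delta> g)"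
        using bc x_G gG by (simp add: y_def Suc R.m_assoc)
      moreover have "\<dots> = y \<otimes>\<^bsub>KG\<^esub> \<Delta> g' \<otimes>\<^bsub>KG\<^esub> \<Delta> x \<oplus>\<^bsub>KG\<^esub>
          (y \<otimes>\<^bsub>KG\<^esub> \<Delta> c \<otimes>\<^bsub>KG\<^esub> \<Delta> g \<oplus>\<^bsub>KG\<^esub> y \<otimes>\<^bsub>KG\<^esub> \<Delta> c)"
        unfolding gcomm_swap[OF x_G gG] c_def[symmetric] g'_def[symmetric]
        using yc cG gG x_G by (simp add: R.r_distr R.m_assoc)
      ultimately show ?thesis by simp
    qed
  next
    case (add w a b)
    then show ?case using T.add T_carrier gG by (simp add: R.l_distr)
  qed
qed

text \<open>When the exponent would reach \<open>p\<close>, the Frobenius identity gives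
  \<open>(x - 1)^p = x^p - 1\<close>. This is a factor from \<open>M0\<close> of depth
  \<open>p i\<close>, exactly the weight of the \<open>p\<close> factors it replaces.\<close>

lemma T_mult_x': "(w, a) \<in> T (p - 1) \<Longrightarrow> (w + i, a \<otimes>\<^bsub>KG\<^esub> \<Delta> x) \<in> T (p - 1)"
proof (induction rule: T.induct)
  case (gen u b e w)
  have bc: "b \<in> carrier KG" by (rule S_carrier[OF gen(1)])
  show ?case
  proof (cases "e = p - 1")
    case False
    have "(w + i, b \<otimes>\<^bsub>KG\<^esub> \<Delta> x [^]\<^bsub>KG\<^esub> Suc e) \<in> T (p - 1)" using gen False by (intro T.gen[of u b]) auto
    then show ?thesis using bc x_G by (simp add: R.m_assoc)
  next
    case True
    then have p: "p = Suc e" using p_gt_0 by simp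
    have "\<Delta> x [^]\<^bsub>KG\<^esub> e \<otimes>\<^bsub>KG\<^esub> \<Delta> x = \<Delta> (x [^]\<^bsub>G\<^esub> p)"
      using Delta_pow_p[OF x_G] by (simp add: p)
    moreover have "(u + p * i, b \<otimes>\<^bsub>KG\<^esub> \<Delta> (x [^]\<^bsub>G\<^esub> p)) \<in> S M0"
      by (rule S.mult[OF gen(1) x_pow H_pow[OF x_H]])
    then have "(w + i, b \<otimes>\<^bsub>KG\<^esub> \<Delta> (x [^]\<^bsub>G\<^esub> p) \<otimes>\<^bsub>KG\<^esub> \<Delta> x [^]\<^bsub>KG\<^esub> (0::nat)) \<in> T (p - 1)"
      by (rule T.gen) (use gen(3) p in auto)
    ultimately show ?thesis using bc x_G by (simp add: R.m_assoc)
  qed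
next
  case (add w a b)
  then show ?case using T.add T_carrier x_G by (simp add: R.l_distr)
qed

lemma T_mult_M:
  assumes g: "g \<in> M" "g \<in> H v" and a: "(w, a) \<in> T (p - 1)"
  shows "(w + v, a \<otimes>\<^bsub>KG\<^esub> \<Delta> g) \<in> T (p - 1)"
proof (cases "g \<in> M0")
  case True
  then show ?thesis using T_mult_M0 a g by blast
next
  case False
  have vi: "v \<le> i"
  proof (rule ccontr)
    assume "\<not> v \<le> i"
    then have "g \<in> H (Suc i)" using H_mono[OF g(2), of "Suc i"] by simp
    then show False using M_H_Suc g(1) False by blast
  qed
  \<comment> \<open>Closed under products, by the expansion of \<open>g h - 1\<close>. It therefore
    suffices to treat the parts of \<open>g = m x^e\<close>.\<close>
  define good where "good h \<longleftrightarrow> h \<in> carrier G \<and> (\<forall>w a. (w, a) \<in> T (p - 1) \<longrightarrow> (w + v, a \<otimes>\<^bsub>KG\<^esub> \<Delta> h) \<in> T (p - 1))" for h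
  have good_mult: "good (h \<otimes>\<^bsub>G\<^esub> k)" if h: "good h" and k: "good k" for h k
    unfolding good_def
  proof (intro conjI allI impI)
    have G: "h \<in> carrier G" "k \<in> carrier G" using h k by (auto simp: good_def)
    then show "h \<otimes>\<^bsub>G\<^esub> k \<in> carrier G" by simp
    fix w a assume a: "(w, a) \<in> T (p - 1)"
    have 1: "(w + v, a \<otimes>\<^bsub>KG\<^esub> \<Delta> h) \<in> T (p - 1)" and 2: "(w + v, a \<otimes>\<^bsub>KG\<^esub> \<Delta> k) \<in> T (p - 1)"
      using h k a by (auto simp: good_def)
    have "(w + v + v, a \<otimes>\<^bsub>KG\<^esub> \<Delta> h \<otimes>\<^bsub>KG\<^esub> \<Delta> k) \<in> T (p - 1)" using k 1 by (auto simp: good_def)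
    then have "(w + v, a \<otimes>\<^bsub>KG\<^esub> \<Delta> h \<otimes>\<^bsub>KG\<^esub> \<Delta> k) \<in> T (p - 1)" by (rule T_mono) auto
    then have "(w + v, a \<otimes>\<^bsub>KG\<^esub> \<Delta> h \<otimes>\<^bsub>KG\<^esub> \<Delta> k \<oplus>\<^bsub>KG\<^esub> a \<otimes>\<^bsub>KG\<^esub> \<Delta> h \<oplus>\<^bsub>KG\<^esub> a \<otimes>\<^bsub>KG\<^esub> \<Delta> k) \<in> T (p - 1)"
      using 1 2 by (intro T.add)
    then show "(w + v, a \<otimes>\<^bsub>KG\<^esub> \<Delta> (h \<otimes>\<^bsub>G\<^esub> k)) \<in> T (p - 1)"
      using T_carrier[OF a] G by (simp add: Delta_mult'[OF G] R.r_distr R.m_assoc)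
  qed
  have good_x: "good x"
    unfolding good_def
  proof (intro conjI allI impI x_G)
    fix w a assume "(w, a) \<in> T (p - 1)"
    from T_mult_x'[OF this] show "(w + v, a \<otimes>\<^bsub>KG\<^esub> \<Delta> x) \<in> T (p - 1)" by (rule T_mono) (use vi in auto)
  qed
  have good_pow: "good (x [^]\<^bsub>G\<^esub> e)" for e :: nat
  proof (induction e)
    case 0
    show ?case unfolding good_def by (auto simp: T_zero dest: T_carrier)
  next
    case (Suc e)
    then show ?case using good_mult[OF Suc good_x] by simp
  qed
  obtain m e where m: "m \<in> M0" "g = m \<otimes>\<^bsub>G\<^esub> x [^]\<^bsub>G\<^esub> (e::nat)" using decomp[OF g(1)] by blast
  have mG: "m \<in> carrier G" using in_carrier(3)[OF m(1)] .
  \<comment> \<open>The part \<open>m\<close> keeps depth \<open>v\<close> because \<open>x\<close>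
    has depth \<open>i \<ge> v\<close>.\<close>
  have xv: "x [^]\<^bsub>G\<^esub> int e \<in> H v"
    by (rule G.subgroup_int_pow_closed[OF H_subgroup H_mono[OF x_H vi]])
  have "m = g \<otimes>\<^bsub>G\<^esub> inv\<^bsub>G\<^esub> (x [^]\<^bsub>G\<^esub> int e)" using m mG x_G by (simp add: int_pow_int G.m_assoc)
  then have mv: "m \<in> H v"
    using subgroup.m_closed[OF H_subgroup g(2) subgroup.m_inv_closed[OF H_subgroup xv]] by simp
  have "good m" unfolding good_def using mG T_mult_M0[OF _ m(1) mv] by blast
  then have "good g" using good_mult good_pow m(2) by blast
  then show ?thesis using a by (simp add: good_def)
qed

lemma S_subset_T: "(w, a) \<in> S M \<Longrightarrow> (w, a) \<in> T (p - 1)"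
proof (induction rule: S.induct)
  case (base r)
  have "(0, r \<otimes>\<^bsub>KG\<^esub> \<Delta> x [^]\<^bsub>KG\<^esub> (0::nat)) \<in> T (p - 1)" by (rule T.gen[OF S.base[OF base]]) auto
  then show ?case using base by simp
next
  case (mult w a g v)
  then show ?case using T_mult_M by blast
next
  case (mono w a u)
  then show ?case using T_mono by blast
qed (auto intro: T_zero T.add)

text \<open>
  Every product of total weight \<open>w\<close> is a combination of \<open>b (x - 1)\<^sup>e\<close> with \<open>e < p\<close> and \<open>b\<close> of weight \<open>w - e i\<close> over the smaller subgroup.
\<close>

lemma S_vanish_step:
  assumes van: "\<And>u b. (u, b) \<in> S M0 \<Longrightarrow> u > (p - 1) * n \<Longrightarrow> b = \<zero>\<^bsub>KG\<^esub>"
    and a: "(w, a) \<in> S M" and w: "w > (p - 1) * (n + i)"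
  shows "a = \<zero>\<^bsub>KG\<^esub>"
  using S_subset_T[OF a] w
proof (induction rule: T.induct)
  case (gen u b e w)
  have "e * i \<le> (p - 1) * i" using gen(2) by (rule mult_le_mono1)
  then have "u > (p - 1) * n" using gen(3,4) unfolding distrib_left by linarith
  then have "b = \<zero>\<^bsub>KG\<^esub>" using van gen(1) by blast
  then show ?case using x_G by simp
qed simp

text \<open>Leading terms: \<open>(x - 1)^e\<close> spreads \<open>b\<close> over the cosets
  \<open>x^e' M0\<close> with \<open>e' \<le> e\<close>, and on the last coset it leaves a translate
  of \<open>b\<close>. For \<open>e < p\<close> these cosets are distinct, so nothing cancels and
  the product stays nonzero.\<close>

lemma lower_step:
  assumes b: "b \<in> carrier KG" "supp K b \<subseteq> M0"
  shows "e < p \<Longrightarrow> (\<forall>g. (\<Delta> x [^]\<^bsub>KG\<^esub> e \<otimes>\<^bsub>KG\<^esub> b) g \<noteq> \<zero>\<^bsub>K\<^esub> \<longrightarrow> (\<exists>e'\<le>e. \<exists>m\<in>M0. g = x [^]\<^bsub>G\<^esub> e' \<otimes>\<^bsub>G\<^esub> m)) \<and>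
    (\<forall>m\<in>M0. (\<Delta> x [^]\<^bsub>KG\<^esub> e \<otimes>\<^bsub>KG\<^esub> b) (x [^]\<^bsub>G\<^esub> e \<otimes>\<^bsub>G\<^esub> m) = b m)"
proof (induction e)
  case 0
  have "\<exists>m\<in>M0. g = x [^]\<^bsub>G\<^esub> (0::nat) \<otimes>\<^bsub>G\<^esub> m" if "b g \<noteq> \<zero>\<^bsub>K\<^esub>" for g
    using that b(2) in_carrier(3) by (auto simp: supp_def)
  then show ?case using b(1) in_carrier(3) by auto
next
  case (Suc e)
  define f where "f = \<Delta> x [^]\<^bsub>KG\<^esub> e \<otimes>\<^bsub>KG\<^esub> b"
  have f: "f \<in> carrier KG" using b x_G by (simp add: f_def)
  have eq: "\<Delta> x [^]\<^bsub>KG\<^esub> Suc e \<otimes>\<^bsub>KG\<^esub> b = \<Delta> x \<otimes>\<^bsub>KG\<^esub> f"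
    unfolding f_def using b x_G by (simp only: R.nat_pow_Suc2 Delta_closed R.m_assoc R.nat_pow_closed)
  have IH1: "\<exists>e'\<le>e. \<exists>m\<in>M0. g = x [^]\<^bsub>G\<^esub> e' \<otimes>\<^bsub>G\<^esub> m" if "f g \<noteq> \<zero>\<^bsub>K\<^esub>" for g
    using Suc that by (simp add: f_def)
  have IH2: "f (x [^]\<^bsub>G\<^esub> e \<otimes>\<^bsub>G\<^esub> m) = b m" if "m \<in> M0" for m
    using Suc that by (simp add: f_def)
  have 1: "\<exists>e'\<le>Suc e. \<exists>m\<in>M0. g = x [^]\<^bsub>G\<^esub> e' \<otimes>\<^bsub>G\<^esub> m" if nz: "(\<Delta> x \<otimes>\<^bsub>KG\<^esub> f) g \<noteq> \<zero>\<^bsub>K\<^esub>" for g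
  proof -
    have gG: "g \<in> carrier G" using nz mult_outside by blast
    have "(\<Delta> x \<otimes>\<^bsub>KG\<^esub> f) g = f (inv\<^bsub>G\<^esub> x \<otimes>\<^bsub>G\<^esub> g) \<ominus>\<^bsub>K\<^esub> f g" by (rule Delta_apply[OF x_G f gG])
    then consider "f (inv\<^bsub>G\<^esub> x \<otimes>\<^bsub>G\<^esub> g) \<noteq> \<zero>\<^bsub>K\<^esub>" | "f g \<noteq> \<zero>\<^bsub>K\<^esub>" using nz by (force simp: K.minus_eq)
    then show ?thesis
    proof cases
      case 1
      from IH1[OF this] obtain e' m where em: "e' \<le> e" "m \<in> M0" "inv\<^bsub>G\<^esub> x \<otimes>\<^bsub>G\<^esub> g = x [^]\<^bsub>G\<^esub> e' \<otimes>\<^bsub>G\<^esub> m" by blast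
      have mG: "m \<in> carrier G" using in_carrier(3)[OF em(2)] .
      have "g = x \<otimes>\<^bsub>G\<^esub> (inv\<^bsub>G\<^esub> x \<otimes>\<^bsub>G\<^esub> g)" using x_G gG by (simp add: G.inv_r_cancel)
      also have "\<dots> = x [^]\<^bsub>G\<^esub> Suc e' \<otimes>\<^bsub>G\<^esub> m" unfolding em(3) using x_G mG by (simp only: G.nat_pow_Suc2 G.m_assoc G.nat_pow_closed)
      finally show ?thesis using em by (intro exI[of _ "Suc e'"]) auto
    next
      case 2
      then show ?thesis using IH1 le_SucI by blast
    qed
  qed
  have 2: "(\<Delta> x \<otimes>\<^bsub>KG\<^esub> f) (x [^]\<^bsub>G\<^esub> Suc e \<otimes>\<^bsub>G\<^esub> m) = b m" if m: "m \<in> M0" for m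
  proof -
    have mG: "m \<in> carrier G" using in_carrier(3)[OF m] .
    have "f (x [^]\<^bsub>G\<^esub> Suc e \<otimes>\<^bsub>G\<^esub> m) = \<zero>\<^bsub>K\<^esub>"
    proof (rule ccontr)
      assume "f (x [^]\<^bsub>G\<^esub> Suc e \<otimes>\<^bsub>G\<^esub> m) \<noteq> \<zero>\<^bsub>K\<^esub>"
      from IH1[OF this] obtain e' m' where em: "e' \<le> e" "m' \<in> M0" "x [^]\<^bsub>G\<^esub> Suc e \<otimes>\<^bsub>G\<^esub> m = x [^]\<^bsub>G\<^esub> e' \<otimes>\<^bsub>G\<^esub> m'" by blast
      have mG': "m' \<in> carrier G" using in_carrier(3)[OF em(2)] .
      define d where "d = Suc e - e'"
      have d: "0 < d" "d < p" "Suc e = e' + d" using em(1) Suc.prems by (auto simp: d_def)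
      have "x [^]\<^bsub>G\<^esub> e' \<otimes>\<^bsub>G\<^esub> (x [^]\<^bsub>G\<^esub> d \<otimes>\<^bsub>G\<^esub> m) = x [^]\<^bsub>G\<^esub> e' \<otimes>\<^bsub>G\<^esub> m'"
        using em(3) x_G mG unfolding d(3) by (simp add: G.nat_pow_mult[symmetric] G.m_assoc)
      then have "x [^]\<^bsub>G\<^esub> d \<otimes>\<^bsub>G\<^esub> m = m'" using x_G mG mG' by simp
      then have "x [^]\<^bsub>G\<^esub> d = m' \<otimes>\<^bsub>G\<^esub> inv\<^bsub>G\<^esub> m" using x_G mG by (auto simp: G.m_assoc)
      also have "\<dots> \<in> M0" by (rule subgroup.m_closed[OF M0 em(2) subgroup.m_inv_closed[OF M0 m]])
      finally show False using pow_not_mem[OF d(1,2)] by simp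
    qed
    moreover have "inv\<^bsub>G\<^esub> x \<otimes>\<^bsub>G\<^esub> (x [^]\<^bsub>G\<^esub> Suc e \<otimes>\<^bsub>G\<^esub> m) = x [^]\<^bsub>G\<^esub> e \<otimes>\<^bsub>G\<^esub> m"
      using x_G mG by (simp only: G.nat_pow_Suc2 G.m_assoc G.nat_pow_closed G.inv_l_cancel G.m_closed)
    ultimately show ?thesis
      using Delta_apply[OF x_G f, of "x [^]\<^bsub>G\<^esub> Suc e \<otimes>\<^bsub>G\<^esub> m"] IH2[OF m] x_G mG carrierD(1)[OF b(1)]
      by (simp add: K.minus_eq)
  qed
  show ?case unfolding eq using 1 2 by blast
qed

end


declare upper_Lie_power.simps(3) [simp del]

section \<open>Top weight, heights and the upper Lie nilpotency index\<close>

context central_series begin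

lemma card_power: "subgroup M G \<Longrightarrow> M \<subseteq> D \<Longrightarrow> \<exists>n. card M = p ^ n"
proof (induction "card M" arbitrary: M rule: less_induct)
  case less
  show ?case
  proof (cases "M = {\<one>\<^bsub>G\<^esub>}")
    case True
    then show ?thesis by (intro exI[of _ 0]) simp
  next
    case False
    from step_exists[OF less.prems False] obtain i M0 x where step: "subgroup_step G p M M0 x" by blast
    interpret step: subgroup_step G p M M0 x by (rule step)
    have "finite M" using less.prems(2) finite_derived by (rule finite_subset)
    have "M0 \<subset> M" using step.M0_M step.x by blast
    then have "card M0 < card M" using \<open>finite M\<close> by (intro psubset_card_mono)
    moreover have "M0 \<subseteq> D" using step.M0_M less.prems(2) by (rule order.trans)
    ultimately obtain n where "card M0 = p ^ n" using less.hyps[OF _ step.M0] by blast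
    then show ?thesis using step.card_eq by (intro exI[of _ "Suc n"]) simp
  qed
qed

text \<open>Induction along subgroup steps. A step at depth \<open>i\<close> multiplies the factors
  with \<open>j \<le> i\<close> by \<open>p\<close> and leaves the others alone, so \<open>w\<close>
  grows by \<open>i\<close>; the top weight grows by \<open>(p-1) i\<close>, by
  \<open>S_vanish_step\<close>. Under the last hypothesis multiplication by
  \<open>(x - 1)^(p-1)\<close> carries along a nonzero element of that weight, so the bound is
  attained.\<close>

lemma weight:
  assumes c: "H c = {\<one>\<^bsub>G\<^esub>}"
  shows "subgroup M G \<Longrightarrow> M \<subseteq> D \<Longrightarrow>
    \<exists>w. (\<Prod>j\<in>{1..c}. card (M \<inter> H j)) = p ^ w \<and>
        (\<forall>u b. (u, b) \<in> S M \<longrightarrow> u > (p - 1) * w \<longrightarrow> b = \<zero>\<^bsub>KG\<^esub>) \<and>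
        ((\<forall>i. H i \<subseteq> dim_subgroup (R.ULP (Suc i))) \<longrightarrow>
          (\<exists>b\<in>R.ULP (Suc ((p - 1) * w)). b \<noteq> \<zero>\<^bsub>KG\<^esub> \<and> supp K b \<subseteq> M))"
proof (induction "card M" arbitrary: M rule: less_induct)
  case less
  show ?case
  proof (cases "M = {\<one>\<^bsub>G\<^esub>}")
    case True
    have "card (M \<inter> H j) = 1" for j
      using True subgroup.one_closed[OF H_subgroup, of j] by simp
    moreover have "b = \<zero>\<^bsub>KG\<^esub>" if "(u, b) \<in> S M" "u > 0" for u b
      using S_trivial that True by blast
    moreover have "\<one>\<^bsub>KG\<^esub> \<noteq> \<zero>\<^bsub>KG\<^esub>" using one_not_zero by (metis one_apply zero_apply)
    moreover have "supp K \<one>\<^bsub>KG\<^esub> \<subseteq> M" by (auto simp: supp_def one_apply True split: if_splits)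
    ultimately show ?thesis by (intro exI[of _ 0]) (auto intro!: bexI[of _ "\<one>\<^bsub>KG\<^esub>"])
  next
    case False
    from step_exists[OF less.prems False] obtain i M0 x where i: "i \<ge> 1" "M \<subseteq> H i" "M \<inter> H (Suc i) \<subseteq> M0"
      and step: "subgroup_step G p M M0 x" by blast
    interpret step: subgroup_step G p M M0 x by (rule step)
    interpret cs: central_series_step K G p H M M0 x i
      by (intro central_series_step.intro central_series_step_axioms.intro central_series_axioms step i)
    have "finite M" using less.prems(2) finite_derived by (rule finite_subset)
    have "M0 \<subset> M" using step.M0_M step.x by blast
    then have "card M0 < card M" using \<open>finite M\<close> by (intro psubset_card_mono)
    moreover have "M0 \<subseteq> D" using step.M0_M less.prems(2) by (rule order.trans)
    ultimately obtain w where w: "(\<Prod>j\<in>{1..c}. card (M0 \<inter> H j)) = p ^ w"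
      and van: "\<And>u b. (u, b) \<in> S M0 \<Longrightarrow> u > (p - 1) * w \<Longrightarrow> b = \<zero>\<^bsub>KG\<^esub>"
      and low: "(\<forall>i. H i \<subseteq> dim_subgroup (R.ULP (Suc i))) \<Longrightarrow>
          (\<exists>b\<in>R.ULP (Suc ((p - 1) * w)). b \<noteq> \<zero>\<^bsub>KG\<^esub> \<and> supp K b \<subseteq> M0)"
      using less.hyps[OF _ step.M0] by blast
    \<comment> \<open>Ensures that all \<open>i\<close> affected factors occur in the product up to
      \<open>c\<close>.\<close>
    have "i \<le> c"
    proof (rule ccontr)
      assume "\<not> i \<le> c"
      then have "M \<subseteq> {\<one>\<^bsub>G\<^esub>}" using i(2) H_antimono[of c i] c by auto
      then show False using False subgroup.one_closed[OF less.prems(1)] by blast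
    qed
    have "card (M \<inter> H j) = card (M0 \<inter> H j) * (if j \<le> i then p else 1)" for j
    proof (cases "j \<le> i")
      case True
      then have "M \<subseteq> H j" using H_antimono[OF True] i(2) by blast
      then have "M \<inter> H j = M" "M0 \<inter> H j = M0" using step.M0_M by auto
      then show ?thesis using True step.card_eq by simp
    next
      case False
      then have "H j \<subseteq> H (Suc i)" by (intro H_antimono) simp
      then have "M \<inter> H j = M0 \<inter> H j" using i(3) step.M0_M by blast
      then show ?thesis using False by simp
    qed
    then have "(\<Prod>j\<in>{1..c}. card (M \<inter> H j)) = p ^ w * (\<Prod>j\<in>{1..c}. if j \<le> i then p else 1)"
      by (simp only: prod.distrib w)
    also have "(\<Prod>j\<in>{1..c}. if j \<le> i then p else 1) = (\<Prod>j\<in>{j\<in>{1..c}. j \<le> i}. p)"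
      by (rule prod.inter_filter[symmetric]) simp
    also have "{j\<in>{1..c}. j \<le> i} = {1..i}" using \<open>i \<le> c\<close> by auto
    finally have "(\<Prod>j\<in>{1..c}. card (M \<inter> H j)) = p ^ (w + i)" by (simp add: power_add)
    moreover have "b = \<zero>\<^bsub>KG\<^esub>" if "(u, b) \<in> S M" "u > (p - 1) * (w + i)" for u b
      using cs.S_vanish_step[OF van that] .
    moreover have "\<exists>b\<in>R.ULP (Suc ((p - 1) * (w + i))). b \<noteq> \<zero>\<^bsub>KG\<^esub> \<and> supp K b \<subseteq> M"
      if dim: "\<forall>i. H i \<subseteq> dim_subgroup (R.ULP (Suc i))"
    proof -
      from low[OF dim] obtain b where b: "b \<in> R.ULP (Suc ((p - 1) * w))" "b \<noteq> \<zero>\<^bsub>KG\<^esub>" "supp K b \<subseteq> M0" by blast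
      have bc: "b \<in> carrier KG" using b(1) R.ULP_carrier by blast
      define b' where "b' = \<Delta> x [^]\<^bsub>KG\<^esub> (p - 1) \<otimes>\<^bsub>KG\<^esub> b"
      have "\<Delta> x \<in> R.ULP (Suc i)" using dim cs.x_H by (auto simp: dim_subgroup_def)
      then have "b' \<in> R.ULP (Suc ((p - 1) * i + (p - 1) * w))"
        unfolding b'_def by (intro R.ULP_mult R.ULP_pow b(1))
      then have "b' \<in> R.ULP (Suc ((p - 1) * (w + i)))" by (simp only: distrib_left add.commute)
      moreover note ls = cs.lower_step[OF bc b(3), of "p - 1", folded b'_def]
      have "p - 1 < p" using p_gt_0 by simp
      note ls = ls[OF this]
      obtain m where m: "m \<in> supp K b" using b(2) by (auto simp: eq_zero_iff_supp)
      then have "b' (x [^]\<^bsub>G\<^esub> (p - 1) \<otimes>\<^bsub>G\<^esub> m) \<noteq> \<zero>\<^bsub>K\<^esub>" using ls b(3) by (auto simp: supp_def)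
      then have "b' \<noteq> \<zero>\<^bsub>KG\<^esub>" by (auto simp: zero_apply)
      moreover have "supp K b' \<subseteq> M"
      proof
        fix g assume "g \<in> supp K b'"
        then have "b' g \<noteq> \<zero>\<^bsub>K\<^esub>" by (simp add: supp_def)
        then obtain e m where em: "m \<in> M0" "g = x [^]\<^bsub>G\<^esub> (e::nat) \<otimes>\<^bsub>G\<^esub> m" using ls by blast
        have "x [^]\<^bsub>G\<^esub> int e \<in> M" by (rule G.subgroup_int_pow_closed[OF step.M step.x(1)])
        then show "g \<in> M" unfolding em(2) using em(1) step.M0_M subgroup.m_closed[OF step.M]
          by (auto simp: int_pow_int)
      qed
      ultimately show ?thesis by blast
    qed
    ultimately show ?thesis by (intro exI[of _ "w + i"]) blast
  qed
qed

definition ht :: "nat \<Rightarrow> nat" where "ht j = (SOME n. card (H j) = p ^ n)"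

lemma card_H: "card (H j) = p ^ ht j"
  unfolding ht_def by (rule someI_ex) (rule card_power[OF H_subgroup H_D])

lemma ht_eq: "card (H j) = p ^ n \<Longrightarrow> ht j = n"
  using card_H[of j] prime_gt_1_nat[OF prime_p] by (simp add: power_inject_exp)

lemma weight_eq:
  assumes "(\<Prod>j\<in>{1..c}. card (D \<inter> H j)) = p ^ w"
  shows "w = (\<Sum>j\<in>{1..c}. ht j)"
proof -
  have "D \<inter> H j = H j" for j using H_D by blast
  then have "p ^ w = (\<Prod>j\<in>{1..c}. p ^ ht j)" using assms by (simp add: card_H)
  also have "\<dots> = p ^ (\<Sum>j\<in>{1..c}. ht j)" by (simp add: power_sum)
  finally show ?thesis using prime_gt_1_nat[OF prime_p] by (simp add: power_inject_exp)
qed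

lemma D_subgroup: "subgroup D G"
  using H_subgroup[of 0] H_0 by simp

text \<open>Weight \<open>w\<close> belongs to \<open>ULP (Suc w)\<close>, and the first weight that
  vanishes is one above the top; hence two successors.\<close>

lemma ULP_vanish:
  assumes c: "H c = {\<one>\<^bsub>G\<^esub>}"
  shows "R.ULP (Suc (Suc ((p - 1) * (\<Sum>j\<in>{1..c}. ht j)))) = {\<zero>\<^bsub>KG\<^esub>}"
proof -
  obtain w where w: "(\<Prod>j\<in>{1..c}. card (D \<inter> H j)) = p ^ w"
    and van: "\<And>u b. (u, b) \<in> S D \<Longrightarrow> u > (p - 1) * w \<Longrightarrow> b = \<zero>\<^bsub>KG\<^esub>"
    using weight[OF c D_subgroup order.refl] by blast
  have "b = \<zero>\<^bsub>KG\<^esub>" if "b \<in> R.ULP (Suc (Suc ((p - 1) * w)))" for b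
  proof (rule van)
    show "(Suc ((p - 1) * w), b) \<in> S D" using subsetD[OF ULP_subset_S that] by blast
  qed simp
  then show ?thesis
    using additive_subgroup.zero_closed[OF ideal.axioms(1)[OF R.ULP_ideal]] weight_eq[OF w] by auto
qed

lemma ULP_nonzero:
  assumes c: "H c = {\<one>\<^bsub>G\<^esub>}" and dim: "\<forall>i. H i \<subseteq> dim_subgroup (R.ULP (Suc i))"
  shows "R.ULP (Suc ((p - 1) * (\<Sum>j\<in>{1..c}. ht j))) \<noteq> {\<zero>\<^bsub>KG\<^esub>}"
proof -
  obtain w b where w: "(\<Prod>j\<in>{1..c}. card (D \<inter> H j)) = p ^ w"
    and b: "b \<in> R.ULP (Suc ((p - 1) * w))" "b \<noteq> \<zero>\<^bsub>KG\<^esub>"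
    using weight[OF c D_subgroup order.refl] dim by blast
  then show ?thesis using weight_eq[OF w] by auto
qed

lemma index_le:
  assumes c: "H c = {\<one>\<^bsub>G\<^esub>}"
  shows "upper_Lie_nilpotency_index KG \<le> (p - 1) * (\<Sum>j\<in>{1..c}. ht j) + 2"
  unfolding upper_Lie_nilpotency_index_def
  by (rule Least_le) (use ULP_vanish[OF c] in simp)

lemma index_eq:
  assumes c: "H c = {\<one>\<^bsub>G\<^esub>}" and dim: "\<forall>i. H i \<subseteq> dim_subgroup (R.ULP (Suc i))"
  shows "upper_Lie_nilpotency_index KG = (p - 1) * (\<Sum>j\<in>{1..c}. ht j) + 2"
proof (rule antisym[OF index_le[OF c]])
  let ?n = "upper_Lie_nilpotency_index KG" and ?N = "(p - 1) * (\<Sum>j\<in>{1..c}. ht j)"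
  have "?n \<ge> 1 \<and> R.ULP ?n = {\<zero>\<^bsub>KG\<^esub>}"
    unfolding upper_Lie_nilpotency_index_def
    by (rule LeastI[of _ "?N + 2"]) (use ULP_vanish[OF c] in simp)
  then have n: "R.ULP ?n = {\<zero>\<^bsub>KG\<^esub>}" by blast
  show "?N + 2 \<le> ?n"
  proof (rule ccontr)
    assume "\<not> ?N + 2 \<le> ?n"
    then have "R.ULP (Suc ?N) \<subseteq> {\<zero>\<^bsub>KG\<^esub>}" using R.ULP_antimono[of ?n "Suc ?N"] n by simp
    then show False
      using ULP_nonzero[OF c dim] additive_subgroup.zero_closed[OF ideal.axioms(1)[OF R.ULP_ideal]] by blast
  qed
qed

end

subsection \<open>The Lie dimension series\<close>

locale nilpotent_group_algebra = modular_group_algebra K G p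
  for K :: "('k, 'm) ring_scheme" and G :: "('g, 'n) monoid_scheme" and p +
  assumes finite_D: "finite (derived G (carrier G))"
    and ULP_end: "\<exists>n. R.ULP (Suc n) = {\<zero>\<^bsub>KG\<^esub>}"
begin

text \<open>The Lie dimension subgroups, indexed by weight. The intersection with \<open>G'\<close>
  gives index 0 the value that \<open>central_series\<close> prescribes.\<close>

definition DH :: "nat \<Rightarrow> 'g set" where
  "DH i = derived G (carrier G) \<inter> dim_subgroup (R.ULP (Suc i))"

lemma Delta_eq_zero: "g \<in> carrier G \<Longrightarrow> \<Delta> g = \<zero>\<^bsub>KG\<^esub> \<Longrightarrow> g = \<one>\<^bsub>G\<^esub>"
proof (rule ccontr)
  assume g: "g \<in> carrier G" and z: "\<Delta> g = \<zero>\<^bsub>KG\<^esub>" and ne: "g \<noteq> \<one>\<^bsub>G\<^esub>"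
  have "\<delta> g = \<one>\<^bsub>KG\<^esub>" using z R.r_right_minus_eq[of "\<delta> g" "\<one>\<^bsub>KG\<^esub>"] g by simp
  then have "\<delta> g g = \<one>\<^bsub>KG\<^esub> g" by simp
  then show False using ne one_not_zero by (simp add: mon_def one_apply)
qed

lemma gcomm_derived: "x \<in> carrier G \<Longrightarrow> y \<in> carrier G \<Longrightarrow> gcomm G x y \<in> derived G (carrier G)"
  unfolding derived_def by (rule generate.incl) (auto simp: gcomm_def)

lemma derived_G: "x \<in> derived G (carrier G) \<Longrightarrow> x \<in> carrier G"
  using G.derived_in_carrier[of "carrier G"] by blast

lemma derived_subgroup: "subgroup (derived G (carrier G)) G"
  by (rule G.derived_is_subgroup) simp

text \<open>The conditions mirror properties of the upper Lie powers: \<open>ULP_bracket\<close> for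
  commutators with \<open>G\<close>, \<open>ULP_mult\<close> for commutators within the series, and
  \<open>ULP_pow\<close> with the Frobenius identity for \<open>p\<close>-th powers.\<close>

sublocale DH: central_series K G p DH
proof (intro central_series.intro central_series_axioms.intro modular_group_algebra_axioms)
  show "subgroup (DH i) G" for i
    unfolding DH_def by (rule G.subgroups_Inter_pair[OF derived_subgroup dim_subgroup[OF R.ULP_ideal]])
  show "DH 0 = derived G (carrier G)"
    using derived_G by (auto simp: DH_def dim_subgroup_def)
  have "derived G (carrier G) \<subseteq> dim_subgroup (R.ULP (Suc 1))"
    unfolding derived_def
  proof (rule G.generate_subgroup_incl[OF _ dim_subgroup[OF R.ULP_ideal]])
    have "gcomm G x y \<in> dim_subgroup (R.ULP (Suc 1))" if "x \<in> carrier G" "y \<in> carrier G" for x y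
      by (rule gcomm_mem_dim_subgroup[OF R.ULP_ideal that], rule R.ULP_bracket) (use that in simp_all)
    then show "derived_set G (carrier G) \<subseteq> dim_subgroup (R.ULP (Suc 1))" by (auto simp: gcomm_def)
  qed
  then show "DH 1 = derived G (carrier G)" by (auto simp: DH_def)
  show "DH (Suc i) \<subseteq> DH i" for i
    unfolding DH_def dim_subgroup_def using R.ULP_mono_Suc[of "Suc i"] by blast
  fix i x assume x: "x \<in> DH i"
  then have xD: "x \<in> derived G (carrier G)" and xG: "x \<in> carrier G" and xU: "\<Delta> x \<in> R.ULP (Suc i)"
    by (auto simp: DH_def dim_subgroup_def)
  have lb: "lie_bracket KG (\<delta> x) y = lie_bracket KG (\<Delta> x) y" if y: "y \<in> carrier KG" for y
  proof -
    have "lie_bracket KG (\<Delta> x) y \<oplus>\<^bsub>KG\<^esub> lie_bracket KG \<one>\<^bsub>KG\<^esub> y = lie_bracket KG (\<delta> x) y"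
      using xG y by (simp add: R.lie_bracket_add_left[symmetric] Delta_add_one)
    moreover have "lie_bracket KG \<one>\<^bsub>KG\<^esub> y = \<zero>\<^bsub>KG\<^esub>"
      using y by (simp add: lie_bracket_def a_minus_def R.r_neg)
    ultimately show ?thesis using xG y by simp
  qed
  show "gcomm G x g \<in> DH (Suc i)" if g: "g \<in> carrier G" for g
  proof -
    have "lie_bracket KG (\<delta> x) (\<delta> g) \<in> R.ULP (Suc (Suc i))"
      unfolding lb[OF mon_closed[OF K.one_closed g]] by (rule R.ULP_bracket[OF xU]) (use g in simp)
    then show ?thesis
      unfolding DH_def using gcomm_mem_dim_subgroup[OF R.ULP_ideal xG g] gcomm_derived[OF xG g] by blast
  qed
  show "gcomm G x y \<in> DH (i + j)" if y: "y \<in> DH j" for j y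
  proof -
    from y have yG: "y \<in> carrier G" and yU: "\<Delta> y \<in> R.ULP (Suc j)" by (auto simp: DH_def dim_subgroup_def)
    interpret I: ideal "R.ULP (Suc (i + j))" KG by (rule R.ULP_ideal)
    have 1: "\<Delta> x \<otimes>\<^bsub>KG\<^esub> \<Delta> y \<in> R.ULP (Suc (i + j))" by (rule R.ULP_mult[OF xU yU])
    have "\<Delta> y \<otimes>\<^bsub>KG\<^esub> \<Delta> x \<in> R.ULP (Suc (j + i))" by (rule R.ULP_mult[OF yU xU])
    then have 2: "\<ominus>\<^bsub>KG\<^esub> (\<Delta> y \<otimes>\<^bsub>KG\<^esub> \<Delta> x) \<in> R.ULP (Suc (i + j))"
      unfolding add.commute[of j i] by (rule I.a_inv_closed)
    have "lie_bracket KG (\<Delta> x) (\<Delta> y) \<in> R.ULP (Suc (i + j))"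
      using I.a_closed[OF 1 2] by (simp only: lie_bracket_def a_minus_def)
    moreover have "lie_bracket KG (\<Delta> x) (\<Delta> y) = lie_bracket KG (\<delta> x) (\<delta> y)"
    proof -
      have "lie_bracket KG (\<delta> x) (\<delta> y) = lie_bracket KG (\<delta> x) (\<Delta> y \<oplus>\<^bsub>KG\<^esub> \<one>\<^bsub>KG\<^esub>)"
        using yG by (simp only: Delta_add_one)
      also have "\<dots> = lie_bracket KG (\<delta> x) (\<Delta> y) \<oplus>\<^bsub>KG\<^esub> lie_bracket KG (\<delta> x) \<one>\<^bsub>KG\<^esub>"
        using xG yG by (intro R.lie_bracket_add_right) auto
      also have "lie_bracket KG (\<delta> x) \<one>\<^bsub>KG\<^esub> = \<zero>\<^bsub>KG\<^esub>"
        using xG by (simp add: lie_bracket_def)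
      finally show ?thesis using lb[OF Delta_closed[OF yG]] xG yG by simp
    qed
    ultimately have "lie_bracket KG (\<delta> x) (\<delta> y) \<in> R.ULP (Suc (i + j))" by simp
    then show ?thesis
      unfolding DH_def using gcomm_mem_dim_subgroup[OF R.ULP_ideal xG yG] gcomm_derived[OF xG yG] by blast
  qed
  have "\<Delta> (x [^]\<^bsub>G\<^esub> p) \<in> R.ULP (Suc (p * i))"
    unfolding Delta_pow_p[OF xG, symmetric] by (rule R.ULP_pow[OF xU])
  moreover have "x [^]\<^bsub>G\<^esub> int p \<in> derived G (carrier G)"
    by (rule G.subgroup_int_pow_closed[OF derived_subgroup xD])
  ultimately show "x [^]\<^bsub>G\<^esub> p \<in> DH (p * i)"
    using xG by (simp add: DH_def dim_subgroup_def int_pow_int)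
next
  obtain n where n: "R.ULP (Suc n) = {\<zero>\<^bsub>KG\<^esub>}" using ULP_end by blast
  have "x = \<one>\<^bsub>G\<^esub>" if "x \<in> DH n" for x
    using that n Delta_eq_zero by (auto simp: DH_def dim_subgroup_def)
  moreover have "\<one>\<^bsub>G\<^esub> \<in> DH n"
    unfolding DH_def
    by (rule subgroup.one_closed[OF G.subgroups_Inter_pair[OF derived_subgroup dim_subgroup[OF R.ULP_ideal]]])
  ultimately have "DH n = {\<one>\<^bsub>G\<^esub>}" by blast
  then show "\<exists>c. DH c = {\<one>\<^bsub>G\<^esub>}" by blast
qed (rule finite_D)

lemma DH_dim: "\<forall>i. DH i \<subseteq> dim_subgroup (R.ULP (Suc i))"
  by (simp add: DH_def)

lemma DH_index: "DH c = {\<one>\<^bsub>G\<^esub>} \<Longrightarrow> upper_Lie_nilpotency_index KG = (p - 1) * (\<Sum>j\<in>{1..c}. DH.ht j) + 2"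
  using DH.index_eq DH_dim by blast

text \<open>
  By the two bounds on the index, the Lie dimension series has no proper refinement of the same kind;
  this replaces an explicit description of its terms.
\<close>

lemma DH_minimal:
  assumes H': "central_series K G p H'" and sub: "\<And>i. H' i \<subseteq> DH i"
  shows "H' i = DH i"
proof (rule ccontr)
  assume ne: "H' i \<noteq> DH i"
  interpret H': central_series K G p H' by (rule H')
  obtain c0 where c0: "DH c0 = {\<one>\<^bsub>G\<^esub>}" using DH.H_end by blast
  define c where "c = max c0 i"
  have one: "\<one>\<^bsub>G\<^esub> \<in> H' j" "\<one>\<^bsub>G\<^esub> \<in> DH j" for j
    by (rule subgroup.one_closed[OF H'.H_subgroup], rule subgroup.one_closed[OF DH.H_subgroup])
  have "DH c \<subseteq> {\<one>\<^bsub>G\<^esub>}" using DH.H_antimono[of c0 c] c0 by (simp add: c_def)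
  then have c: "DH c = {\<one>\<^bsub>G\<^esub>}" "H' c = {\<one>\<^bsub>G\<^esub>}" using one[of c] sub[of c] by blast+
  have i: "i \<in> {1..c}"
  proof -
    have "i \<noteq> 0" using ne H'.H_0 DH.H_0 by metis
    then show ?thesis by (simp add: c_def)
  qed
  have p1: "p > 1" by (rule prime_gt_1_nat[OF prime_p])
  have le: "H'.ht j \<le> DH.ht j" for j
  proof -
    have "card (H' j) \<le> card (DH j)" by (rule card_mono[OF DH.H_finite sub])
    then show ?thesis using p1 by (simp add: H'.card_H DH.card_H)
  qed
  have "H' i \<subset> DH i" using ne sub by blast
  then have "card (H' i) < card (DH i)" using DH.H_finite by (intro psubset_card_mono)
  then have "H'.ht i < DH.ht i" using p1 by (simp add: H'.card_H DH.card_H)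
  then have "(\<Sum>j\<in>{1..c}. H'.ht j) < (\<Sum>j\<in>{1..c}. DH.ht j)"
    using le i by (intro sum_strict_mono_ex1) auto
  then have "(p - 1) * (\<Sum>j\<in>{1..c}. H'.ht j) < (p - 1) * (\<Sum>j\<in>{1..c}. DH.ht j)"
    using p1 by simp
  then show False using H'.index_le[OF c(2)] DH_index[OF c(1)] by linarith
qed

text \<open>If the series is constant from \<open>m + 1\<close> to \<open>k\<close>, with value
  \<open>N\<close>, let \<open>Q\<close> be generated by \<open>(N, G)\<close> and the
  \<open>p\<close>-th powers of \<open>N\<close>, and cut all terms from \<open>k\<close> on down to
  \<open>Q\<close>. The bounds on \<open>k\<close> ensure that a commutator or power reaching index
  \<open>k\<close> involves an element of index above \<open>m\<close>, hence of \<open>N\<close>.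
  Minimality then gives \<open>N \<subseteq> Q\<close>, which is impossible for nontrivial
  \<open>N\<close>.\<close>

lemma DH_gap:
  assumes k: "k \<ge> m + 2" "k > p * m" and eq: "DH (Suc m) = DH k"
  shows "DH (Suc m) = {\<one>\<^bsub>G\<^esub>}"
proof -
  let ?N = "DH (Suc m)"
  define U where "U = {gcomm G x g | x g. x \<in> ?N \<and> g \<in> carrier G} \<union> {x [^]\<^bsub>G\<^esub> p | x. x \<in> ?N}"
  define Q where "Q = generate G U"
  have U: "U \<subseteq> carrier G" using DH.H_carrier by (auto simp: U_def)
  have Q: "subgroup Q G" unfolding Q_def by (rule G.generate_is_subgroup[OF U])
  have QU: "u \<in> Q" if "u \<in> U" for u unfolding Q_def using that by (rule generate.incl)
  have Qg: "gcomm G x g \<in> Q" if "x \<in> ?N" "g \<in> carrier G" for x g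
    using that by (intro QU) (auto simp: U_def)
  have Qg': "gcomm G g x \<in> Q" if "x \<in> ?N" "g \<in> carrier G" for x g
    using subgroup.m_inv_closed[OF Q Qg[OF that]] that DH.H_carrier[of x] by (simp add: G.gcomm_inv)
  have Qp: "x [^]\<^bsub>G\<^esub> p \<in> Q" if "x \<in> ?N" for x
    using that by (intro QU) (auto simp: U_def)
  have p2: "p \<ge> 2" by (rule prime_ge_2_nat[OF prime_p])
  define H' where "H' i = (if i < k then DH i else Q \<inter> DH i)" for i
  have H'_sub: "H' i \<subseteq> DH i" for i by (auto simp: H'_def)
  have H'_I: "x \<in> H' i" if "x \<in> DH i" "i \<ge> k \<Longrightarrow> x \<in> Q" for x i
    using that by (auto simp: H'_def)
  have N: "x \<in> ?N" if "x \<in> H' i" "i > m" for x i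
    using DH.H_mono[of x i "Suc m"] H'_sub that by auto
  have "central_series K G p H'"
  proof (intro central_series.intro central_series_axioms.intro modular_group_algebra_axioms)
    show "subgroup (H' i) G" for i
      using DH.H_subgroup G.subgroups_Inter_pair[OF Q] by (simp add: H'_def)
    show "H' 0 = derived G (carrier G)" "H' 1 = derived G (carrier G)"
      using k(1) DH.H_0 DH.H_1 by (simp_all add: H'_def)
    show "H' (Suc i) \<subseteq> H' i" for i using DH.H_Suc[of i] by (auto simp: H'_def)
    show "gcomm G x g \<in> H' (Suc i)" if "x \<in> H' i" "g \<in> carrier G" for i x g
    proof (rule H'_I)
      show "gcomm G x g \<in> DH (Suc i)" using that H'_sub by (intro DH.H_central) auto
      assume "k \<le> Suc i"
      then show "gcomm G x g \<in> Q" using that k(1) by (intro Qg N[of x i]) auto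
    qed
    show "gcomm G x y \<in> H' (i + j)" if x: "x \<in> H' i" and y: "y \<in> H' j" for i j x y
    proof (rule H'_I)
      have xy: "x \<in> DH i" "y \<in> DH j" using x y H'_sub by auto
      show "gcomm G x y \<in> DH (i + j)" by (rule DH.H_comm[OF xy])
      assume "k \<le> i + j"
      moreover have "2 * m \<le> p * m" using p2 by (rule mult_le_mono1)
      ultimately have "i > m \<or> j > m" using k(2) by linarith
      then show "gcomm G x y \<in> Q"
      proof
        assume "i > m"
        then show ?thesis using Qg[OF N[OF x]] DH.H_carrier[OF xy(2)] by blast
      next
        assume "j > m"
        then show ?thesis using Qg'[OF N[OF y]] DH.H_carrier[OF xy(1)] by blast
      qed
    qed
    show "x [^]\<^bsub>G\<^esub> p \<in> H' (p * i)" if "x \<in> H' i" for i x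
    proof (rule H'_I)
      show "x [^]\<^bsub>G\<^esub> p \<in> DH (p * i)" using that H'_sub by (intro DH.H_pow) auto
      assume "k \<le> p * i"
      then have "p * m < p * i" using k(2) by linarith
      then have "m < i" by simp
      then show "x [^]\<^bsub>G\<^esub> p \<in> Q" by (rule Qp[OF N[OF that]])
    qed
    obtain c where c: "DH c = {\<one>\<^bsub>G\<^esub>}" using DH.H_end by blast
    have "\<one>\<^bsub>G\<^esub> \<in> H' c"
      by (rule H'_I) (use c subgroup.one_closed[OF Q] in simp_all)
    then show "\<exists>c. H' c = {\<one>\<^bsub>G\<^esub>}" using c H'_sub[of c] by (intro exI[of _ c]) blast
  qed (rule finite_D)
  from DH_minimal[OF this H'_sub, of k] have "DH k \<subseteq> Q" by (auto simp: H'_def)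
  then have NQ: "?N \<subseteq> Q" using eq by simp
  \<comment> \<open>Every generator of \<open>Q\<close> lies one step deeper than \<open>N\<close>,
    so \<open>N \<subseteq> Q\<close> pushes \<open>N\<close> down indefinitely.\<close>
  have "?N \<subseteq> DH (Suc m + j)" for j
  proof (induction j)
    case (Suc j)
    have "U \<subseteq> DH (Suc (Suc m + j))"
    proof
      fix u assume "u \<in> U"
      then consider x g where "u = gcomm G x g" "x \<in> ?N" "g \<in> carrier G" | x where "u = x [^]\<^bsub>G\<^esub> p" "x \<in> ?N"
        by (auto simp: U_def)
      then show "u \<in> DH (Suc (Suc m + j))"
      proof cases
        case 1
        then show ?thesis using Suc DH.H_central[of x "Suc m + j" g] by blast
      next
        case 2
        have *: "Suc t \<le> p * t" if "t \<ge> 1" for t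
          using mult_le_mono1[OF p2, of t] that by linarith
        have "Suc (Suc m + j) \<le> p * (Suc m + j)" by (rule *) simp
        then show ?thesis using DH.H_mono[OF DH.H_pow[of x "Suc m + j"]] 2 Suc by blast
      qed
    qed
    then have "Q \<subseteq> DH (Suc (Suc m + j))"
      unfolding Q_def by (rule G.generate_subgroup_incl[OF _ DH.H_subgroup])
    then show ?case using NQ by simp
  qed simp
  moreover obtain c where c: "DH c = {\<one>\<^bsub>G\<^esub>}" using DH.H_end by blast
  moreover have "DH (Suc m + c) \<subseteq> DH c" by (rule DH.H_antimono) simp
  ultimately have "?N \<subseteq> {\<one>\<^bsub>G\<^esub>}" by blast
  then show ?thesis using subgroup.one_closed[OF DH.H_subgroup, of "Suc m"] by blast
qed

end


subsection \<open>The extremal weight sequence\<close>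

lemma geometric_sum_nat: "(p - 1) * (\<Sum>j<n. p ^ j) + 1 = (p::nat) ^ n" if "p \<ge> 1"
proof (induction n)
  case (Suc n)
  have "(p - 1) * (\<Sum>j<Suc n. p ^ j) + 1 = ((p - 1) * (\<Sum>j<n. p ^ j) + 1) + (p - 1) * p ^ n"
    by (simp add: distrib_left)
  also have "\<dots> = (1 + (p - 1)) * p ^ n" unfolding Suc by (simp only: distrib_right mult_1)
  finally show ?case using that by simp
qed simp

text \<open>
  The sequence with \<open>h i = #{j < n. i \<le> p\<^sup>j}\<close> is the largest one satisfying the gap condition;
  its sum is \<open>1 + p + \<dots> + p^(n-1)\<close>, and a sequence with sum smaller by one differs from it in one place.
\<close>

lemma extremal_heights:
  fixes h :: "nat \<Rightarrow> nat"
  assumes p: "p \<ge> 2" and h1: "h 1 = n" and anti: "\<And>i. h (Suc i) \<le> h i" and hc: "h c = 0"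
    and gap: "\<And>m k. k \<ge> m + 2 \<Longrightarrow> k > p * m \<Longrightarrow> h (Suc m) = h k \<Longrightarrow> h (Suc m) = 0"
    and sum: "(p - 1) * (\<Sum>j\<in>{1..c}. h j) + p = p ^ n"
  shows "n \<ge> 2" "\<And>i a. i \<ge> 1 \<Longrightarrow> a < n \<Longrightarrow> i \<le> p ^ a \<Longrightarrow> (\<And>b. b < a \<Longrightarrow> p ^ b < i) \<Longrightarrow>
      i \<noteq> p ^ (n - 1) \<Longrightarrow> h i = n - a" "h (p ^ (n - 1)) = 0"
proof -
  define f where "f i = card {j. j < n \<and> i \<le> p ^ j}" for i
  have mono: "h j \<le> h i" if "i \<le> j" for i j using lift_Suc_antimono_le[of h, OF anti that] .
  have pmono: "p ^ a \<le> p ^ b" if "a \<le> b" for a b using p that by (intro power_increasing) auto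
  have fval: "f i = n - a" if "a \<le> n" "a < n \<Longrightarrow> i \<le> p ^ a" "\<And>b. b < a \<Longrightarrow> p ^ b < i" for i a
  proof -
    have "{j. j < n \<and> i \<le> p ^ j} = {a..<n}"
    proof (intro equalityI subsetI)
      fix j assume "j \<in> {j. j < n \<and> i \<le> p ^ j}"
      then show "j \<in> {a..<n}" using that(3)[of j] by (cases "j < a") auto
    next
      fix j assume j: "j \<in> {a..<n}"
      then have "i \<le> p ^ a" using that(2) by simp
      also have "\<dots> \<le> p ^ j" using j by (intro pmono) simp
      finally show "j \<in> {j. j < n \<and> i \<le> p ^ j}" using j by simp
    qed
    then show ?thesis by (simp add: f_def)
  qed
  have lev: "\<exists>a\<le>n. (a < n \<longrightarrow> i \<le> p ^ a) \<and> (\<forall>b<a. p ^ b < i)" for i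
  proof -
    define a where "a = (LEAST a. a = n \<or> i \<le> p ^ a)"
    have "a = n \<or> i \<le> p ^ a" unfolding a_def by (rule LeastI[of _ n]) simp
    moreover have "a \<le> n" unfolding a_def by (rule Least_le) simp
    moreover have "p ^ b < i" if "b < a" for b
      using not_less_Least[of b "\<lambda>a. a = n \<or> i \<le> p ^ a"] that by (auto simp: a_def)
    ultimately show ?thesis by blast
  qed
  \<comment> \<open>The gap condition with \<open>m = p^j\<close> and \<open>k = p^(j+1) + 1\<close>
    makes the height drop strictly between consecutive powers of \<open>p\<close>.\<close>
  have claim: "h (Suc (p ^ j)) = 0 \<or> h (Suc (p ^ j)) + j + 1 \<le> n" for j
  proof (induction j)
    case 0
    have "h 2 \<le> h 1" by (rule mono) simp
    moreover have "h 1 = h 2 \<longrightarrow> h 1 = 0" using gap[of 0 2] by simp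
    ultimately show ?case using h1 by (cases "h 2 = h 1") (auto simp: numeral_2_eq_2)
  next
    case (Suc j)
    have "2 * p ^ j \<le> p * p ^ j" using p by (rule mult_le_mono1)
    moreover have "p ^ j \<ge> 1" using p by simp
    ultimately have k: "Suc (p ^ Suc j) \<ge> p ^ j + 2" unfolding power_Suc by linarith
    have "h (Suc (p ^ Suc j)) \<le> h (Suc (p ^ j))" by (rule mono) (use k p in simp)
    moreover have "h (Suc (p ^ j)) = h (Suc (p ^ Suc j)) \<longrightarrow> h (Suc (p ^ j)) = 0"
      using gap[OF k] by simp
    ultimately show ?case using Suc by (cases "h (Suc (p ^ j)) = h (Suc (p ^ Suc j))") auto
  qed
  have hf: "h i \<le> f i" if "i \<ge> 1" for i
  proof -
    obtain a where a: "a \<le> n" "a < n \<longrightarrow> i \<le> p ^ a" "\<forall>b<a. p ^ b < i" using lev by blast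
    have fi: "f i = n - a" using a by (intro fval) auto
    show ?thesis
    proof (cases a)
      case 0
      then show ?thesis using fi mono[OF that] h1 by simp
    next
      case (Suc b)
      then have "Suc (p ^ b) \<le> i" using a(3) by (simp add: Suc_le_eq)
      then have "h i \<le> h (Suc (p ^ b))" by (rule mono)
      then show ?thesis using claim[of b] fi Suc by auto
    qed
  qed
  \<comment> \<open>A common range for both sums, beyond which \<open>f\<close> and \<open>h\<close>
    vanish.\<close>
  define C where "C = max c (p ^ n)"
  have sumh: "(\<Sum>i\<in>{1..C}. h i) = (\<Sum>i\<in>{1..c}. h i)"
  proof (rule sum.mono_neutral_right)
    show "\<forall>i\<in>{1..C} - {1..c}. h i = 0"
    proof
      fix i assume "i \<in> {1..C} - {1..c}"
      then have "c \<le> i" by auto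
      then show "h i = 0" using mono[of c i] hc by simp
    qed
  qed (auto simp: C_def)
  have sumf: "(\<Sum>i\<in>{1..C}. f i) = (\<Sum>j<n. p ^ j)"
  proof -
    have "f i = (\<Sum>j<n. if i \<le> p ^ j then 1 else 0)" for i
    proof -
      have "f i = (\<Sum>j\<in>{j\<in>{..<n}. i \<le> p ^ j}. 1)" by (simp add: f_def)
      also have "\<dots> = (\<Sum>j<n. if i \<le> p ^ j then 1 else 0)" by (rule sum.inter_filter) simp
      finally show ?thesis .
    qed
    then have "(\<Sum>i\<in>{1..C}. f i) = (\<Sum>i\<in>{1..C}. \<Sum>j<n. if i \<le> p ^ j then 1 else 0)" by simp
    also have "\<dots> = (\<Sum>j<n. \<Sum>i\<in>{1..C}. if i \<le> p ^ j then 1 else 0)" by (rule sum.swap)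
    also have "\<dots> = (\<Sum>j<n. p ^ j)"
    proof (rule sum.cong)
      fix j assume "j \<in> {..<n}"
      then have "p ^ j \<le> C" using pmono[of j n] by (simp add: C_def)
      then have "{i\<in>{1..C}. i \<le> p ^ j} = {1..p ^ j}" by auto
      moreover have "(\<Sum>i\<in>{1..C}. if i \<le> p ^ j then 1 else 0) = (\<Sum>i\<in>{i\<in>{1..C}. i \<le> p ^ j}. 1 :: nat)"
        by (rule sum.inter_filter[symmetric]) simp
      ultimately show "(\<Sum>i\<in>{1..C}. if i \<le> p ^ j then 1 else 0) = p ^ j" by simp
    qed simp
    finally show ?thesis .
  qed
  have "(p - 1) * (\<Sum>i\<in>{1..C}. f i) + 1 = (p - 1) * (\<Sum>i\<in>{1..C}. h i) + p"
    using geometric_sum_nat[of p n] p sum by (simp only: sumf sumh)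
  then have "(p - 1) * (\<Sum>i\<in>{1..C}. f i) = (p - 1) * ((\<Sum>i\<in>{1..C}. h i) + 1)"
    using p unfolding distrib_left by linarith
  moreover have "p - 1 \<noteq> 0" using p by simp
  ultimately have "(\<Sum>i\<in>{1..C}. f i) = (\<Sum>i\<in>{1..C}. h i) + 1"
    unfolding mult_cancel1 by blast
  moreover have "(\<Sum>i\<in>{1..C}. f i - h i) = (\<Sum>i\<in>{1..C}. f i) - (\<Sum>i\<in>{1..C}. h i)"
    by (rule sum_subtractf_nat) (use hf in auto)
  ultimately have "(\<Sum>i\<in>{1..C}. f i - h i) = 1" by simp
  then obtain i0 where i0: "i0 \<in> {1..C}" "f i0 - h i0 = 1"
    and oth: "\<And>i. i \<in> {1..C} \<Longrightarrow> i0 \<noteq> i \<Longrightarrow> f i - h i = 0"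
    using sum_eq_1_iff[of "{1..C}" "\<lambda>i. f i - h i"] by blast
  have f0: "f i0 = h i0 + 1" using i0 by simp
  have ot: "h i = f i" if "1 \<le> i" "i \<le> C" "i \<noteq> i0" for i
    using oth[of i] hf[of i] that by simp
  have "f 1 = n" using fval[of 0 1] by simp
  then have i01: "i0 \<noteq> 1" using f0 h1 by auto
  obtain a where a: "a \<le> n" "a < n \<longrightarrow> i0 \<le> p ^ a" "\<forall>b<a. p ^ b < i0" using lev by blast
  have fi0: "f i0 = n - a" using a by (intro fval) auto
  have an: "a < n" using f0 fi0 by simp
  have C: "p ^ b \<le> C" if "b \<le> n" for b using pmono[OF that] by (simp add: C_def)
  \<comment> \<open>Otherwise \<open>f\<close> has the same value at \<open>i0 + 1\<close>, where
    \<open>h\<close> agrees with it, and \<open>h\<close> would increase.\<close>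
  have i0_eq: "i0 = p ^ a"
  proof (rule ccontr)
    assume "i0 \<noteq> p ^ a"
    then have lt: "Suc i0 \<le> p ^ a" using a an by simp
    have "f (Suc i0) = n - a" using a lt by (intro fval) (auto simp: less_SucI)
    moreover have "h (Suc i0) = f (Suc i0)" using lt C[of a] an by (intro ot) auto
    ultimately show False using anti[of i0] f0 fi0 by simp
  qed
  have a0: "a \<noteq> 0" using i0_eq i01 by (metis power_0)
  \<comment> \<open>Otherwise \<open>h\<close> takes the same nonzero value at \<open>p^a\<close>
    and at \<open>p^(a+1)\<close>, against the gap condition with
    \<open>m = p^a - 1\<close>.\<close>
  have alast: "a = n - 1"
  proof (rule ccontr)
    assume "a \<noteq> n - 1"
    then have a2: "Suc a < n" using an by simp
    define m where "m = p ^ a - 1"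
    have pa: "p ^ a \<ge> 2" using a0 pmono[of 1 a] p by simp
    have m: "Suc m = p ^ a" using pa by (simp add: m_def)
    have "2 * p ^ a \<le> p * p ^ a" using p by (rule mult_le_mono1)
    then have k1: "p ^ Suc a \<ge> m + 2" using pa m unfolding power_Suc by linarith
    have k2: "p ^ Suc a > p * m"
    proof -
      have "p * m < p * p ^ a" using m p by simp
      then show ?thesis by simp
    qed
    have "p ^ b < p ^ Suc a" if "b < Suc a" for b using p that by (intro power_strict_increasing) auto
    then have "f (p ^ Suc a) = n - Suc a" using a2 by (intro fval) auto
    moreover have "p ^ Suc a \<noteq> i0" unfolding i0_eq using p by (simp add: power_inject_exp)
    then have "h (p ^ Suc a) = f (p ^ Suc a)" using C[of "Suc a"] a2 p by (intro ot) auto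
    ultimately have "h (Suc m) = h (p ^ Suc a)" using f0 fi0 m i0_eq by simp
    from gap[OF k1 k2 this] show False using f0 fi0 m i0_eq a2 by simp
  qed
  show "n \<ge> 2" using a0 an by simp
  have e: "i0 = p ^ (n - 1)" using i0_eq alast by simp
  show "h (p ^ (n - 1)) = 0" using f0 fi0 e alast an by simp
  show "h i = n - a" if "i \<ge> 1" "a < n" "i \<le> p ^ a" "\<And>b. b < a \<Longrightarrow> p ^ b < i" "i \<noteq> p ^ (n - 1)" for i a
  proof -
    have "f i = n - a" using that by (intro fval) auto
    moreover have "i \<le> C" using that(3) C[of a] that(2) by simp
    ultimately show ?thesis using ot[of i] that e by simp
  qed
qed


subsection \<open>The lower central series\<close>

context group begin

lemma commutator_subgroup_eq:
  "commutator_subgroup G A B = generate G {gcomm G x y | x y. x \<in> A \<and> y \<in> B}"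
  unfolding commutator_subgroup_def gcomm_def by (rule arg_cong[where f = "generate G"]) auto

lemma lower_central_Suc:
  "n \<ge> 1 \<Longrightarrow> lower_central G (Suc n) = generate G {gcomm G x y | x y. x \<in> lower_central G n \<and> y \<in> carrier G}"
  by (cases n) (simp_all add: commutator_subgroup_eq)

lemma lower_central_subset_carrier: "lower_central G i \<subseteq> carrier G"
proof (induction i)
  case (Suc n)
  show ?case
  proof (cases "n \<ge> 1")
    case True
    show ?thesis unfolding lower_central_Suc[OF True]
      by (rule generate_incl) (use Suc in auto)
  qed (cases n, auto)
qed simp

lemma lower_central_gens: "{gcomm G x y | x y. x \<in> lower_central G n \<and> y \<in> carrier G} \<subseteq> carrier G"
  using lower_central_subset_carrier[of n] by auto

lemma lower_central_subgroup: "subgroup (lower_central G i) G"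
proof (cases "i \<ge> 2")
  case True
  then obtain n where n: "i = Suc n" "n \<ge> 1" by (cases i) auto
  show ?thesis unfolding n(1) lower_central_Suc[OF n(2)]
    by (rule generate_is_subgroup[OF lower_central_gens])
next
  case False
  then have "i = 0 \<or> i = Suc 0" by auto
  then show ?thesis using subgroup_self by auto
qed

lemma lower_central_gcomm:
  "x \<in> lower_central G n \<Longrightarrow> g \<in> carrier G \<Longrightarrow> n \<ge> 1 \<Longrightarrow> gcomm G x g \<in> lower_central G (Suc n)"
  by (simp only: lower_central_Suc) (rule generate.incl, blast)

lemma lower_central_least:
  assumes "n \<ge> 1" "subgroup L G" "\<And>x g. x \<in> lower_central G n \<Longrightarrow> g \<in> carrier G \<Longrightarrow> gcomm G x g \<in> L"
  shows "lower_central G (Suc n) \<subseteq> L"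
  unfolding lower_central_Suc[OF assms(1)] by (rule generate_subgroup_incl[OF _ assms(2)]) (use assms(3) in auto)

lemma lower_central_antimono_Suc: "lower_central G (Suc n) \<subseteq> lower_central G n"
proof (induction n)
  case (Suc n)
  show ?case
  proof (cases "n \<ge> 1")
    case True
    show ?thesis
      by (rule lower_central_least[OF _ lower_central_subgroup]) (use True Suc lower_central_gcomm in auto)
  next
    case False
    then show ?thesis using lower_central_subset_carrier[of "Suc (Suc n)"] by (cases n) auto
  qed
qed (use lower_central_subset_carrier in auto)

lemma lower_central_antimono: "i \<le> j \<Longrightarrow> lower_central G j \<subseteq> lower_central G i"
  by (induction rule: dec_induct) (use lower_central_antimono_Suc in auto)

lemma lower_central_one: "\<one> \<in> lower_central G i"
  by (rule subgroup.one_closed[OF lower_central_subgroup])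

lemma nilpotency_class_eqI:
  assumes "lower_central G (Suc (Suc c)) = {\<one>}" "lower_central G (Suc c) \<noteq> {\<one>}"
  shows "nilpotency_class G = Suc c"
  unfolding nilpotency_class_def
proof (rule Least_equality)
  show "lower_central G (Suc (Suc c)) = {\<one>}" by (rule assms(1))
  fix y assume y: "lower_central G (Suc y) = {\<one>}"
  show "Suc c \<le> y"
  proof (rule ccontr)
    assume "\<not> Suc c \<le> y"
    then have "lower_central G (Suc c) \<subseteq> {\<one>}" using lower_central_antimono[of "Suc y" "Suc c"] y by simp
    then show False using assms(2) lower_central_one[of "Suc c"] by blast
  qed
qed

lemma nilpotency_classD:
  assumes "lower_central G (Suc d) = {\<one>}" "nilpotency_class G = Suc c"
  shows "lower_central G (Suc (Suc c)) = {\<one>}" "lower_central G (Suc c) \<noteq> {\<one>}"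
proof -
  have L: "(LEAST c. lower_central G (Suc c) = {\<one>}) = Suc c" using assms(2) by (simp only: nilpotency_class_def)
  show "lower_central G (Suc (Suc c)) = {\<one>}"
    using LeastI[of "\<lambda>c. lower_central G (Suc c) = {\<one>}", OF assms(1)] unfolding L .
  show "lower_central G (Suc c) \<noteq> {\<one>}"
    by (rule not_less_Least[of c "\<lambda>c. lower_central G (Suc c) = {\<one>}"]) (simp only: L lessI)
qed

lemma centralizer_subgroup:
  assumes n: "n \<in> carrier G" shows "subgroup {g \<in> carrier G. n \<otimes> g = g \<otimes> n} G"
proof (rule subgroupI)
  show "{g \<in> carrier G. n \<otimes> g = g \<otimes> n} \<noteq> {}" using n by auto
next
  fix a assume "a \<in> {g \<in> carrier G. n \<otimes> g = g \<otimes> n}"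
  then have a: "a \<in> carrier G" "n \<otimes> a = a \<otimes> n" by auto
  have "inv a \<otimes> (a \<otimes> n) \<otimes> inv a = n \<otimes> inv a" "inv a \<otimes> (n \<otimes> a) \<otimes> inv a = inv a \<otimes> n"
    using a(1) n by (simp_all add: group_nf)
  then show "inv a \<in> {g \<in> carrier G. n \<otimes> g = g \<otimes> n}" using a by simp
next
  fix a b assume "a \<in> {g \<in> carrier G. n \<otimes> g = g \<otimes> n}" "b \<in> {g \<in> carrier G. n \<otimes> g = g \<otimes> n}"
  then have a: "a \<in> carrier G" "n \<otimes> a = a \<otimes> n" and b: "b \<in> carrier G" "n \<otimes> b = b \<otimes> n" by auto
  have "n \<otimes> (a \<otimes> b) = a \<otimes> n \<otimes> b" using a b n by (simp add: m_assoc[symmetric])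
  also have "\<dots> = a \<otimes> b \<otimes> n" using a b n by (simp add: m_assoc)
  finally show "a \<otimes> b \<in> {g \<in> carrier G. n \<otimes> g = g \<otimes> n}" using a b by simp
qed auto

lemma gcomm_central_left:
  assumes "a \<in> carrier G" "g \<in> carrier G" "k \<in> carrier G" "\<And>h. h \<in> carrier G \<Longrightarrow> a \<otimes> h = h \<otimes> a"
  shows "gcomm G (a \<otimes> g) k = gcomm G g k"
proof -
  have "gcomm G a k = \<one>" using assms gcomm_eq_one_iff by simp
  moreover have "a \<otimes> gcomm G g k \<otimes> inv a = gcomm G g k"
    using assms(4)[of "gcomm G g k"] assms(1-3) by (simp add: m_assoc)
  ultimately show ?thesis using assms(1-3) by (simp add: gcomm_mult_left)
qed

text \<open>If all \<open>(n, g)\<close> are central, then \<open>g \<mapsto> (n, g)\<close> is a homomorphism to an abelian group.\<close>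

lemma commutes_derived:
  assumes n: "n \<in> carrier G"
    and c: "\<And>g h. g \<in> carrier G \<Longrightarrow> h \<in> carrier G \<Longrightarrow> gcomm G n g \<otimes> h = h \<otimes> gcomm G n g"
    and y: "y \<in> derived G (carrier G)"
  shows "n \<otimes> y = y \<otimes> n"
proof -
  have "gcomm G g h \<in> {g \<in> carrier G. n \<otimes> g = g \<otimes> n}" if g: "g \<in> carrier G" and h: "h \<in> carrier G" for g h
  proof -
    let ?a = "gcomm G n g" and ?b = "gcomm G n h"
    have cl: "?a \<in> carrier G" "?b \<in> carrier G" using n g h by auto
    have cj: "n \<otimes> g \<otimes> inv n = ?a \<otimes> g" "n \<otimes> h \<otimes> inv n = ?b \<otimes> h"
      using n g h by (simp_all add: gcomm_conj)
    have "n \<otimes> gcomm G g h \<otimes> inv n = gcomm G (n \<otimes> g \<otimes> inv n) (n \<otimes> h \<otimes> inv n)"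
      using n g h by (simp add: gcomm_def group_nf)
    also have "\<dots> = gcomm G g (?b \<otimes> h)"
      unfolding cj by (rule gcomm_central_left) (use cl g h c in auto)
    also have "\<dots> = inv (gcomm G (?b \<otimes> h) g)" using cl g h by (simp add: gcomm_inv)
    also have "gcomm G (?b \<otimes> h) g = gcomm G h g"
      by (rule gcomm_central_left) (use cl g h c in auto)
    also have "inv (gcomm G h g) = gcomm G g h" using g h by (simp add: gcomm_inv)
    finally have "n \<otimes> gcomm G g h \<otimes> inv n \<otimes> n = gcomm G g h \<otimes> n" by simp
    then show ?thesis using n g h by (simp add: m_assoc)
  qed
  then have "derived_set G (carrier G) \<subseteq> {g \<in> carrier G. n \<otimes> g = g \<otimes> n}" by (auto simp: gcomm_def)
  then have "derived G (carrier G) \<subseteq> {g \<in> carrier G. n \<otimes> g = g \<otimes> n}"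
    unfolding derived_def by (rule generate_subgroup_incl[OF _ centralizer_subgroup[OF n]])
  then show ?thesis using y by blast
qed

lemma int_pow_mod:
  assumes "x \<in> carrier G" "x [^] m = \<one>" shows "x [^] (k mod int m) = x [^] (k::int)"
proof -
  have "x [^] k = x [^] (int m * (k div int m) + k mod int m)" by simp
  also have "\<dots> = (x [^] int m) [^] (k div int m) \<otimes> x [^] (k mod int m)"
    using assms(1) by (simp only: int_pow_mult int_pow_pow)
  finally show ?thesis using assms by (simp add: int_pow_int)
qed

text \<open>The map \<open>(a, b) \<mapsto> x^a y^b\<close> respects addition because exponents
  count modulo \<open>m\<close> and \<open>n\<close>. Independence makes it injective, and the order
  of \<open>A\<close> makes it onto.\<close>

lemma iso_integer_mod_groups:
  assumes A: "subgroup A G" "finite A" "card A = m * n" and mn: "m > 0" "n > 0"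
    and comm: "\<And>a b. a \<in> A \<Longrightarrow> b \<in> A \<Longrightarrow> a \<otimes> b = b \<otimes> a"
    and x: "x \<in> A" "x [^] m = \<one>" and y: "y \<in> A" "y [^] n = \<one>"
    and indep: "\<And>a b. a < m \<Longrightarrow> b < n \<Longrightarrow> x [^] a \<otimes> y [^] b = \<one> \<Longrightarrow> a = 0 \<and> b = 0"
  shows "G\<lparr>carrier := A\<rparr> \<cong> integer_mod_group m \<times>\<times> integer_mod_group n"
proof -
  let ?Z = "integer_mod_group m \<times>\<times> integer_mod_group n"
  have xG: "x \<in> carrier G" and yG: "y \<in> carrier G"
    using subgroup.mem_carrier[OF A(1)] x(1) y(1) by auto
  have xA: "x [^] (k::int) \<in> A" and yA: "y [^] (k::int) \<in> A" for k
    using subgroup_int_pow_closed[OF A(1)] x(1) y(1) by auto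
  have xyA: "x [^] (k::int) \<otimes> y [^] (l::int) \<in> A" for k l by (rule subgroup.m_closed[OF A(1) xA yA])
  define \<phi> where "\<phi> = (\<lambda>(a::int, b::int). x [^] a \<otimes> y [^] b)"
  have mult: "x [^] (a + a') \<otimes> y [^] (b + b') = (x [^] a \<otimes> y [^] b) \<otimes> (x [^] a' \<otimes> y [^] b')" for a a' b b' :: int
  proof -
    have "(x [^] a \<otimes> y [^] b) \<otimes> (x [^] a' \<otimes> y [^] b') = x [^] a \<otimes> (y [^] b \<otimes> x [^] a') \<otimes> y [^] b'"
      using xG yG by (simp add: m_assoc)
    also have "y [^] b \<otimes> x [^] a' = x [^] a' \<otimes> y [^] b" by (rule comm[OF yA xA])
    finally show ?thesis using xG yG by (simp add: m_assoc int_pow_mult)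
  qed
  have cZ: "carrier ?Z = {0..<int m} \<times> {0..<int n}" using mn by (simp add: carrier_integer_mod_group)
  have hom: "\<phi> \<in> hom ?Z (G\<lparr>carrier := A\<rparr>)"
  proof (rule homI)
    fix u assume "u \<in> carrier ?Z"
    then show "\<phi> u \<in> carrier (G\<lparr>carrier := A\<rparr>)" using xyA by (auto simp: \<phi>_def)
  next
    fix u v
    show "\<phi> (u \<otimes>\<^bsub>?Z\<^esub> v) = \<phi> u \<otimes>\<^bsub>G\<lparr>carrier := A\<rparr>\<^esub> \<phi> v"
      by (cases u; cases v)
        (simp add: \<phi>_def int_pow_mod[OF xG x(2)] int_pow_mod[OF yG y(2)] mult)
  qed
  have inj: "inj_on \<phi> (carrier ?Z)"
  proof (rule inj_onI)
    fix u v assume u: "u \<in> carrier ?Z" and v: "v \<in> carrier ?Z" and eq: "\<phi> u = \<phi> v"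
    obtain a b a' b' where uv: "u = (a, b)" "v = (a', b')" by fastforce
    define d e where "d = (a - a') mod int m" and "e = (b - b') mod int n"
    have eq': "x [^] a \<otimes> y [^] b = x [^] a' \<otimes> y [^] b'" using eq by (simp add: uv \<phi>_def)
    have "x [^] (a - a') \<otimes> y [^] (b - b') = (x [^] a \<otimes> y [^] b) \<otimes> (x [^] (- a') \<otimes> y [^] (- b'))"
      using mult[of a "- a'" b "- b'"] by simp
    also have "\<dots> = x [^] (a' + - a') \<otimes> y [^] (b' + - b')" unfolding eq' by (rule mult[symmetric])
    also have "\<dots> = \<one>" by simp
    finally have "x [^] d \<otimes> y [^] e = \<one>"
      using int_pow_mod[OF xG x(2)] int_pow_mod[OF yG y(2)] by (simp add: d_def e_def)
    moreover have de: "d = int (nat d)" "e = int (nat e)" and "nat d < m" "nat e < n"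
      using mn by (simp_all add: d_def e_def nat_less_iff)
    ultimately have "nat d = 0 \<and> nat e = 0" using indep[of "nat d" "nat e"] by (metis int_pow_int)
    then have "d = 0" "e = 0" using de by simp_all
    then have "int m dvd a - a'" "int n dvd b - b'" by (simp_all add: d_def e_def dvd_eq_mod_eq_0)
    moreover have "\<bar>a - a'\<bar> < int m" "\<bar>b - b'\<bar> < int n" using u v unfolding cZ uv by auto
    ultimately have "a - a' = 0" "b - b' = 0" using dvd_imp_le_int[of "a - a'" "int m"] dvd_imp_le_int[of "b - b'" "int n"] by auto
    then show "u = v" by (simp add: uv)
  qed
  have "card (\<phi> ` carrier ?Z) = m * n"
    using card_image[OF inj] unfolding cZ by (simp add: card_cartesian_product)
  moreover have "\<phi> ` carrier ?Z \<subseteq> A" using xyA by (auto simp: \<phi>_def)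
  ultimately have "\<phi> ` carrier ?Z = A" using A by (intro card_subset_eq) auto
  then have "\<phi> \<in> iso ?Z (G\<lparr>carrier := A\<rparr>)" using hom inj by (simp add: iso_def bij_betw_def)
  then have "?Z \<cong> G\<lparr>carrier := A\<rparr>" by (rule is_isoI)
  moreover have "group ?Z" by (intro DirProd_group) simp_all
  ultimately show ?thesis by (rule group.iso_sym[rotated])
qed

end


subsection \<open>Almost maximal index\<close>

context nilpotent_group_algebra begin

abbreviation D where "D \<equiv> derived G (carrier G)"

lemma D_comm_gcomm:
  assumes "\<And>x y. x \<in> D \<Longrightarrow> y \<in> D \<Longrightarrow> x \<otimes>\<^bsub>G\<^esub> y = y \<otimes>\<^bsub>G\<^esub> x" "x \<in> D" "y \<in> D"
  shows "gcomm G x y = \<one>\<^bsub>G\<^esub>"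
  using assms(1)[OF assms(2,3)] G.gcomm_eq_one_iff[OF derived_G[OF assms(2)] derived_G[OF assms(3)]] by simp

text \<open>The hypotheses say that \<open>G', A, B, 1\<close> is an admissible series below
  \<open>DH\<close>, so by \<open>DH_minimal\<close> it equals \<open>DH\<close>. The powers of
  \<open>G'\<close> must lie in the term of index \<open>p\<close>: this is \<open>A\<close> for
  \<open>p = 2\<close>, whereas for larger \<open>p\<close> they are required to be trivial.\<close>

lemma chain_series:
  assumes A: "subgroup A G" "A \<subseteq> DH 2" and B: "subgroup B G" "B \<subseteq> DH 3" "B \<subseteq> A"
    and comm: "\<And>x y. x \<in> D \<Longrightarrow> y \<in> D \<Longrightarrow> x \<otimes>\<^bsub>G\<^esub> y = y \<otimes>\<^bsub>G\<^esub> x"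
    and DA: "\<And>x g. x \<in> D \<Longrightarrow> g \<in> carrier G \<Longrightarrow> gcomm G x g \<in> A"
    and AB: "\<And>x g. x \<in> A \<Longrightarrow> g \<in> carrier G \<Longrightarrow> gcomm G x g \<in> B"
    and B1: "\<And>x g. x \<in> B \<Longrightarrow> g \<in> carrier G \<Longrightarrow> gcomm G x g = \<one>\<^bsub>G\<^esub>"
    and pD: "\<And>x. x \<in> D \<Longrightarrow> x [^]\<^bsub>G\<^esub> p \<in> A" "\<And>x. x \<in> D \<Longrightarrow> p \<noteq> 2 \<Longrightarrow> x [^]\<^bsub>G\<^esub> p = \<one>\<^bsub>G\<^esub>"
    and pA: "\<And>x. x \<in> A \<Longrightarrow> x [^]\<^bsub>G\<^esub> p = \<one>\<^bsub>G\<^esub>"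
  shows "DH 2 = A" "DH 3 = B" "DH 4 = {\<one>\<^bsub>G\<^esub>}"
proof -
  define H' where "H' i = (if i \<le> 1 then D else if i = 2 then A else if i = 3 then B else {\<one>\<^bsub>G\<^esub>})" for i :: nat
  have one: "\<one>\<^bsub>G\<^esub> \<in> D" "\<one>\<^bsub>G\<^esub> \<in> A" "\<one>\<^bsub>G\<^esub> \<in> B"
    using subgroup.one_closed derived_subgroup A(1) B(1) by blast+
  have AD: "A \<subseteq> D" using A(2) DH.H_D by blast
  have sub: "subgroup (H' i) G" for i
    using derived_subgroup A(1) B(1) G.triv_subgroup by (simp add: H'_def)
  have H'D: "H' i \<subseteq> D" for i using one AD B(3) by (auto simp: H'_def)
  have H'A: "H' i \<subseteq> A" if "i \<ge> 2" for i using that one B(3) by (auto simp: H'_def)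
  have one': "\<one>\<^bsub>G\<^esub> \<in> H' i" for i by (rule subgroup.one_closed[OF sub])
  have cs: "central_series K G p H'"
  proof (intro central_series.intro central_series_axioms.intro modular_group_algebra_axioms)
    show "H' 0 = D" "H' 1 = D" by (simp_all add: H'_def)
    show "H' (Suc i) \<subseteq> H' i" for i using one AD B(3) by (auto simp: H'_def)
    show "gcomm G x g \<in> H' (Suc i)" if x: "x \<in> H' i" and g: "g \<in> carrier G" for i x g
    proof -
      consider "i = 0" | "i = 1" | "i = 2" | "i = 3" | "i \<ge> 4" by linarith
      then show ?thesis
      proof cases
        case 1
        then have "gcomm G x g \<in> D" using x g derived_G gcomm_derived by (simp add: H'_def)
        then show ?thesis using 1 by (simp add: H'_def)
      qed (use x g DA AB B1 in \<open>auto simp: H'_def G.gcomm_eq_one_iff\<close>)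
    qed
    show "gcomm G x y \<in> H' (i + j)" if "x \<in> H' i" "y \<in> H' j" for i j x y
      using D_comm_gcomm[OF comm] that H'D one' by (metis subsetD)
    show "x [^]\<^bsub>G\<^esub> p \<in> H' (p * i)" if x: "x \<in> H' i" for i x
    proof -
      consider "i = 0" | "i = 1" | "i \<ge> 2" by linarith
      then show ?thesis
      proof cases
        case 1
        then show ?thesis using x pD(1) AD by (auto simp: H'_def)
      next
        case 2
        then have "x \<in> D" using x by (simp add: H'_def)
        then show ?thesis using 2 pD one' by (cases "p = 2") (auto simp: H'_def)
      next
        case 3
        then show ?thesis using x pA H'A[OF 3] one' by (metis subsetD)
      qed
    qed
    show "\<exists>c. H' c = {\<one>\<^bsub>G\<^esub>}" by (rule exI[of _ 4]) (simp add: H'_def)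
  qed (rule sub, rule finite_D)
  have "H' i \<subseteq> DH i" for i
  proof -
    consider "i = 0" | "i = 1" | "i = 2" | "i = 3" | "i \<ge> 4" by linarith
    then show ?thesis
    proof cases
      case 5
      then show ?thesis using subgroup.one_closed[OF DH.H_subgroup] by (simp add: H'_def)
    qed (use A B DH.H_0 DH.H_1 in \<open>simp_all add: H'_def\<close>)
  qed
  from DH_minimal[OF cs this] have "H' i = DH i" for i .
  from this[of 2] this[of 3] this[of 4] show "DH 2 = A" "DH 3 = B" "DH 4 = {\<one>\<^bsub>G\<^esub>}"
    by (simp_all add: H'_def)
qed

text \<open>The extremal heights make \<open>DH\<close> constant of order \<open>p\<close> for
  \<open>v < i \<le> w\<close>, with \<open>v = p^(n-2)\<close> and \<open>w = p^(n-1) - 1\<close>,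
  and trivial afterwards. If this stretch has at least two indices, the series can be made trivial
  already at \<open>w\<close>, against minimality. So \<open>p v \<le> v + 2\<close>, which leaves
  three pairs \<open>(p, n)\<close>.\<close>

lemma almost_maximal_shape:
  assumes idx: "upper_Lie_nilpotency_index KG + p = card D + 2"
  shows "(p = 2 \<and> card D = 4 \<and> DH 2 = {\<one>\<^bsub>G\<^esub>}) \<or>
    (p = 3 \<and> card D = 9 \<and> card (DH 2) = 3 \<and> DH 3 = {\<one>\<^bsub>G\<^esub>}) \<or>
    (p = 2 \<and> card D = 8 \<and> card (DH 2) = 4 \<and> card (DH 3) = 2 \<and> DH 4 = {\<one>\<^bsub>G\<^esub>})"
proof -
  have p2: "p \<ge> 2" by (rule prime_ge_2_nat[OF prime_p])
  obtain c where c: "DH c = {\<one>\<^bsub>G\<^esub>}" using DH.H_end by blast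
  define n where "n = DH.ht 1"
  let ?h = DH.ht
  have cardD: "card D = p ^ n" using DH.card_H[of 1] DH.H_1 by (simp add: n_def)
  have le: "card (DH j) \<le> card (DH i)" if "i \<le> j" for i j
    by (rule card_mono[OF DH.H_finite DH.H_antimono[OF that]])
  have anti: "?h (Suc i) \<le> ?h i" for i
    using le[of i "Suc i"] p2 by (simp add: DH.card_H)
  have triv: "DH i = {\<one>\<^bsub>G\<^esub>}" if "?h i = 0" for i
  proof -
    have "card (DH i) = 1" using DH.card_H[of i] that by simp
    then obtain a where "DH i = {a}" by (auto simp: card_1_singleton_iff)
    then show ?thesis using subgroup.one_closed[OF DH.H_subgroup, of i] by simp
  qed
  have triv': "?h i = 0" if "DH i = {\<one>\<^bsub>G\<^esub>}" for i by (rule DH.ht_eq) (simp add: that)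
  have eqH: "DH i = DH j" if "i \<le> j" "?h i = ?h j" for i j
  proof -
    have "DH j = DH i"
      by (rule card_subset_eq[OF DH.H_finite DH.H_antimono[OF that(1)]]) (simp add: DH.card_H that(2))
    then show ?thesis by simp
  qed
  have gap: "?h (Suc m) = 0" if "k \<ge> m + 2" "k > p * m" "?h (Suc m) = ?h k" for m k
    by (rule triv'[OF DH_gap[OF that(1,2) eqH]]) (use that in auto)
  have "(p - 1) * (\<Sum>j\<in>{1..c}. ?h j) + p = p ^ n"
    using idx DH_index[OF c] cardD by simp
  note ext = extremal_heights[of p ?h n c, OF p2 n_def[symmetric] anti triv'[OF c] _ this]
  have n2: "n \<ge> 2" by (rule ext(1)) (erule (2) gap)
  have ext2: "?h i = n - a"
    if "i \<ge> 1" "a < n" "i \<le> p ^ a" "\<And>b. b < a \<Longrightarrow> p ^ b < i" "i \<noteq> p ^ (n - 1)" for i a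
    by (rule ext(2)[OF _ that]) (erule (2) gap)
  have ext3: "?h (p ^ (n - 1)) = 0" by (rule ext(3)) (erule (2) gap)
  define v w where "v = p ^ (n - 2)" and "w = p * v - 1"
  have pv: "p ^ (n - 1) = p * v"
  proof -
    have "n - 1 = Suc (n - 2)" using n2 by simp
    then show ?thesis by (simp only: v_def power_Suc)
  qed
  have v1: "v \<ge> 1" using p2 by (simp add: v_def)
  have pv2: "2 * v \<le> p * v" by (rule mult_le_mono1[OF p2])
  then have w1: "Suc w = p * v" "w \<ge> v" using v1 unfolding w_def by linarith+
  have hSw: "DH (Suc w) = {\<one>\<^bsub>G\<^esub>}" using triv ext3 pv w1 by simp
  have pow_lt: "p ^ a < p ^ b" if "a < b" for a b using p2 that by (intro power_strict_increasing) auto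
  have hw: "?h i = 1" if i: "v < i" "i \<le> w" for i
  proof -
    have "?h i = n - (n - 1)"
    proof (rule ext2)
      show "p ^ b < i" if "b < n - 1" for b
      proof -
        have "p ^ b \<le> p ^ (n - 2)" using p2 that by (intro power_increasing) auto
        then show ?thesis using i(1) by (simp add: v_def)
      qed
    qed (use i n2 w1 pv in auto)
    then show ?thesis using n2 by simp
  qed
  have "w \<le> v + 1"
  proof (rule ccontr)
    assume "\<not> w \<le> v + 1"
    then have wv: "w \<ge> v + 2" by simp
    define H' where "H' i = (if i < w then DH i else {\<one>\<^bsub>G\<^esub>})" for i
    have H'DH: "H' i \<subseteq> DH i" for i using subgroup.one_closed[OF DH.H_subgroup] by (auto simp: H'_def)
    have one: "\<one>\<^bsub>G\<^esub> \<in> H' i" for i using subgroup.one_closed[OF DH.H_subgroup] by (auto simp: H'_def)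
    have H'G: "x \<in> carrier G" if "x \<in> H' i" for x i using that H'DH DH.H_carrier by blast
    have cen: "gcomm G x g = \<one>\<^bsub>G\<^esub>" if x: "x \<in> H' i" and i: "v < i" and g: "g \<in> carrier G" for i x g
    proof (cases "i < w")
      case True
      have "DH i = DH w" by (rule eqH) (use True i hw[of i] hw[of w] in auto)
      then have "x \<in> DH w" using x H'DH by blast
      from DH.H_central[OF this g] show ?thesis using hSw by simp
    next
      case False
      then show ?thesis using x g by (simp add: H'_def G.gcomm_eq_one_iff)
    qed
    have cen': "gcomm G g x = \<one>\<^bsub>G\<^esub>" if x: "x \<in> H' i" and i: "v < i" and g: "g \<in> carrier G" for i x g
      using cen[OF x i g] H'G[OF x] g by (simp add: G.gcomm_eq_one_iff)
    have big: "DH i = {\<one>\<^bsub>G\<^esub>}" if "i \<ge> Suc w" for i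
      using DH.H_antimono[OF that] hSw subgroup.one_closed[OF DH.H_subgroup, of i] by blast
    have mem: "g \<in> H' k" if "g \<in> DH k" "k \<ge> w \<Longrightarrow> g = \<one>\<^bsub>G\<^esub>" for g k
      using that by (auto simp: H'_def)
    have "central_series K G p H'"
    proof (intro central_series.intro central_series_axioms.intro modular_group_algebra_axioms)
      show "subgroup (H' i) G" for i
        using DH.H_subgroup G.triv_subgroup by (simp add: H'_def)
      show "H' 0 = D" "H' 1 = D" using wv DH.H_0 DH.H_1 by (simp_all add: H'_def)
      show "H' (Suc i) \<subseteq> H' i" for i
        using DH.H_Suc[of i] subgroup.one_closed[OF DH.H_subgroup, of i] by (auto simp: H'_def)
      show "gcomm G x g \<in> H' (Suc i)" if x: "x \<in> H' i" and g: "g \<in> carrier G" for i x g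
      proof (rule mem)
        show "gcomm G x g \<in> DH (Suc i)" using x g H'DH by (intro DH.H_central) auto
        assume "w \<le> Suc i"
        then have "v < i" using wv by simp
        then show "gcomm G x g = \<one>\<^bsub>G\<^esub>" using cen[OF x _ g] by simp
      qed
      show "gcomm G x y \<in> H' (i + j)" if x: "x \<in> H' i" and y: "y \<in> H' j" for i j x y
      proof (rule mem)
        have xy: "x \<in> DH i" "y \<in> DH j" using x y H'DH by auto
        show "gcomm G x y \<in> DH (i + j)" by (rule DH.H_comm[OF xy])
        assume ij: "w \<le> i + j"
        show "gcomm G x y = \<one>\<^bsub>G\<^esub>"
        proof (cases "v < i \<or> v < j")
          case True
          then show ?thesis using cen[OF x _ H'G[OF y]] cen'[OF y _ H'G[OF x]] by blast
        next
          case False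
          then have v: "i \<le> v" "j \<le> v" by auto
          show ?thesis
          proof (cases "i + j \<ge> Suc w")
            case True
            then show ?thesis using DH.H_comm[OF xy] big[OF True] by simp
          next
            case False
            \<comment> \<open>The only commutators not trivial for reasons of depth. Here
              \<open>i, j \<le> v\<close> and \<open>i + j = p v - 1\<close> force
              \<open>p = 2\<close> and \<open>i, j \<ge> v - 1\<close>. Since \<open>DH\<close> has
              equal terms at \<open>v - 1\<close> and \<open>v\<close>, the commutator gains the
              missing unit of depth.\<close>
            then have ijw: "i + j = w" using ij by simp
            have peq: "p = 2"
            proof (rule ccontr)
              assume "p \<noteq> 2"
              then have "3 * v \<le> p * v" using p2 by (intro mult_le_mono1) simp
              then show False using ijw v w1 wv by linarith
            qed
            have v3: "v \<ge> 3" using wv w1(1) unfolding peq by linarith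
            have "n \<ge> 4"
            proof (rule ccontr)
              assume "\<not> n \<ge> 4"
              then have "n - 2 \<le> 1" by simp
              then have "v \<le> 2 ^ 1" unfolding v_def peq by (intro power_increasing) auto
              then show False using v3 by simp
            qed
            then have n2': "n - 2 = Suc (n - 3)" "n - 2 < n" by auto
            have vv: "v = 2 * 2 ^ (n - 3)" unfolding v_def peq n2'(1) by simp
            have h2: "?h k = n - (n - 2)" if k: "v - 1 \<le> k" "k \<le> v" for k
            proof (rule ext2)
              have lt: "2 ^ (n - 3) < k" using k v3 vv by linarith
              show "p ^ b < k" if "b < n - 2" for b
              proof -
                have "(2::nat) ^ b \<le> 2 ^ (n - 3)" using that by (intro power_increasing) auto
                then show ?thesis unfolding peq using lt by (rule le_less_trans)
              qed
              show "k \<noteq> p ^ (n - 1)" using k pv peq v1 by simp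
              show "k \<ge> 1" using k v3 by simp
              show "k \<le> p ^ (n - 2)" using k by (simp add: v_def)
            qed (rule n2'(2))
            have "DH (v - 1) = DH v" by (rule eqH) (use h2[of v] h2[of "v - 1"] in simp_all)
            moreover have "v - 1 \<le> i" "v - 1 \<le> j" using ijw v w1(1) unfolding peq by linarith+
            ultimately have "x \<in> DH v" "y \<in> DH v" using DH.H_mono xy by blast+
            from DH.H_comm[OF this] show ?thesis using hSw w1(1) peq by (simp add: mult_2)
          qed
        qed
      qed
      show "x [^]\<^bsub>G\<^esub> p \<in> H' (p * i)" if x: "x \<in> H' i" for i x
      proof (rule mem)
        have xi: "x \<in> DH i" using x H'DH by auto
        show "x [^]\<^bsub>G\<^esub> p \<in> DH (p * i)" by (rule DH.H_pow[OF xi])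
        assume "w \<le> p * i"
        \<comment> \<open>As \<open>w = p v - 1\<close> is not a multiple of \<open>p\<close>,
          reaching \<open>w\<close> means reaching \<open>p v\<close>, where the series is
          trivial.\<close>
        have "v \<le> i"
        proof (rule ccontr)
          assume "\<not> v \<le> i"
          then have "p * Suc i \<le> p * v" by (intro mult_le_mono2) simp
          then show False using \<open>w \<le> p * i\<close> w1(1) p2 by simp
        qed
        then have "x \<in> DH v" using DH.H_mono[OF xi] by simp
        from DH.H_pow[OF this] show "x [^]\<^bsub>G\<^esub> p = \<one>\<^bsub>G\<^esub>" using hSw w1(1) by simp
      qed
      show "\<exists>c. H' c = {\<one>\<^bsub>G\<^esub>}" by (rule exI[of _ w]) (simp add: H'_def)
    qed (rule finite_D)
    from DH_minimal[OF this H'DH, of w] have "DH w = {\<one>\<^bsub>G\<^esub>}" by (simp add: H'_def)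
    then show False using triv'[of w] hw[of w] wv by simp
  qed
  then have small: "p * v \<le> v + 2" using w1(1) by simp
  consider "n = 2" "p = 2" | "n = 2" "p = 3" | "n = 3" "p = 2"
  proof (cases "n = 2")
    case True
    then have "p \<le> 3" using small by (simp add: v_def)
    then show ?thesis using that(1,2) True p2 by linarith
  next
    case False
    then have n3: "n - 2 \<ge> 1" using n2 by simp
    have "p ^ 1 \<le> v" unfolding v_def using p2 n3 by (intro power_increasing) auto
    then have vp: "p \<le> v" by simp
    have "p = 2"
    proof (rule ccontr)
      assume "p \<noteq> 2"
      then have "3 * v \<le> p * v" using p2 by (intro mult_le_mono1) simp
      then show False using small vp p2 by linarith
    qed
    moreover have "n = 3"
    proof (rule ccontr)
      assume "n \<noteq> 3"
      then have "(2::nat) ^ 2 \<le> 2 ^ (n - 2)" using n3 by (intro power_increasing) auto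
      then show False using small \<open>p = 2\<close> by (simp add: v_def)
    qed
    ultimately show ?thesis using that(3) by blast
  qed
  then show ?thesis
  proof cases
    case 1
    then have w2: "Suc w = 2" using w1 by (simp add: v_def)
    have "DH 2 = {\<one>\<^bsub>G\<^esub>}" using hSw unfolding w2 .
    then show ?thesis using 1 cardD by simp
  next
    case 2
    then have "v = 1" "w = 2" by (simp_all add: v_def w_def)
    then have "card (DH 2) = 3" "DH 3 = {\<one>\<^bsub>G\<^esub>}" using hw[of 2] DH.card_H[of 2] 2 hSw by (simp_all add: numeral_3_eq_3)
    then show ?thesis using 2 cardD by simp
  next
    case 3
    then have vw: "v = 2" "w = 3" by (simp_all add: v_def w_def)
    have "?h 2 = n - 1" by (rule ext2) (use 3 in \<open>auto simp: less_Suc_eq\<close>)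
    then have "card (DH 2) = 4" using DH.card_H[of 2] 3 by simp
    moreover have "card (DH 3) = 2" using DH.card_H[of 3] hw[of 3] vw 3 by simp
    moreover have "DH 4 = {\<one>\<^bsub>G\<^esub>}" using hSw vw by (simp add: eval_nat_numeral)
    ultimately show ?thesis using 3 cardD by simp
  qed
qed

end

section \<open>Isomorphism invariants of C_4 x C_2 and C_2 x C_2\<close>

lemma integer_mod_4_2_facts:
  assumes H: "group H" and iso: "H \<cong> integer_mod_group 4 \<times>\<times> integer_mod_group 2"
  shows "card (carrier H) = 8"
    and "\<And>x y. x \<in> carrier H \<Longrightarrow> y \<in> carrier H \<Longrightarrow> x \<otimes>\<^bsub>H\<^esub> y = y \<otimes>\<^bsub>H\<^esub> x"
    and "card {x \<in> carrier H. x \<otimes>\<^bsub>H\<^esub> x = \<one>\<^bsub>H\<^esub>} = 4"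
    and "\<And>x. x \<in> carrier H \<Longrightarrow> (x \<otimes>\<^bsub>H\<^esub> x) \<otimes>\<^bsub>H\<^esub> (x \<otimes>\<^bsub>H\<^esub> x) = \<one>\<^bsub>H\<^esub>"
proof -
  interpret H: group H by (rule H)
  let ?Z = "integer_mod_group 4 \<times>\<times> integer_mod_group 2"
  have Z: "group ?Z" by (intro DirProd_group) simp_all
  obtain h where h: "h \<in> hom H ?Z" and bij: "bij_betw h (carrier H) (carrier ?Z)"
    using iso by (auto simp: is_iso_def iso_def)
  have cZ: "carrier ?Z = {0..<4} \<times> {0..<2}" by (simp add: carrier_integer_mod_group)
  have inj: "inj_on h (carrier H)" and im: "h ` carrier H = carrier ?Z"
    using bij by (auto simp: bij_betw_def)
  have hm: "h (x \<otimes>\<^bsub>H\<^esub> y) = h x \<otimes>\<^bsub>?Z\<^esub> h y" if "x \<in> carrier H" "y \<in> carrier H" for x y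
    using hom_mult[OF h that] .
  have h1: "h \<one>\<^bsub>H\<^esub> = (0, 0)" using hom_one[OF h H Z] by simp
  have hc: "h x \<in> {0..<4} \<times> {0..<2}" if "x \<in> carrier H" for x using im that cZ by blast
  have eqI: "x = y" if "x \<in> carrier H" "y \<in> carrier H" "h x = h y" for x y
    using inj that by (auto dest: inj_onD)
  show "card (carrier H) = 8" using iso_same_card[OF iso] unfolding cZ by (simp add: card_cartesian_product)
  show "x \<otimes>\<^bsub>H\<^esub> y = y \<otimes>\<^bsub>H\<^esub> x" if "x \<in> carrier H" "y \<in> carrier H" for x y
    by (rule eqI) (use that in \<open>simp_all add: hm mult_DirProd' add.commute\<close>)
  have four: "(((a + a) mod 4 + (a + a) mod 4) mod 4 :: int) = 0" for a by presburger
  have two: "(((a + a) mod 2 + (a + a) mod 2) mod 2 :: int) = 0" for a by presburger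
  show "(x \<otimes>\<^bsub>H\<^esub> x) \<otimes>\<^bsub>H\<^esub> (x \<otimes>\<^bsub>H\<^esub> x) = \<one>\<^bsub>H\<^esub>" if "x \<in> carrier H" for x
    by (rule eqI) (use that four two in \<open>simp_all add: hm h1 mult_DirProd' del: mod_add_eq mod_add_left_eq mod_add_right_eq\<close>)
  have "h ` {x \<in> carrier H. x \<otimes>\<^bsub>H\<^esub> x = \<one>\<^bsub>H\<^esub>} = {0, 2} \<times> {0, 1}"
  proof (intro equalityI subsetI)
    fix z assume "z \<in> h ` {x \<in> carrier H. x \<otimes>\<^bsub>H\<^esub> x = \<one>\<^bsub>H\<^esub>}"
    then obtain x where x: "x \<in> carrier H" "x \<otimes>\<^bsub>H\<^esub> x = \<one>\<^bsub>H\<^esub>" "z = h x" by blast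
    obtain a b where ab: "h x = (a, b)" by fastforce
    have "h x \<otimes>\<^bsub>?Z\<^esub> h x = (0, 0)" using x(2) hm[OF x(1) x(1)] h1 by simp
    then have "(a + a) mod 4 = 0" by (simp add: ab)
    moreover have "0 \<le> a" "a < 4" "0 \<le> b" "b < 2" using hc[OF x(1)] by (auto simp: ab)
    ultimately have "a = 0 \<or> a = 2" "b = 0 \<or> b = 1" by presburger+
    then show "z \<in> {0, 2} \<times> {0, 1}" using x(3) ab by auto
  next
    fix z :: "int \<times> int" assume z: "z \<in> {0, 2} \<times> {0, 1}"
    then have "z \<in> h ` carrier H" unfolding im cZ by auto
    then obtain x where x: "x \<in> carrier H" "z = h x" by blast
    have "h x \<otimes>\<^bsub>?Z\<^esub> h x = (0, 0)" using z by (auto simp: x(2)[symmetric])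
    then have "x \<otimes>\<^bsub>H\<^esub> x = \<one>\<^bsub>H\<^esub>" using x(1) by (intro eqI) (simp_all add: hm h1)
    then show "z \<in> h ` {x \<in> carrier H. x \<otimes>\<^bsub>H\<^esub> x = \<one>\<^bsub>H\<^esub>}" using x by blast
  qed
  note img = this
  have "inj_on h {x \<in> carrier H. x \<otimes>\<^bsub>H\<^esub> x = \<one>\<^bsub>H\<^esub>}" using inj by (rule inj_on_subset) auto
  from card_image[OF this]
  have "card {x \<in> carrier H. x \<otimes>\<^bsub>H\<^esub> x = \<one>\<^bsub>H\<^esub>} = card ({0::int, 2} \<times> {0::int, 1})"
    unfolding img by (rule sym)
  then show "card {x \<in> carrier H. x \<otimes>\<^bsub>H\<^esub> x = \<one>\<^bsub>H\<^esub>} = 4" by (simp add: card_cartesian_product)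
qed

lemma integer_mod_2_2_facts:
  assumes H: "group H" and iso: "H \<cong> integer_mod_group 2 \<times>\<times> integer_mod_group 2"
  shows "card (carrier H) = 4" and "\<And>x. x \<in> carrier H \<Longrightarrow> x \<otimes>\<^bsub>H\<^esub> x = \<one>\<^bsub>H\<^esub>"
proof -
  interpret H: group H by (rule H)
  let ?Z = "integer_mod_group 2 \<times>\<times> integer_mod_group 2"
  have Z: "group ?Z" by (intro DirProd_group) simp_all
  obtain h where h: "h \<in> hom H ?Z" and bij: "bij_betw h (carrier H) (carrier ?Z)"
    using iso by (auto simp: is_iso_def iso_def)
  have cZ: "carrier ?Z = {0..<2} \<times> {0..<2}" by (simp add: carrier_integer_mod_group)
  have inj: "inj_on h (carrier H)" using bij by (auto simp: bij_betw_def)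
  show "card (carrier H) = 4" using iso_same_card[OF iso] unfolding cZ by (simp add: card_cartesian_product)
  show "x \<otimes>\<^bsub>H\<^esub> x = \<one>\<^bsub>H\<^esub>" if x: "x \<in> carrier H" for x
  proof -
    have "h (x \<otimes>\<^bsub>H\<^esub> x) = h x \<otimes>\<^bsub>?Z\<^esub> h x" by (rule hom_mult[OF h x x])
    also have "\<dots> = h \<one>\<^bsub>H\<^esub>" using hom_one[OF h H Z] by (simp add: mult_DirProd')
    finally show ?thesis using inj x by (auto dest: inj_onD)
  qed
qed

lemma Suc_numerals: "Suc 1 = 2" "Suc 2 = 3" "Suc 3 = 4" "Suc 4 = 5"
  by simp_all

section \<open>The lower central series against the Lie dimension series\<close>

context nilpotent_group_algebra begin

text \<open>Both series absorb commutators with \<open>G\<close> in the same way, but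
  \<open>G'\<close> has index 2 in one and index 1 in the other; hence the shift.\<close>

lemma lower_central_subset_DH: "lower_central G (Suc (Suc i)) \<subseteq> DH (Suc i)"
proof (induction i)
  case 0
  have "lower_central G (Suc (Suc 0)) = D" using lower_central_2[of G] by (simp add: numeral_2_eq_2)
  then show ?case using DH.H_1 by simp
next
  case (Suc i)
  show ?case
    by (rule G.lower_central_least[OF _ DH.H_subgroup]) (use Suc DH.H_central in auto)
qed

lemma lower_central_3: "lower_central G 3 \<subseteq> DH 2"
  and lower_central_4: "lower_central G 4 \<subseteq> DH 3"
  and lower_central_5: "lower_central G 5 \<subseteq> DH 4"
  by (rule lower_central_subset_DH[of 1, unfolded Suc_numerals]
      lower_central_subset_DH[of 2, unfolded Suc_numerals]
      lower_central_subset_DH[of 3, unfolded Suc_numerals])+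

lemma lower_central_end: "\<exists>d. lower_central G (Suc d) = {\<one>\<^bsub>G\<^esub>}"
proof -
  obtain c where c: "DH c = {\<one>\<^bsub>G\<^esub>}" using DH.H_end by blast
  have "DH (Suc c) \<subseteq> DH c" by (rule DH.H_Suc)
  then have "lower_central G (Suc (Suc c)) \<subseteq> {\<one>\<^bsub>G\<^esub>}" using c lower_central_subset_DH[of c] by blast
  then have "lower_central G (Suc (Suc c)) = {\<one>\<^bsub>G\<^esub>}" using G.lower_central_one by blast
  then show ?thesis by blast
qed

lemma gcomm_lower_central:
  "x \<in> D \<Longrightarrow> g \<in> carrier G \<Longrightarrow> gcomm G x g \<in> lower_central G 3"
  "x \<in> lower_central G 3 \<Longrightarrow> g \<in> carrier G \<Longrightarrow> gcomm G x g \<in> lower_central G 4"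
  "x \<in> lower_central G 4 \<Longrightarrow> g \<in> carrier G \<Longrightarrow> gcomm G x g \<in> lower_central G 5"
  using G.lower_central_gcomm[of x 2 g, unfolded Suc_numerals lower_central_2]
    G.lower_central_gcomm[of x 3 g, unfolded Suc_numerals] G.lower_central_gcomm[of x 4 g, unfolded Suc_numerals]
  by simp_all

lemma nilpotency_class_eq:
  "lower_central G 3 = {\<one>\<^bsub>G\<^esub>} \<Longrightarrow> D \<noteq> {\<one>\<^bsub>G\<^esub>} \<Longrightarrow> nilpotency_class G = 2"
  "lower_central G 4 = {\<one>\<^bsub>G\<^esub>} \<Longrightarrow> lower_central G 3 \<noteq> {\<one>\<^bsub>G\<^esub>} \<Longrightarrow> nilpotency_class G = 3"
  "lower_central G 5 = {\<one>\<^bsub>G\<^esub>} \<Longrightarrow> lower_central G 4 \<noteq> {\<one>\<^bsub>G\<^esub>} \<Longrightarrow> nilpotency_class G = 4"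
  using G.nilpotency_class_eqI[of 1, unfolded Suc_numerals lower_central_2]
    G.nilpotency_class_eqI[of 2, unfolded Suc_numerals] G.nilpotency_class_eqI[of 3, unfolded Suc_numerals]
  by simp_all

lemma nilpotency_class_imp:
  "nilpotency_class G = 2 \<Longrightarrow> lower_central G 3 = {\<one>\<^bsub>G\<^esub>}"
  "nilpotency_class G = 3 \<Longrightarrow> lower_central G 4 = {\<one>\<^bsub>G\<^esub>} \<and> lower_central G 3 \<noteq> {\<one>\<^bsub>G\<^esub>}"
  "nilpotency_class G = 4 \<Longrightarrow> lower_central G 5 = {\<one>\<^bsub>G\<^esub>} \<and> lower_central G 4 \<noteq> {\<one>\<^bsub>G\<^esub>}"
proof -
  obtain d where d: "lower_central G (Suc d) = {\<one>\<^bsub>G\<^esub>}" using lower_central_end by blast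
  note D = G.nilpotency_classD[OF d]
  show "nilpotency_class G = 2 \<Longrightarrow> lower_central G 3 = {\<one>\<^bsub>G\<^esub>}"
    using D[of 1, unfolded Suc_numerals] by simp
  show "nilpotency_class G = 3 \<Longrightarrow> lower_central G 4 = {\<one>\<^bsub>G\<^esub>} \<and> lower_central G 3 \<noteq> {\<one>\<^bsub>G\<^esub>}"
    using D[of 2, unfolded Suc_numerals] by simp
  show "nilpotency_class G = 4 \<Longrightarrow> lower_central G 5 = {\<one>\<^bsub>G\<^esub>} \<and> lower_central G 4 \<noteq> {\<one>\<^bsub>G\<^esub>}"
    using D[of 3, unfolded Suc_numerals] by simp
qed

text \<open>A repetition makes the series stationary, while it does reach 1.\<close>

lemma lower_central_proper:
  assumes "lower_central G (Suc n) = lower_central G n" "n \<ge> 1" shows "lower_central G n = {\<one>\<^bsub>G\<^esub>}"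
proof -
  have "lower_central G (n + k) = lower_central G n" for k
  proof (induction k)
    case (Suc k)
    have "lower_central G (Suc (n + k)) = lower_central G (Suc n)"
      using assms(2) Suc by (simp only: G.lower_central_Suc le_add1 order.trans[OF assms(2)])
    then show ?case using assms(1) by simp
  qed simp
  moreover obtain d where d: "lower_central G (Suc d) = {\<one>\<^bsub>G\<^esub>}" using lower_central_end by blast
  moreover have "lower_central G (n + Suc d) \<subseteq> lower_central G (Suc d)" by (rule G.lower_central_antimono) simp
  ultimately have "lower_central G n \<subseteq> {\<one>\<^bsub>G\<^esub>}" by metis
  then show ?thesis using G.lower_central_one[of n] by blast
qed

lemma subgroup_facts:
  assumes L: "subgroup L G"
  shows "group (G\<lparr>carrier := L\<rparr>)" "x [^]\<^bsub>G\<lparr>carrier := L\<rparr>\<^esub> (k::nat) = x [^]\<^bsub>G\<^esub> k"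
  using G.subgroup_imp_group[OF L] G.nat_pow_consistent[of x k L] by simp_all

lemma square_eq: "x \<in> carrier G \<Longrightarrow> x [^]\<^bsub>G\<^esub> (2::nat) = x \<otimes>\<^bsub>G\<^esub> x"
  by (simp add: numeral_2_eq_2)

lemma card_subgroup_D:
  assumes "subgroup L G" "L \<subseteq> D" shows "\<exists>k. card L = p ^ k"
  using DH.card_power[OF assms] .

lemma cyclic_iff:
  "cyclic_group (lower_central_group G 2) \<longleftrightarrow> (\<exists>x\<in>D. D = range (\<lambda>k::int. x [^]\<^bsub>G\<^esub> k))"
proof -
  have "x [^]\<^bsub>G\<lparr>carrier := D\<rparr>\<^esub> k = x [^]\<^bsub>G\<^esub> k" if "x \<in> D" for x and k :: int
    using G.int_pow_consistent[OF derived_subgroup that] by simp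
  then show ?thesis
    using group.cyclic_group[OF subgroup_facts(1)[OF derived_subgroup]]
    by (simp add: lower_central_group_def lower_central_2)
qed

lemma not_cyclic_4:
  assumes "card D = 4" "\<And>x. x \<in> D \<Longrightarrow> x [^]\<^bsub>G\<^esub> (2::nat) = \<one>\<^bsub>G\<^esub>"
  shows "\<not> cyclic_group (lower_central_group G 2)"
proof
  assume "cyclic_group (lower_central_group G 2)"
  then obtain x where x: "x \<in> D" "D = range (\<lambda>k::int. x [^]\<^bsub>G\<^esub> k)" using cyclic_iff by blast
  have xG: "x \<in> carrier G" by (rule derived_G[OF x(1)])
  have "range (\<lambda>k::int. x [^]\<^bsub>G\<^esub> k) \<subseteq> {\<one>\<^bsub>G\<^esub>, x}"
  proof
    fix y assume "y \<in> range (\<lambda>k::int. x [^]\<^bsub>G\<^esub> k)"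
    then obtain k where "y = x [^]\<^bsub>G\<^esub> (k::int)" by blast
    then have y: "y = x [^]\<^bsub>G\<^esub> (k mod int 2)" using G.int_pow_mod[OF xG assms(2)[OF x(1)], of k] by simp
    have "k mod int 2 = 0 \<or> k mod int 2 = 1" by auto
    then show "y \<in> {\<one>\<^bsub>G\<^esub>, x}" using y xG by auto
  qed
  then have "card D \<le> card {\<one>\<^bsub>G\<^esub>, x}" using x(2) by (intro card_mono) auto
  also have "\<dots> \<le> 2" by (simp add: card_insert_if)
  finally show False using assms(1) by simp
qed

text \<open>An element with nontrivial square generates a subgroup with at least three elements; its
  order is a power of 2, so it is all of \<open>G'\<close>.\<close>

lemma exponent_2_of_not_cyclic_4:
  assumes p: "p = 2" and card: "card D = 4" and nc: "\<not> cyclic_group (lower_central_group G 2)" and x: "x \<in> D"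
  shows "x [^]\<^bsub>G\<^esub> (2::nat) = \<one>\<^bsub>G\<^esub>"
proof (rule ccontr)
  assume ne: "x [^]\<^bsub>G\<^esub> (2::nat) \<noteq> \<one>\<^bsub>G\<^esub>"
  have xG: "x \<in> carrier G" by (rule derived_G[OF x])
  define L where "L = generate G {x}"
  have L: "subgroup L G" unfolding L_def by (rule G.generate_is_subgroup) (use xG in simp)
  have LD: "L \<subseteq> D" unfolding L_def by (rule G.generate_subgroup_incl[OF _ derived_subgroup]) (use x in simp)
  have Leq: "L = range (\<lambda>k::int. x [^]\<^bsub>G\<^esub> k)" unfolding L_def G.generate_pow[OF xG] by auto
  have fin: "finite L" using LD finite_D by (rule finite_subset)
  have x1: "x \<noteq> \<one>\<^bsub>G\<^esub>" using ne by auto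
  have xx: "x \<otimes>\<^bsub>G\<^esub> x \<noteq> x" using x1 xG G.r_cancel_one' by auto
  have xL: "x \<in> L" unfolding L_def by (rule generate.incl) simp
  have "{\<one>\<^bsub>G\<^esub>, x, x \<otimes>\<^bsub>G\<^esub> x} \<subseteq> L"
    using subgroup.one_closed[OF L] xL subgroup.m_closed[OF L xL xL] by simp
  then have "card {\<one>\<^bsub>G\<^esub>, x, x \<otimes>\<^bsub>G\<^esub> x} \<le> card L" by (rule card_mono[OF fin])
  moreover have "card {\<one>\<^bsub>G\<^esub>, x, x \<otimes>\<^bsub>G\<^esub> x} = 3" using x1 xx ne square_eq[OF xG] by auto
  ultimately have L3: "card L \<ge> 3" by simp
  have L4: "card L \<le> 4" using card_mono[OF finite_D LD] card by simp
  obtain k where k: "card L = 2 ^ k" using card_subgroup_D[OF L LD] p by blast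
  have "card L = 4"
  proof (cases "k \<le> 1")
    case True
    then have "(2::nat) ^ k \<le> 2 ^ 1" by (intro power_increasing) auto
    then show ?thesis using k L3 by simp
  next
    case False
    then have "(2::nat) ^ 2 \<le> 2 ^ k" by (intro power_increasing) auto
    then show ?thesis using k L4 by simp
  qed
  then have "L = D" using LD card finite_D by (intro card_subset_eq) auto
  then show False using nc cyclic_iff x Leq by blast
qed

lemma comm_group_D_iff:
  "comm_group (lower_central_group G 2) \<longleftrightarrow> (\<forall>x\<in>D. \<forall>y\<in>D. x \<otimes>\<^bsub>G\<^esub> y = y \<otimes>\<^bsub>G\<^esub> x)"
proof
  assume "comm_group (lower_central_group G 2)"
  then interpret C: comm_group "lower_central_group G 2" .
  show "\<forall>x\<in>D. \<forall>y\<in>D. x \<otimes>\<^bsub>G\<^esub> y = y \<otimes>\<^bsub>G\<^esub> x"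
    using C.m_comm by (simp add: lower_central_group_def lower_central_2)
next
  assume "\<forall>x\<in>D. \<forall>y\<in>D. x \<otimes>\<^bsub>G\<^esub> y = y \<otimes>\<^bsub>G\<^esub> x"
  then show "comm_group (lower_central_group G 2)"
    unfolding lower_central_group_def lower_central_2
    by (intro group.group_comm_groupI[OF subgroup_facts(1)[OF derived_subgroup]]) simp
qed

lemma elementary_abelian_D_iff:
  "elementary_abelian q (lower_central_group G 2) \<longleftrightarrow>
    (\<forall>x\<in>D. \<forall>y\<in>D. x \<otimes>\<^bsub>G\<^esub> y = y \<otimes>\<^bsub>G\<^esub> x) \<and> (\<forall>x\<in>D. x [^]\<^bsub>G\<^esub> q = \<one>\<^bsub>G\<^esub>)"
  unfolding elementary_abelian_def comm_group_D_iff
  by (simp add: lower_central_group_def lower_central_2 subgroup_facts(2)[OF derived_subgroup])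

lemma order_D: "order (lower_central_group G 2) = card D"
  by (simp add: order_def lower_central_group_def lower_central_2)

end

section \<open>From the orders of the Lie dimension subgroups to the group-theoretic
  conditions\<close>

context nilpotent_group_algebra begin

lemma DH_gcomm: "x \<in> DH i \<Longrightarrow> g \<in> carrier G \<Longrightarrow> DH (Suc i) = {\<one>\<^bsub>G\<^esub>} \<Longrightarrow> gcomm G x g = \<one>\<^bsub>G\<^esub>"
  using DH.H_central[of x i g] by simp

text \<open>Commutators of \<open>x\<close> with \<open>G\<close> lie in \<open>DH (Suc i)\<close>,
  which is central by hypothesis, so \<open>commutes_derived\<close> applies.\<close>

lemma DH_commutes_D:
  assumes i: "DH (Suc (Suc i)) = {\<one>\<^bsub>G\<^esub>}" and x: "x \<in> DH i" and y: "y \<in> D"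
  shows "x \<otimes>\<^bsub>G\<^esub> y = y \<otimes>\<^bsub>G\<^esub> x"
proof (rule G.commutes_derived[OF DH.H_carrier[OF x] _ y])
  fix g h assume g: "g \<in> carrier G" and h: "h \<in> carrier G"
  have "gcomm G x g \<in> DH (Suc i)" by (rule DH.H_central[OF x g])
  from DH_gcomm[OF this h i] show "gcomm G x g \<otimes>\<^bsub>G\<^esub> h = h \<otimes>\<^bsub>G\<^esub> gcomm G x g"
    using DH.H_carrier[OF x] g h by (simp add: G.gcomm_eq_one_iff)
qed

lemma DH_pow: "x \<in> DH i \<Longrightarrow> k = p * i \<Longrightarrow> DH k = {\<one>\<^bsub>G\<^esub>} \<Longrightarrow> x [^]\<^bsub>G\<^esub> p = \<one>\<^bsub>G\<^esub>"
  using DH.H_pow[of x i] by simp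

lemma chain_series_short:
  assumes A: "subgroup A G" "A \<subseteq> DH 2"
    and comm: "\<And>x y. x \<in> D \<Longrightarrow> y \<in> D \<Longrightarrow> x \<otimes>\<^bsub>G\<^esub> y = y \<otimes>\<^bsub>G\<^esub> x"
    and DA: "\<And>x g. x \<in> D \<Longrightarrow> g \<in> carrier G \<Longrightarrow> gcomm G x g \<in> A"
    and AB: "\<And>x g. x \<in> A \<Longrightarrow> g \<in> carrier G \<Longrightarrow> gcomm G x g = \<one>\<^bsub>G\<^esub>"
    and pD: "\<And>x. x \<in> D \<Longrightarrow> x [^]\<^bsub>G\<^esub> p \<in> A" "\<And>x. x \<in> D \<Longrightarrow> p \<noteq> 2 \<Longrightarrow> x [^]\<^bsub>G\<^esub> p = \<one>\<^bsub>G\<^esub>"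
    and pA: "\<And>x. x \<in> A \<Longrightarrow> x [^]\<^bsub>G\<^esub> p = \<one>\<^bsub>G\<^esub>"
  shows "DH 2 = A" "DH 3 = {\<one>\<^bsub>G\<^esub>}" "DH 4 = {\<one>\<^bsub>G\<^esub>}"
proof -
  have 1: "{\<one>\<^bsub>G\<^esub>} \<subseteq> DH 3" "{\<one>\<^bsub>G\<^esub>} \<subseteq> A"
    using subgroup.one_closed[OF DH.H_subgroup] subgroup.one_closed[OF A(1)] by auto
  have AB': "gcomm G x g \<in> {\<one>\<^bsub>G\<^esub>}" if "x \<in> A" "g \<in> carrier G" for x g using AB[OF that] by simp
  have B: "gcomm G x g = \<one>\<^bsub>G\<^esub>" if "x \<in> {\<one>\<^bsub>G\<^esub>}" "g \<in> carrier G" for x g using that by (simp add: gcomm_def)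
  note ch = chain_series[OF A G.triv_subgroup 1 comm DA AB' B pD pA]
  show "DH 2 = A" "DH 3 = {\<one>\<^bsub>G\<^esub>}" "DH 4 = {\<one>\<^bsub>G\<^esub>}" by (rule ch; assumption)+
qed

lemma chain_series_trivial:
  assumes comm: "\<And>x g. x \<in> D \<Longrightarrow> g \<in> carrier G \<Longrightarrow> gcomm G x g = \<one>\<^bsub>G\<^esub>"
    and pow: "\<And>x. x \<in> D \<Longrightarrow> x [^]\<^bsub>G\<^esub> p = \<one>\<^bsub>G\<^esub>"
  shows "DH 2 = {\<one>\<^bsub>G\<^esub>}" "DH 3 = {\<one>\<^bsub>G\<^esub>}" "DH 4 = {\<one>\<^bsub>G\<^esub>}"
proof -
  have c: "x \<otimes>\<^bsub>G\<^esub> y = y \<otimes>\<^bsub>G\<^esub> x" if "x \<in> D" "y \<in> D" for x y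
    using comm[OF that(1) derived_G[OF that(2)]] G.gcomm_eq_one_iff[OF derived_G[OF that(1)] derived_G[OF that(2)]] by simp
  have 1: "{\<one>\<^bsub>G\<^esub>} \<subseteq> DH 2" using subgroup.one_closed[OF DH.H_subgroup] by simp
  have DA: "gcomm G x g \<in> {\<one>\<^bsub>G\<^esub>}" if "x \<in> D" "g \<in> carrier G" for x g using comm[OF that] by simp
  have B: "gcomm G x g = \<one>\<^bsub>G\<^esub>" if "x \<in> {\<one>\<^bsub>G\<^esub>}" "g \<in> carrier G" for x g using that by (simp add: gcomm_def)
  have p1: "x [^]\<^bsub>G\<^esub> p \<in> {\<one>\<^bsub>G\<^esub>}" if "x \<in> D" for x using pow[OF that] by simp
  have p2: "x [^]\<^bsub>G\<^esub> p = \<one>\<^bsub>G\<^esub>" if "x \<in> {\<one>\<^bsub>G\<^esub>}" for x using that by simp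
  note ch = chain_series_short[OF G.triv_subgroup 1 c DA B p1 pow p2]
  show "DH 2 = {\<one>\<^bsub>G\<^esub>}" "DH 3 = {\<one>\<^bsub>G\<^esub>}" "DH 4 = {\<one>\<^bsub>G\<^esub>}" by (rule ch; assumption)+
qed

lemma shape_4:
  assumes p: "p = 2" and D: "card D = 4" and DH2: "DH 2 = {\<one>\<^bsub>G\<^esub>}"
  shows "nilpotency_class G = 2 \<and> \<not> cyclic_group (lower_central_group G 2)"
proof
  have "lower_central G 3 = {\<one>\<^bsub>G\<^esub>}" using lower_central_3 DH2 G.lower_central_one by blast
  moreover have "D \<noteq> {\<one>\<^bsub>G\<^esub>}" using D by auto
  ultimately show "nilpotency_class G = 2" by (rule nilpotency_class_eq(1))
  have "x [^]\<^bsub>G\<^esub> (2::nat) = \<one>\<^bsub>G\<^esub>" if "x \<in> D" for x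
    using DH_pow[of x 1 2] that p DH2 DH.H_1 by simp
  then show "\<not> cyclic_group (lower_central_group G 2)" by (rule not_cyclic_4[OF D])
qed

lemma shape_9:
  assumes p: "p = 3" and D: "card D = 9" and DH2: "card (DH 2) = 3" and DH3: "DH 3 = {\<one>\<^bsub>G\<^esub>}"
  shows "nilpotency_class G = 3 \<and> elementary_abelian 3 (lower_central_group G 2)"
proof
  have comm: "x \<otimes>\<^bsub>G\<^esub> y = y \<otimes>\<^bsub>G\<^esub> x" if "x \<in> D" "y \<in> D" for x y
    using DH_commutes_D[of 1 x y, unfolded Suc_numerals] that DH3 DH.H_1 by simp
  have pow: "x [^]\<^bsub>G\<^esub> p = \<one>\<^bsub>G\<^esub>" if "x \<in> D" for x
    using DH_pow[of x 1 3] that p DH3 DH.H_1 by simp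
  show "elementary_abelian 3 (lower_central_group G 2)"
    using comm pow p by (simp add: elementary_abelian_D_iff)
  have "lower_central G 4 = {\<one>\<^bsub>G\<^esub>}" using lower_central_4 DH3 G.lower_central_one by blast
  moreover have "lower_central G 3 \<noteq> {\<one>\<^bsub>G\<^esub>}"
  proof
    \<comment> \<open>Then \<open>G'\<close> is central of exponent \<open>p\<close>, and the
      admissible series that drops to 1 at index 2 contradicts the order of
      \<open>DH 2\<close>.\<close>
    assume l3: "lower_central G 3 = {\<one>\<^bsub>G\<^esub>}"
    have "DH 2 = {\<one>\<^bsub>G\<^esub>}"
    proof (rule chain_series_trivial(1)[OF _ pow])
      show "gcomm G x g = \<one>\<^bsub>G\<^esub>" if "x \<in> D" "g \<in> carrier G" for x g
        using gcomm_lower_central(1)[OF that] l3 by simp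
    qed
    then show False using DH2 by simp
  qed
  ultimately show "nilpotency_class G = 3" by (rule nilpotency_class_eq(2))
qed

text \<open>\<open>DH 2\<close> centralises \<open>G'\<close> and has index 2 in it, so
  \<open>G'\<close> is abelian. The class is 4 because otherwise \<open>DH 3\<close> would be
  trivial by minimality. Strictness of the lower central series then leaves only order 4 for its
  third term, which fills \<open>DH 2\<close>.\<close>

lemma shape_8:
  assumes p: "p = 2" and D: "card D = 8" and DH2: "card (DH 2) = 4" and DH3: "card (DH 3) = 2"
    and DH4: "DH 4 = {\<one>\<^bsub>G\<^esub>}"
  shows "nilpotency_class G = 4" "lower_central G 3 = DH 2"
    "\<And>x y. x \<in> D \<Longrightarrow> y \<in> D \<Longrightarrow> x \<otimes>\<^bsub>G\<^esub> y = y \<otimes>\<^bsub>G\<^esub> x"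
    "\<And>x. x \<in> D \<Longrightarrow> x \<otimes>\<^bsub>G\<^esub> x \<in> DH 2" "\<And>x. x \<in> DH 2 \<Longrightarrow> x \<otimes>\<^bsub>G\<^esub> x = \<one>\<^bsub>G\<^esub>"
proof -
  have DH2_D: "x \<in> D" if "x \<in> DH 2" for x using that DH.H_D by blast
  have cen: "x \<otimes>\<^bsub>G\<^esub> y = y \<otimes>\<^bsub>G\<^esub> x" if "x \<in> DH 2" "y \<in> D" for x y
    using DH_commutes_D[of 2 x y, unfolded Suc_numerals] that DH4 by simp
  have sq2: "x \<otimes>\<^bsub>G\<^esub> x = \<one>\<^bsub>G\<^esub>" if "x \<in> DH 2" for x
    using DH_pow[of x 2 4] that p DH4 square_eq[OF DH.H_carrier[OF that]] by simp
  have sqD: "x \<otimes>\<^bsub>G\<^esub> x \<in> DH 2" if "x \<in> D" for x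
    using DH.H_pow[of x 1] that p DH.H_1 square_eq[OF derived_G[OF that]] by simp
  have comm: "x \<otimes>\<^bsub>G\<^esub> y = y \<otimes>\<^bsub>G\<^esub> x" if x: "x \<in> D" and y: "y \<in> D" for x y
  proof -
    \<comment> \<open>A subgroup step provides \<open>z\<close> with
      \<open>G' = DH 2 \<union> DH 2 z\<close>; its depth must be 1 because \<open>DH 2\<close> is
      smaller than \<open>G'\<close>.\<close>
    have "D \<noteq> {\<one>\<^bsub>G\<^esub>}" using D by auto
    from DH.step_exists[OF derived_subgroup order.refl this]
    obtain i M0 z where i: "i \<ge> 1" "D \<subseteq> DH i" "D \<inter> DH (Suc i) \<subseteq> M0" and step: "subgroup_step G p D M0 z" by blast
    interpret step: subgroup_step G p D M0 z by (rule step)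
    have "i = 1"
    proof (rule ccontr)
      assume "i \<noteq> 1"
      then have "D \<subseteq> DH 2" using i DH.H_antimono[of 2 i] by auto
      then have "card D \<le> card (DH 2)" by (intro card_mono DH.H_finite)
      then show False using D DH2 by simp
    qed
    from i(3)[unfolded this Suc_numerals] have "DH 2 \<subseteq> M0" using DH.H_D[of 2] by blast
    moreover have "finite M0" using step.M0_M finite_D by (rule finite_subset)
    ultimately have M0: "M0 = DH 2" using step.card_eq D DH2 p by (intro card_subset_eq[symmetric]) auto
    obtain m e where m: "m \<in> M0" "x = m \<otimes>\<^bsub>G\<^esub> z [^]\<^bsub>G\<^esub> (e::nat)" using step.decomp[OF x] by blast
    obtain m' e' where m': "m' \<in> M0" "y = m' \<otimes>\<^bsub>G\<^esub> z [^]\<^bsub>G\<^esub> (e'::nat)" using step.decomp[OF y] by blast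
    have zG: "z \<in> carrier G" by (rule step.in_carrier(2))
    have cl: "m \<in> carrier G" "m' \<in> carrier G" using step.in_carrier(3) m m' by auto
    have zD: "z [^]\<^bsub>G\<^esub> (k::nat) \<in> D" for k
      using G.subgroup_int_pow_closed[OF derived_subgroup step.x(1), of "int k"] by (simp add: int_pow_int)
    have "z [^]\<^bsub>G\<^esub> e \<otimes>\<^bsub>G\<^esub> y = y \<otimes>\<^bsub>G\<^esub> z [^]\<^bsub>G\<^esub> e"
    proof -
      have "z [^]\<^bsub>G\<^esub> e \<otimes>\<^bsub>G\<^esub> y = (z [^]\<^bsub>G\<^esub> e \<otimes>\<^bsub>G\<^esub> m') \<otimes>\<^bsub>G\<^esub> z [^]\<^bsub>G\<^esub> e'"
        using m'(2) zG cl by (simp add: G.m_assoc)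
      also have "z [^]\<^bsub>G\<^esub> e \<otimes>\<^bsub>G\<^esub> m' = m' \<otimes>\<^bsub>G\<^esub> z [^]\<^bsub>G\<^esub> e"
        using cen[of m' "z [^]\<^bsub>G\<^esub> e"] m'(1) M0 zD by simp
      finally show ?thesis using m'(2) zG cl by (simp add: G.m_assoc G.nat_pow_mult add.commute)
    qed
    then have "x \<otimes>\<^bsub>G\<^esub> y = m \<otimes>\<^bsub>G\<^esub> y \<otimes>\<^bsub>G\<^esub> z [^]\<^bsub>G\<^esub> e"
      using m(2) zG cl derived_G[OF y] by (simp add: G.m_assoc)
    also have "m \<otimes>\<^bsub>G\<^esub> y = y \<otimes>\<^bsub>G\<^esub> m" using cen[of m y] m(1) M0 y by simp
    finally show ?thesis using m(2) zG cl derived_G[OF y] by (simp add: G.m_assoc)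
  qed
  show "x \<otimes>\<^bsub>G\<^esub> y = y \<otimes>\<^bsub>G\<^esub> x" if "x \<in> D" "y \<in> D" for x y using comm[OF that] .
  show "x \<otimes>\<^bsub>G\<^esub> x \<in> DH 2" if "x \<in> D" for x using sqD[OF that] .
  show "x \<otimes>\<^bsub>G\<^esub> x = \<one>\<^bsub>G\<^esub>" if "x \<in> DH 2" for x using sq2[OF that] .
  have l4: "lower_central G 4 \<noteq> {\<one>\<^bsub>G\<^esub>}"
  proof
    assume l4: "lower_central G 4 = {\<one>\<^bsub>G\<^esub>}"
    \<comment> \<open>The third lower central term together with the squares of \<open>G'\<close>
      generates the smallest candidate for the term of index 2. It is central if the fourth lower
      central term is trivial.\<close>
    define U where "U = lower_central G 3 \<union> {x \<otimes>\<^bsub>G\<^esub> x | x. x \<in> D}"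
    define S where "S = generate G U"
    have U2: "U \<subseteq> DH 2" using lower_central_3 sqD by (auto simp: U_def)
    have UG: "U \<subseteq> carrier G" using U2 DH.H_carrier by blast
    have S: "subgroup S G" unfolding S_def by (rule G.generate_is_subgroup[OF UG])
    have S2: "S \<subseteq> DH 2" unfolding S_def by (rule G.generate_subgroup_incl[OF U2 DH.H_subgroup])
    have US: "u \<in> S" if "u \<in> U" for u unfolding S_def using that by (rule generate.incl)
    have Ucen: "gcomm G u g = \<one>\<^bsub>G\<^esub>" if u: "u \<in> U" and g: "g \<in> carrier G" for u g
    proof (cases "u \<in> lower_central G 3")
      case True
      then show ?thesis using gcomm_lower_central(2)[OF True g] l4 by simp
    next
      case False
      then obtain x where x: "x \<in> D" "u = x \<otimes>\<^bsub>G\<^esub> x" using u by (auto simp: U_def)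
      have xG: "x \<in> carrier G" by (rule derived_G[OF x(1)])
      have c2: "gcomm G x g \<in> DH 2" using gcomm_lower_central(1)[OF x(1) g] lower_central_3 by blast
      \<comment> \<open>As \<open>G'\<close> is abelian, \<open>(x^2, g) = (x, g)^2\<close>, and
        squares in \<open>DH 2\<close> are trivial.\<close>
      have "gcomm G u g = x \<otimes>\<^bsub>G\<^esub> gcomm G x g \<otimes>\<^bsub>G\<^esub> inv\<^bsub>G\<^esub> x \<otimes>\<^bsub>G\<^esub> gcomm G x g"
        using xG g x(2) by (simp add: G.gcomm_mult_left)
      also have "x \<otimes>\<^bsub>G\<^esub> gcomm G x g = gcomm G x g \<otimes>\<^bsub>G\<^esub> x" by (rule comm[OF x(1) DH2_D[OF c2]])
      also have "gcomm G x g \<otimes>\<^bsub>G\<^esub> x \<otimes>\<^bsub>G\<^esub> inv\<^bsub>G\<^esub> x = gcomm G x g" using xG g by (simp add: G.m_assoc)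
      also have "gcomm G x g \<otimes>\<^bsub>G\<^esub> gcomm G x g = \<one>\<^bsub>G\<^esub>" by (rule sq2[OF c2])
      finally show ?thesis .
    qed
    have Scen: "gcomm G u g = \<one>\<^bsub>G\<^esub>" if u: "u \<in> S" and g: "g \<in> carrier G" for u g
    proof -
      have "U \<subseteq> {h \<in> carrier G. g \<otimes>\<^bsub>G\<^esub> h = h \<otimes>\<^bsub>G\<^esub> g}"
      proof
        fix h assume h: "h \<in> U"
        have hG: "h \<in> carrier G" using h UG by blast
        have "h \<otimes>\<^bsub>G\<^esub> g = g \<otimes>\<^bsub>G\<^esub> h" using Ucen[OF h g] G.gcomm_eq_one_iff[OF hG g] by simp
        then show "h \<in> {h \<in> carrier G. g \<otimes>\<^bsub>G\<^esub> h = h \<otimes>\<^bsub>G\<^esub> g}" using hG by simp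
      qed
      then have "S \<subseteq> {h \<in> carrier G. g \<otimes>\<^bsub>G\<^esub> h = h \<otimes>\<^bsub>G\<^esub> g}"
        unfolding S_def by (rule G.generate_subgroup_incl[OF _ G.centralizer_subgroup[OF g]])
      then have "u \<in> carrier G" "g \<otimes>\<^bsub>G\<^esub> u = u \<otimes>\<^bsub>G\<^esub> g" using u by auto
      then show ?thesis using g by (simp add: G.gcomm_eq_one_iff)
    qed
    have "DH 3 = {\<one>\<^bsub>G\<^esub>}"
    proof (rule chain_series_short(2)[OF S S2])
      show "gcomm G x g \<in> S" if "x \<in> D" "g \<in> carrier G" for x g
        using gcomm_lower_central(1)[OF that] by (intro US) (simp add: U_def)
      show "x [^]\<^bsub>G\<^esub> p \<in> S" if "x \<in> D" for x
        unfolding p square_eq[OF derived_G[OF that]] using that by (intro US) (auto simp: U_def)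
      show "x [^]\<^bsub>G\<^esub> p = \<one>\<^bsub>G\<^esub>" if "x \<in> S" for x
      proof -
        have "x \<in> DH 2" using that S2 by blast
        then show ?thesis unfolding p square_eq[OF DH.H_carrier[OF \<open>x \<in> DH 2\<close>]] by (rule sq2)
      qed
      show "gcomm G x g = \<one>\<^bsub>G\<^esub>" if "x \<in> S" "g \<in> carrier G" for x g by (rule Scen[OF that])
      show "x \<otimes>\<^bsub>G\<^esub> y = y \<otimes>\<^bsub>G\<^esub> x" if "x \<in> D" "y \<in> D" for x y by (rule comm[OF that])
    qed (use p in simp)
    then show False using DH3 by simp
  qed
  have "lower_central G 5 = {\<one>\<^bsub>G\<^esub>}" using lower_central_5 DH4 G.lower_central_one by blast
  then show "nilpotency_class G = 4" using l4 by (rule nilpotency_class_eq(3))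
  show "lower_central G 3 = DH 2"
  proof -
    have fin: "finite (lower_central G 3)" "finite (lower_central G 4)"
      using lower_central_3 lower_central_4 DH.H_finite finite_subset by blast+
    have sub: "lower_central G 4 \<subseteq> lower_central G 3" by (rule G.lower_central_antimono) simp
    have "lower_central G 4 \<noteq> lower_central G 3"
    proof
      assume "lower_central G 4 = lower_central G 3"
      from lower_central_proper[of 3, unfolded Suc_numerals, OF this] this l4 show False by simp
    qed
    then have lt: "card (lower_central G 4) < card (lower_central G 3)"
      using sub fin by (intro psubset_card_mono) auto
    have "card (lower_central G 4) \<noteq> 1"
    proof
      assume "card (lower_central G 4) = 1"
      then obtain a where "lower_central G 4 = {a}" by (auto simp: card_1_singleton_iff)
      then show False using l4 G.lower_central_one[of 4] by simp
    qed
    moreover have "card (lower_central G 4) \<noteq> 0" using fin G.lower_central_one[of 4] by (auto simp del: lower_central.simps)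
    \<comment> \<open>The fourth term has order at least 2 and is proper in the third.\<close>
    ultimately have c3: "card (lower_central G 3) \<ge> 3" using lt by linarith
    have "lower_central G 3 \<subseteq> D" using lower_central_3 DH.H_D by blast
    from card_subgroup_D[OF G.lower_central_subgroup this] obtain k where k: "card (lower_central G 3) = 2 ^ k" using p by blast
    have "card (lower_central G 3) = 4"
    proof (cases "k \<le> 1")
      case True
      then have "(2::nat) ^ k \<le> 2 ^ 1" by (intro power_increasing) auto
      then show ?thesis using k c3 by simp
    next
      case False
      then have "(2::nat) ^ 2 \<le> 2 ^ k" by (intro power_increasing) auto
      then show ?thesis using k card_mono[OF DH.H_finite lower_central_3] DH2 by simp
    qed
    then show ?thesis using lower_central_3 DH2 DH.H_finite by (intro card_subset_eq) auto
  qed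
qed

lemma iso_2_2:
  assumes L: "subgroup L G" "finite L" "card L = 4"
    and comm: "\<And>x y. x \<in> L \<Longrightarrow> y \<in> L \<Longrightarrow> x \<otimes>\<^bsub>G\<^esub> y = y \<otimes>\<^bsub>G\<^esub> x"
    and sq: "\<And>x. x \<in> L \<Longrightarrow> x \<otimes>\<^bsub>G\<^esub> x = \<one>\<^bsub>G\<^esub>"
  shows "G\<lparr>carrier := L\<rparr> \<cong> integer_mod_group 2 \<times>\<times> integer_mod_group 2"
proof -
  have LG: "x \<in> carrier G" if "x \<in> L" for x using subgroup.mem_carrier[OF L(1) that] .
  have one: "\<one>\<^bsub>G\<^esub> \<in> L" by (rule subgroup.one_closed[OF L(1)])
  have "\<not> L \<subseteq> {\<one>\<^bsub>G\<^esub>}" using card_mono[of "{\<one>\<^bsub>G\<^esub>}" L] L(3) by auto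
  then obtain x where x: "x \<in> L" "x \<noteq> \<one>\<^bsub>G\<^esub>" by blast
  have "card {\<one>\<^bsub>G\<^esub>, x} \<le> 2" by (simp add: card_insert_if)
  then have "\<not> L \<subseteq> {\<one>\<^bsub>G\<^esub>, x}" using card_mono[of "{\<one>\<^bsub>G\<^esub>, x}" L] L(3) by auto
  then obtain y where y: "y \<in> L" "y \<noteq> \<one>\<^bsub>G\<^esub>" "y \<noteq> x" by blast
  note G = LG[OF x(1)] LG[OF y(1)]
  have xy: "x \<otimes>\<^bsub>G\<^esub> y \<noteq> \<one>\<^bsub>G\<^esub>"
  proof
    assume "x \<otimes>\<^bsub>G\<^esub> y = \<one>\<^bsub>G\<^esub>"
    then have "x \<otimes>\<^bsub>G\<^esub> y = x \<otimes>\<^bsub>G\<^esub> x" using sq[OF x(1)] by simp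
    then show False using G y(3) by simp
  qed
  show ?thesis
  proof (rule G.iso_integer_mod_groups[OF L(1,2)])
    show "a = 0 \<and> b = 0" if "a < 2" "b < 2" "x [^]\<^bsub>G\<^esub> a \<otimes>\<^bsub>G\<^esub> y [^]\<^bsub>G\<^esub> b = \<one>\<^bsub>G\<^esub>" for a b :: nat
    proof -
      have "a = 0 \<or> a = 1" "b = 0 \<or> b = 1" using that(1,2) by auto
      then show ?thesis using that(3) x(2) y(2) xy G by auto
    qed
  qed (use L(3) x y comm sq G square_eq in simp_all)
qed

text \<open>\<open>x\<close> has order 4, and \<open>y\<close> is an element of \<open>E\<close>
  outside \<open>{1, x^2}\<close>. The odd powers of \<open>x\<close> are not in \<open>E\<close>
  since their square is \<open>x^2\<close>, so no power of \<open>x\<close> equals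
  \<open>y\<close>.\<close>

lemma iso_4_2:
  assumes L: "subgroup L G" "finite L" "card L = 8" and E: "E \<subseteq> L" "card E = 4"
    and comm: "\<And>x y. x \<in> L \<Longrightarrow> y \<in> L \<Longrightarrow> x \<otimes>\<^bsub>G\<^esub> y = y \<otimes>\<^bsub>G\<^esub> x"
    and sqL: "\<And>x. x \<in> L \<Longrightarrow> x \<otimes>\<^bsub>G\<^esub> x \<in> E"
    and sq: "\<And>x. x \<in> E \<Longrightarrow> x \<otimes>\<^bsub>G\<^esub> x = \<one>\<^bsub>G\<^esub>"
    and x: "x \<in> L" "x \<otimes>\<^bsub>G\<^esub> x \<noteq> \<one>\<^bsub>G\<^esub>"
  shows "G\<lparr>carrier := L\<rparr> \<cong> integer_mod_group 4 \<times>\<times> integer_mod_group 2"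
proof -
  have LG: "x \<in> carrier G" if "x \<in> L" for x using subgroup.mem_carrier[OF L(1) that] .
  define u where "u = x \<otimes>\<^bsub>G\<^esub> x"
  have u: "u \<in> E" "u \<noteq> \<one>\<^bsub>G\<^esub>" using sqL[OF x(1)] x(2) by (simp_all add: u_def)
  have finE: "finite E" using E(1) L(2) by (rule finite_subset)
  have "card {\<one>\<^bsub>G\<^esub>, u} \<le> 2" by (simp add: card_insert_if)
  then have "\<not> E \<subseteq> {\<one>\<^bsub>G\<^esub>, u}" using card_mono[of "{\<one>\<^bsub>G\<^esub>, u}" E] E(2) by auto
  then obtain y where y: "y \<in> E" "y \<noteq> \<one>\<^bsub>G\<^esub>" "y \<noteq> u" by blast
  have yL: "y \<in> L" using y E by blast
  have xE: "x \<notin> E" using sq x(2) by blast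
  note G = LG[OF x(1)] LG[OF yL]
  have uG: "u \<in> carrier G" using G by (simp add: u_def)
  have uu: "u \<otimes>\<^bsub>G\<^esub> u = \<one>\<^bsub>G\<^esub>" by (rule sq[OF u(1)])
  have yy: "y \<otimes>\<^bsub>G\<^esub> y = \<one>\<^bsub>G\<^esub>" by (rule sq[OF y(1)])
  have p2: "x [^]\<^bsub>G\<^esub> (2::nat) = u" using square_eq[OF G(1)] by (simp add: u_def)
  have p3: "x [^]\<^bsub>G\<^esub> (3::nat) = u \<otimes>\<^bsub>G\<^esub> x" using p2 by (simp add: numeral_3_eq_3 numeral_2_eq_2)
  have p4: "x [^]\<^bsub>G\<^esub> (4::nat) = \<one>\<^bsub>G\<^esub>"
  proof -
    have "x [^]\<^bsub>G\<^esub> (4::nat) = x [^]\<^bsub>G\<^esub> (2::nat) \<otimes>\<^bsub>G\<^esub> x [^]\<^bsub>G\<^esub> (2::nat)" using G by (simp add: G.nat_pow_mult)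
    then show ?thesis using p2 uu by simp
  qed
  have x1: "x \<noteq> \<one>\<^bsub>G\<^esub>" using x(2) by auto
  have ux1: "u \<otimes>\<^bsub>G\<^esub> x \<noteq> \<one>\<^bsub>G\<^esub>"
  proof
    assume "u \<otimes>\<^bsub>G\<^esub> x = \<one>\<^bsub>G\<^esub>"
    then have "u \<otimes>\<^bsub>G\<^esub> x = u \<otimes>\<^bsub>G\<^esub> u" using uu by simp
    then have "x = u" using G uG by simp
    then show False using xE u by simp
  qed
  have inv_y: "a = y" if "a \<otimes>\<^bsub>G\<^esub> y = \<one>\<^bsub>G\<^esub>" "a \<in> carrier G" for a
  proof -
    have "a \<otimes>\<^bsub>G\<^esub> y = y \<otimes>\<^bsub>G\<^esub> y" using that yy by simp
    then show ?thesis using that(2) G by simp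
  qed
  have ux_y: "u \<otimes>\<^bsub>G\<^esub> x \<noteq> y"
  proof
    assume eq: "u \<otimes>\<^bsub>G\<^esub> x = y"
    have uL: "u \<in> L" using u E by blast
    have "y \<otimes>\<^bsub>G\<^esub> y = u \<otimes>\<^bsub>G\<^esub> (x \<otimes>\<^bsub>G\<^esub> u) \<otimes>\<^bsub>G\<^esub> x" using G uG by (simp add: eq[symmetric] G.m_assoc)
    also have "x \<otimes>\<^bsub>G\<^esub> u = u \<otimes>\<^bsub>G\<^esub> x" by (rule comm[OF x(1) uL])
    also have "u \<otimes>\<^bsub>G\<^esub> (u \<otimes>\<^bsub>G\<^esub> x) \<otimes>\<^bsub>G\<^esub> x = (u \<otimes>\<^bsub>G\<^esub> u) \<otimes>\<^bsub>G\<^esub> u" using G uG by (simp add: u_def G.m_assoc)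
    finally show False using yy uu u uG by simp
  qed
  show ?thesis
  proof (rule G.iso_integer_mod_groups[OF L(1,2)])
    show "a = 0 \<and> b = 0" if ab: "a < 4" "b < 2" "x [^]\<^bsub>G\<^esub> a \<otimes>\<^bsub>G\<^esub> y [^]\<^bsub>G\<^esub> b = \<one>\<^bsub>G\<^esub>" for a b :: nat
    proof -
      have a: "a = 0 \<or> a = 1 \<or> a = 2 \<or> a = 3" using ab(1) by auto
      have b: "b = 0 \<or> b = 1" using ab(2) by auto
      show ?thesis
      proof (cases "b = 0")
        case True
        then have "x [^]\<^bsub>G\<^esub> a = \<one>\<^bsub>G\<^esub>" using ab(3) G by simp
        then show ?thesis using a True x1 u(2) ux1 p2 p3 G by auto
      next
        case False
        then have "x [^]\<^bsub>G\<^esub> a = y" using ab(3) b G inv_y[of "x [^]\<^bsub>G\<^esub> a"] by simp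
        then have False using a y p2 p3 ux_y xE G by auto
        then show ?thesis ..
      qed
    qed
  qed (use L(3) x(1) yL comm p4 yy square_eq G in simp_all)
qed

section \<open>From the group-theoretic conditions to the index\<close>

lemma index_of_chain:
  assumes A: "DH 2 = A" and B: "DH 3 = B" and DH4: "DH 4 = {\<one>\<^bsub>G\<^esub>}"
    and card: "card D = p ^ a" "card A = p ^ b" "card B = p ^ d"
  shows "upper_Lie_nilpotency_index KG = (p - 1) * (a + b + d) + 2"
proof -
  have "DH.ht 1 = a" "DH.ht 2 = b" "DH.ht 3 = d" "DH.ht 4 = 0"
    using A B DH4 card DH.H_1 by (auto intro: DH.ht_eq)
  moreover have "{1..4::nat} = {1, 2, 3, 4}" by auto
  ultimately have "(\<Sum>j\<in>{1..4}. DH.ht j) = a + b + d" by simp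
  then show ?thesis using DH_index[OF DH4] by simp
qed

lemma index_4:
  assumes p: "p = 2" and cl: "nilpotency_class G = 2" and nc: "\<not> cyclic_group (lower_central_group G 2)"
    and D: "card D = 4"
  shows "upper_Lie_nilpotency_index KG + p = card D + 2"
proof -
  have l3: "lower_central G 3 = {\<one>\<^bsub>G\<^esub>}" by (rule nilpotency_class_imp(1)[OF cl])
  have cen: "gcomm G x g = \<one>\<^bsub>G\<^esub>" if "x \<in> D" "g \<in> carrier G" for x g
    using gcomm_lower_central(1)[OF that] l3 by simp
  have sq: "x [^]\<^bsub>G\<^esub> p = \<one>\<^bsub>G\<^esub>" if "x \<in> D" for x
    unfolding p by (rule exponent_2_of_not_cyclic_4[OF p D nc that])
  note c = chain_series_trivial[OF cen sq]
  have "upper_Lie_nilpotency_index KG = (p - 1) * (2 + 0 + 0) + 2"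
    by (rule index_of_chain) ((rule c; assumption) | simp add: D p)+
  then show ?thesis using p D by simp
qed

lemma card_strict_chain:
  assumes L: "subgroup L G" "L \<subseteq> D" and M: "subgroup M G" "M \<subseteq> L" "M \<noteq> L" and card: "card L = p ^ Suc k"
  shows "\<exists>j\<le>k. card M = p ^ j"
proof -
  have "finite L" using L(2) finite_D by (rule finite_subset)
  then have "card M < card L" using M by (intro psubset_card_mono) auto
  moreover obtain j where j: "card M = p ^ j" using card_subgroup_D[OF M(1)] M(2) L(2) by blast
  ultimately have "p ^ j < p ^ Suc k" using card by simp
  then have "j < Suc k" using prime_gt_1_nat[OF prime_p] by (simp only: power_strict_increasing_iff)
  then show ?thesis using j by (intro exI[of _ j]) simp
qed

lemma card_ne_1: "subgroup L G \<Longrightarrow> L \<noteq> {\<one>\<^bsub>G\<^esub>} \<Longrightarrow> card L = p ^ j \<Longrightarrow> j \<noteq> 0"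
proof
  assume L: "subgroup L G" "L \<noteq> {\<one>\<^bsub>G\<^esub>}" "card L = p ^ j" "j = 0"
  then have "card L = 1" by simp
  then obtain a where "L = {a}" by (auto simp: card_1_singleton_iff)
  then show False using L(2) subgroup.one_closed[OF L(1)] by simp
qed

lemma lower_central_3_D: "lower_central G 3 \<subseteq> D" and lower_central_4_3: "lower_central G 4 \<subseteq> lower_central G 3"
  and lower_central_4_D: "lower_central G 4 \<subseteq> D"
  using lower_central_3 DH.H_D[of 2] lower_central_4 DH.H_D[of 3] G.lower_central_antimono[of 3 4] by auto

text \<open>The third lower central term is proper and nontrivial in a group of order 9, so it has
  order 3 and the heights are 2 and 1. The index is
  \<open>2 (2 + 1) + 2 = 8 = 9 - 3 + 2\<close>.\<close>

lemma index_9: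
  assumes p: "p = 3" and cl: "nilpotency_class G = 3" and el: "elementary_abelian 3 (lower_central_group G 2)"
    and D: "card D = 9"
  shows "upper_Lie_nilpotency_index KG + p = card D + 2"
proof -
  have l: "lower_central G 4 = {\<one>\<^bsub>G\<^esub>}" "lower_central G 3 \<noteq> {\<one>\<^bsub>G\<^esub>}" using nilpotency_class_imp(2)[OF cl] by auto
  have comm: "x \<otimes>\<^bsub>G\<^esub> y = y \<otimes>\<^bsub>G\<^esub> x" if "x \<in> D" "y \<in> D" for x y
    using el that by (simp add: elementary_abelian_D_iff)
  have pow: "x [^]\<^bsub>G\<^esub> p = \<one>\<^bsub>G\<^esub>" if "x \<in> D" for x
    using el that p by (simp add: elementary_abelian_D_iff)
  have cen: "gcomm G x g = \<one>\<^bsub>G\<^esub>" if "x \<in> lower_central G 3" "g \<in> carrier G" for x g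
    using gcomm_lower_central(2)[OF that] l by simp
  have "lower_central G 3 \<noteq> D"
    using lower_central_proper[of 2, unfolded Suc_numerals lower_central_2] l(2) by auto
  from card_strict_chain[OF derived_subgroup order.refl G.lower_central_subgroup lower_central_3_D this, of 1]
  obtain j where j: "j \<le> 1" "card (lower_central G 3) = p ^ j" using D p by auto
  have "j = 1" using card_ne_1[OF G.lower_central_subgroup l(2) j(2)] j(1) by simp
  have pow3: "x [^]\<^bsub>G\<^esub> p = \<one>\<^bsub>G\<^esub>" if "x \<in> lower_central G 3" for x
    using pow[OF subsetD[OF lower_central_3_D that]] .
  have powD: "x [^]\<^bsub>G\<^esub> p \<in> lower_central G 3" if "x \<in> D" for x
    unfolding pow[OF that] by (rule G.lower_central_one)
  note ch = chain_series_short[OF G.lower_central_subgroup lower_central_3 comm gcomm_lower_central(1) cen powD pow pow3]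
  have c: "DH 2 = lower_central G 3" "DH 3 = {\<one>\<^bsub>G\<^esub>}" "DH 4 = {\<one>\<^bsub>G\<^esub>}"
    by (rule ch; assumption)+
  have "upper_Lie_nilpotency_index KG = (p - 1) * (2 + 1 + 0) + 2"
    by (rule index_of_chain[OF c(1,2,3)]) (use D p j \<open>j = 1\<close> in simp_all)
  then show ?thesis using p D by simp
qed

text \<open>Class 4 gives a strict chain of length three below the group of order 8, so the orders
  are 8, 4, 2. The chain is admissible, hence it is the Lie dimension series, and the index is
  \<open>3 + 2 + 1 + 2 = 8 = 8 - 2 + 2\<close>.\<close>

lemma index_8:
  assumes p: "p = 2" and cl: "nilpotency_class G = 4" and D: "card D = 8"
    and comm: "\<And>x y. x \<in> D \<Longrightarrow> y \<in> D \<Longrightarrow> x \<otimes>\<^bsub>G\<^esub> y = y \<otimes>\<^bsub>G\<^esub> x"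
    and sqD: "\<And>x. x \<in> D \<Longrightarrow> x \<otimes>\<^bsub>G\<^esub> x \<in> lower_central G 3"
    and sq: "\<And>x. x \<in> lower_central G 3 \<Longrightarrow> x \<otimes>\<^bsub>G\<^esub> x = \<one>\<^bsub>G\<^esub>"
  shows "upper_Lie_nilpotency_index KG + p = card D + 2"
proof -
  have l: "lower_central G 5 = {\<one>\<^bsub>G\<^esub>}" "lower_central G 4 \<noteq> {\<one>\<^bsub>G\<^esub>}" using nilpotency_class_imp(3)[OF cl] by auto
  have cen: "gcomm G x g = \<one>\<^bsub>G\<^esub>" if "x \<in> lower_central G 4" "g \<in> carrier G" for x g
    using gcomm_lower_central(3)[OF that] l by simp
  have l3: "lower_central G 3 \<noteq> {\<one>\<^bsub>G\<^esub>}" using l(2) lower_central_4_3 G.lower_central_one[of 4] by auto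
  have n3: "lower_central G 3 \<noteq> D"
    using lower_central_proper[of 2, unfolded Suc_numerals lower_central_2] l3 by auto
  have n4: "lower_central G 4 \<noteq> lower_central G 3"
    using lower_central_proper[of 3, unfolded Suc_numerals] l3 by auto
  from card_strict_chain[OF derived_subgroup order.refl G.lower_central_subgroup lower_central_3_D n3, of 2]
  obtain j where j: "j \<le> 2" "card (lower_central G 3) = p ^ j" using D p by auto
  have "j \<noteq> 0" by (rule card_ne_1[OF G.lower_central_subgroup l3 j(2)])
  then obtain j' where j': "j = Suc j'" "j' \<le> 1" using j(1) by (cases j) auto
  from card_strict_chain[OF G.lower_central_subgroup lower_central_3_D G.lower_central_subgroup lower_central_4_3 n4, of j']
  obtain k where k: "k \<le> j'" "card (lower_central G 4) = p ^ k" using j(2) j' by auto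
  have "k \<noteq> 0" by (rule card_ne_1[OF G.lower_central_subgroup l(2) k(2)])
  then have jk: "k = 1" "j = 2" using k j' by auto
  note ch = chain_series[of "lower_central G 3" "lower_central G 4", OF G.lower_central_subgroup lower_central_3
      G.lower_central_subgroup lower_central_4 lower_central_4_3]
  have pD: "x [^]\<^bsub>G\<^esub> p \<in> lower_central G 3" if "x \<in> D" for x
    unfolding p square_eq[OF derived_G[OF that]] by (rule sqD[OF that])
  have pA: "x [^]\<^bsub>G\<^esub> p = \<one>\<^bsub>G\<^esub>" if "x \<in> lower_central G 3" for x
  proof -
    have "x \<in> carrier G" using that lower_central_3_D derived_G by blast
    then show ?thesis unfolding p square_eq[OF \<open>x \<in> carrier G\<close>] using sq[OF that] by simp
  qed
  have pD': "x [^]\<^bsub>G\<^esub> p = \<one>\<^bsub>G\<^esub>" if "p \<noteq> 2" for x using that p by simp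
  note ch' = ch[OF comm gcomm_lower_central(1,2) cen pD pD' pA]
  have c: "DH 2 = lower_central G 3" "DH 3 = lower_central G 4" "DH 4 = {\<one>\<^bsub>G\<^esub>}"
    by (rule ch'; assumption)+
  have "upper_Lie_nilpotency_index KG = (p - 1) * (3 + 2 + 1) + 2"
    by (rule index_of_chain[OF c(1,2,3)]) (use D p j k jk in simp_all)
  then show ?thesis using p D by simp
qed

end

section \<open>The characterisation for a Lie nilpotent group algebra in prime
  characteristic\<close>

context nilpotent_group_algebra begin

lemma almost_maximal_iff:
  "upper_Lie_nilpotency_index KG + p = card D + 2 \<longleftrightarrow>
      (p = 2 \<and> nilpotency_class G = 2 \<and>
        \<not> cyclic_group (lower_central_group G 2) \<and> order (lower_central_group G 2) = 4) \<or>
      (p = 2 \<and> nilpotency_class G = 4 \<and>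
        lower_central_group G 2 \<cong> integer_mod_group 4 \<times>\<times> integer_mod_group 2 \<and>
        lower_central_group G 3 \<cong> integer_mod_group 2 \<times>\<times> integer_mod_group 2) \<or>
      (p = 2 \<and> nilpotency_class G = 4 \<and>
        elementary_abelian 2 (lower_central_group G 2) \<and> order (lower_central_group G 2) = 8) \<or>
      (p = 3 \<and> nilpotency_class G = 3 \<and>
        elementary_abelian 3 (lower_central_group G 2) \<and> order (lower_central_group G 2) = 9)"
    (is "_ \<longleftrightarrow> ?i \<or> ?ii \<or> ?iii \<or> ?iv")
proof
  assume "upper_Lie_nilpotency_index KG + p = card D + 2"
  from almost_maximal_shape[OF this] consider
      "p = 2" "card D = 4" "DH 2 = {\<one>\<^bsub>G\<^esub>}"
    | "p = 3" "card D = 9" "card (DH 2) = 3" "DH 3 = {\<one>\<^bsub>G\<^esub>}"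
    | "p = 2" "card D = 8" "card (DH 2) = 4" "card (DH 3) = 2" "DH 4 = {\<one>\<^bsub>G\<^esub>}"
    by blast
  then show "?i \<or> ?ii \<or> ?iii \<or> ?iv"
  proof cases
    case 1
    then show ?thesis using shape_4 order_D by simp
  next
    case 2
    then show ?thesis using shape_9 order_D by simp
  next
    case 3
    note sh = shape_8[OF 3]
    show ?thesis
    \<comment> \<open>Conditions (ii) and (iii) share all orders and the class; they differ only in
      whether \<open>G'\<close> has exponent 2.\<close>
    proof (cases "\<forall>x\<in>D. x \<otimes>\<^bsub>G\<^esub> x = \<one>\<^bsub>G\<^esub>")
      case True
      have "elementary_abelian 2 (lower_central_group G 2)"
        unfolding elementary_abelian_D_iff using True sh(3) square_eq[OF derived_G] by simp
      then show ?thesis using 3 sh(1) order_D by simp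
    next
      case False
      then obtain x where x: "x \<in> D" "x \<otimes>\<^bsub>G\<^esub> x \<noteq> \<one>\<^bsub>G\<^esub>" by blast
      have DH2_D: "DH 2 \<subseteq> D" by (rule DH.H_D)
      have "lower_central_group G 2 \<cong> integer_mod_group 4 \<times>\<times> integer_mod_group 2"
        unfolding lower_central_group_def lower_central_2
        by (rule iso_4_2[OF derived_subgroup finite_D 3(2) DH2_D 3(3) sh(3,4,5) x])
      moreover have "lower_central_group G 3 \<cong> integer_mod_group 2 \<times>\<times> integer_mod_group 2"
        unfolding lower_central_group_def sh(2)
        by (rule iso_2_2[OF DH.H_subgroup DH.H_finite 3(3) sh(3) sh(5)]) (use DH2_D in auto)
      ultimately show ?thesis using 3 sh(1) by simp
    qed
  qed
next
  have l3: "x \<in> D" "x \<in> carrier G" if "x \<in> lower_central G 3" for x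
    using subsetD[OF lower_central_3_D that] derived_G by auto
  assume "?i \<or> ?ii \<or> ?iii \<or> ?iv"
  then consider ?i | ?ii | ?iii | ?iv by blast
  then show "upper_Lie_nilpotency_index KG + p = card D + 2"
  proof cases
    case 1
    then show ?thesis using index_4 order_D by simp
  next
    case 2
    let ?H = "lower_central_group G 2" and ?L = "lower_central_group G 3"
    have H: "group ?H" "carrier ?H = D" "\<one>\<^bsub>?H\<^esub> = \<one>\<^bsub>G\<^esub>" "monoid.mult ?H = monoid.mult G"
      using subgroup_facts(1)[OF derived_subgroup] by (simp_all add: lower_central_group_def lower_central_2)
    have L: "group ?L" "carrier ?L = lower_central G 3" "\<one>\<^bsub>?L\<^esub> = \<one>\<^bsub>G\<^esub>" "monoid.mult ?L = monoid.mult G"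
      using subgroup_facts(1)[OF G.lower_central_subgroup[of 3]] by (simp_all add: lower_central_group_def)
    from 2 have iso: "?H \<cong> integer_mod_group 4 \<times>\<times> integer_mod_group 2" "?L \<cong> integer_mod_group 2 \<times>\<times> integer_mod_group 2"
      by auto
    note F = integer_mod_4_2_facts[OF H(1) iso(1), unfolded H(2,3,4)]
    note F' = integer_mod_2_2_facts[OF L(1) iso(2), unfolded L(2,3,4)]
    \<comment> \<open>C_4 x C_2 has exactly four elements with trivial square, and the third lower
      central term consists of four such elements. As fourth powers are trivial, it contains all
      squares, which is what \<open>index_8\<close> asks for.\<close>
    have "lower_central G 3 = {x \<in> D. x \<otimes>\<^bsub>G\<^esub> x = \<one>\<^bsub>G\<^esub>}"
      using F(3) F' l3 finite_D by (intro card_subset_eq) auto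
    then have "x \<otimes>\<^bsub>G\<^esub> x \<in> lower_central G 3" if "x \<in> D" for x
      using F(4)[OF that] subgroup.m_closed[OF derived_subgroup that that] by simp
    then show ?thesis using 2 F(1,2) F'(2) by (intro index_8) auto
  next
    case 3
    then have el: "elementary_abelian 2 (lower_central_group G 2)" by blast
    have sq: "x \<otimes>\<^bsub>G\<^esub> x = \<one>\<^bsub>G\<^esub>" if "x \<in> D" for x
      using el that square_eq[OF derived_G[OF that]] by (simp add: elementary_abelian_D_iff)
    show ?thesis
    proof (rule index_8)
      show "x \<otimes>\<^bsub>G\<^esub> y = y \<otimes>\<^bsub>G\<^esub> x" if "x \<in> D" "y \<in> D" for x y
        using el that by (simp add: elementary_abelian_D_iff)
      show "x \<otimes>\<^bsub>G\<^esub> x \<in> lower_central G 3" if "x \<in> D" for x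
        unfolding sq[OF that] by (rule G.lower_central_one)
      show "x \<otimes>\<^bsub>G\<^esub> x = \<one>\<^bsub>G\<^esub>" if "x \<in> lower_central G 3" for x by (rule sq[OF l3(1)[OF that]])
    qed (use 3 order_D in auto)
  next
    case 4
    then show ?thesis using index_9 order_D by simp
  qed
qed

end

section \<open>The characteristic is prime, and the conclusion\<close>

lemma (in field) ring_char_prime:
  assumes "ring_char R > 0"
  shows "Factorial_Ring.prime (ring_char R)" and "add_pow R (ring_char R) \<one> = \<zero>"
proof -
  let ?P = "\<lambda>n::nat. n > 0 \<and> add_pow R n \<one> = \<zero>"
  have ex: "\<exists>n. ?P n" using assms by (auto simp: ring_char_def split: if_splits)
  then have p: "ring_char R = (LEAST n. ?P n)" by (auto simp: ring_char_def)
  have P: "?P (ring_char R)" unfolding p by (rule LeastI_ex[OF ex])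
  show "add_pow R (ring_char R) \<one> = \<zero>" using P by blast
  have least: "ring_char R \<le> n" if "?P n" for n unfolding p using that by (rule Least_le)
  have "ring_char R \<noteq> 1"
  proof
    assume "ring_char R = 1"
    then show False using P one_not_zero by (simp add: add.nat_pow_eone)
  qed
  then have p1: "ring_char R > 1" using assms by simp
  have "m = 1 \<or> m = ring_char R" if "m dvd ring_char R" for m
  proof -
    from that obtain k where k: "ring_char R = m * k" by blast
    then have mk: "m > 0" "k > 0" using assms by (auto intro: Nat.gr0I)
    have "add_pow R m \<one> \<otimes> add_pow R k \<one> = add_pow R m (add_pow R k \<one>)"
      by (simp add: add_pow_ldistr)
    also have "\<dots> = add_pow R (k * m) \<one>" by (rule add.nat_pow_pow) simp
    also have "\<dots> = \<zero>" using P k by (simp add: mult.commute)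
    finally have "add_pow R m \<one> = \<zero> \<or> add_pow R k \<one> = \<zero>" by (intro integral) simp_all
    then show ?thesis
    proof
      assume "add_pow R m \<one> = \<zero>"
      then have "ring_char R \<le> m" using mk by (intro least) simp
      then show ?thesis using dvd_imp_le[OF that] assms by simp
    next
      assume "add_pow R k \<one> = \<zero>"
      then have "ring_char R \<le> k" using mk by (intro least) simp
      then have "m * k \<le> 1 * k" using k by simp
      then show ?thesis using mk by simp
    qed
  qed
  with p1 show "Factorial_Ring.prime (ring_char R)" by (simp add: prime_nat_iff)
qed

theorem theorem1:
  fixes K :: "('k, 'm) ring_scheme" and G :: "('g, 'n) monoid_scheme" and p :: nat
  assumes "field K" and "ring_char K = p" and "p > 0"
    and "group G" and "Lie_nilpotent (group_algebra K G)"
  shows "upper_almost_maximal K G \<longleftrightarrow>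
      (p = 2 \<and> nilpotency_class G = 2 \<and>
        \<not> cyclic_group (lower_central_group G 2) \<and> order (lower_central_group G 2) = 4) \<or>
      (p = 2 \<and> nilpotency_class G = 4 \<and>
        lower_central_group G 2 \<cong> integer_mod_group 4 \<times>\<times> integer_mod_group 2 \<and>
        lower_central_group G 3 \<cong> integer_mod_group 2 \<times>\<times> integer_mod_group 2) \<or>
      (p = 2 \<and> nilpotency_class G = 4 \<and>
        elementary_abelian 2 (lower_central_group G 2) \<and> order (lower_central_group G 2) = 8) \<or>
      (p = 3 \<and> nilpotency_class G = 3 \<and>
        elementary_abelian 3 (lower_central_group G 2) \<and> order (lower_central_group G 2) = 9)"
proof -
  interpret F: field K by fact
  interpret Gr: group G by fact
  have GA: "group_algebra_over K G"
    by (intro group_algebra_over.intro F.is_cring assms(4))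
  interpret GA: group_algebra_over K G by (rule GA)
  have "modular_group_algebra K G p"
    using GA F.ring_char_prime assms(2,3) F.one_not_zero
    by (auto simp: modular_group_algebra_def modular_group_algebra_axioms_def)
  moreover note GA.Lie_nilpotent_consequences[OF assms(5) F.one_not_zero]
  ultimately interpret N: nilpotent_group_algebra K G p
    by (intro nilpotent_group_algebra.intro nilpotent_group_algebra_axioms.intro)
  \<comment> \<open>Moving \<open>p\<close> to the other side turns the equation over the integers
    into one over the naturals without truncated subtraction.\<close>
  have "upper_almost_maximal K G \<longleftrightarrow>
      upper_Lie_nilpotency_index (group_algebra K G) + p = card (derived G (carrier G)) + 2"
    unfolding upper_almost_maximal_def assms(2) by linarith
  then show ?thesis using N.almost_maximal_iff by (simp only:)
qed

end
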